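(* Let $\mu$ be a non-trivial $d\times d$ matrix measure on $\mathbb{T}$ with Schur function $f$, Verblunsky coefficients $(\alpha_i)_{i\ge0}$, iterates $f_i$, inverse iterates $b_i$ and CMV bases $(\chi_i)$, $(x_i)$. For integers $0\le j\le k$ let $\mu_{[j,k]}$ and $\hat\mu_{[j,k]}$ be the $(k-j+1)d\times(k-j+1)d$ matrix measures with $d\times d$ blocks $(\mu_{[j,k]})_{r,s}=\chi_r^\dagger\,d\mu\,\chi_s$ and $(\hat\mu_{[j,k]})_{r,s}=x_r^\dagger\,d\mu\,x_s$, $j\le r,s\le k$, and let $f_{[j,k]}$, $\hat f_{[j,k]}$ be their Schur functions. Then $$f_{[j,k]}=\begin{cases}(b_j\oplus\mathbb{1}_{k-j})\,\mathcal{C}_{(j,k)}^\dagger\,(\mathbb{1}_{k-j}\oplus f_k), & j,k\text{ even},\\ (\mathbb{1}_{k-j}\oplus f_k)\,\mathcal{C}_{(j,k)}^\dagger\,(b_j\oplus\mathbb{1}_{k-j}), & j,k\text{ odd},\\ (b_j\oplus\mathbb{1}_{k-j-1}\oplus f_k)\,\mathcal{C}_{(j,k)}^\dagger, & j\text{ even},\ k\text{ odd},\\ \mathcal{C}_{(j,k)}^\dagger\,(b_j\oplus\mathbb{1}_{k-j-1}\oplus f_k), & j\text{ odd},\ k\text{ even},\end{cases}$$ and $$\hat f_{[j,k]}=\begin{cases}(b_j\oplus\mathbb{1}_{k-j})\,\hat{\mathcal{C}}_{(j,k)}^\dagger\,(\mathbb{1}_{k-j}\oplus f_k), & j,k\text{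 odd},\\ (\mathbb{1}_{k-j}\oplus f_k)\,\hat{\mathcal{C}}_{(j,k)}^\dagger\,(b_j\oplus\mathbb{1}_{k-j}), & j,k\text{ even},\\ (b_j\oplus\mathbb{1}_{k-j-1}\oplus f_k)\,\hat{\mathcal{C}}_{(j,k)}^\dagger, & j\text{ odd},\ k\text{ even},\\ \hat{\mathcal{C}}_{(j,k)}^\dagger\,(b_j\oplus\mathbb{1}_{k-j-1}\oplus f_k), & j\text{ even},\ k\text{ odd}.\end{cases}$$ Equivalently, $f_{[j,k]}$ and $\hat f_{[j,k]}$ are obtained by substituting $-\alpha_{j-1}^\dagger\to b_j$ and $\alpha_k\to f_k$ in $\mathcal{C}_{[j,k]}^\dagger$ and $\hat{\mathcal{C}}_{[j,k]}^\dagger$ respectively, where $\mathcal{C}_{[j,k]},\hat{\mathcal{C}}_{[j,k]}$ are the principal $d$-block submatrices of the block CMV matrices of $\mu$ on block rows/columns $j,\dots,k$.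
   Context: Matrix measures, Schur functions, Schur algorithm, non-triviality, Verblunsky coefficients $\alpha_i$ ($\|\alpha_i\|<1$), iterates $f_i$ (Schur function with parameters $(\alpha_i,\alpha_{i+1},\dots)$) and inverse iterates $b_i$ (Schur function with parameters $(-\alpha_{i-1}^\dagger,\dots,-\alpha_0^\dagger,\mathbb{1})$, i.e. the unique Schur function whose matrix Schur algorithm $g_{m+1}(z)=z^{-1}(\rho_m^R)^{-1}(g_m-\beta_m)(\mathbb{1}-\beta_m^\dagger g_m)^{-1}\rho_m^L$, $\beta_m=g_m(0)$, produces these parameters and then terminates at $g_i\equiv\mathbb{1}$; $b_0\equiv\mathbb{1}$) are as follows: a matrix measure $\mu$ on $\mathbb{T}$ takes positive semidefinite $d\times d$ values with $\mu(\mathbb{T})=\mathbb{1}$; its Schur function is $f=z^{-1}(F-\mathbb{1})(F+\mathbb{1})^{-1}$ with $F(z)=\int\frac{t+z}{t-z}d\mu(t)$; $\mu$ is non-trivial if $\int\phi^\dagger d\mu\,\phi\ne0$ for all nonzero vector polynomials $\phi$, and then $f$ has infinitely many Schur parameters $\alpha_i$ with $\|\alpha_i\|<1$; $\rho_i^L=(\mathbb{1}-\alpha_i^\dagger\alpha_i)^{1/2}$, $\rho_i^R=(\mathbb{1}-\alpha_i\alpha_i^\dagger)^{1/2}$. Orthonormal polynomials $\varphi_i^{L},\varphi_i^R$: Gram–Schmidt of $\mathbb{1},z\mathbb{1},\dots$ w.r.t. $\langle\!\langle g|h\rangle\!\rangle_L=\int h\,d\mu\,g^\dagger$, resp. $\langle\!\langle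 g|h\rangle\!\rangle_R=\int g^\dagger d\mu\,h$, with $\varphi_0=\mathbb{1}$ and leading coefficients satisfying $\kappa_{i+1}^L(\kappa_i^L)^{-1}>0$, $(\kappa_i^R)^{-1}\kappa_{i+1}^R>0$. CMV bases: $\chi_{2m}(z)=z^m\varphi_{2m}^L(1/\bar z)^\dagger$, $\chi_{2m+1}(z)=z^{-m}\varphi_{2m+1}^R(z)$, $x_{2m}(z)=z^{-m}\varphi_{2m}^R(z)$, $x_{2m+1}(z)=z^m\varphi_{2m+1}^L(1/\bar z)^\dagger$ (here $p^\dagger(z^{-1})$ means the polynomial with adjoint coefficients evaluated at $z^{-1}$). With $\Theta(\alpha)=\begin{pmatrix}\alpha^\dagger&\rho^L\\ \rho^R&-\alpha\end{pmatrix}$, the block CMV matrices of $\mu$ are $\mathcal{C}=\mathcal{L}\mathcal{M}$, $\hat{\mathcal{C}}=\mathcal{M}\mathcal{L}$ with $\mathcal{L}=\Theta(\alpha_0)\oplus\Theta(\alpha_2)\oplus\cdots$, $\mathcal{M}=\mathbb{1}\oplus\Theta(\alpha_1)\oplus\Theta(\alpha_3)\oplus\cdots$. Finite block CMV matrices for $(\beta_0,\dots,\beta_{N-1})$: $\mathcal{C}_N=\mathcal{L}_N\mathcal{M}_N$, $\hat{\mathcal{C}}_N=\mathcal{M}_N\mathcal{L}_N$ (order $(N+1)d$), where for odd $N$ $\mathcal{L}_N=\Theta(\beta_0)\oplus\Theta(\beta_2)\oplus\cdots\oplus\Theta(\beta_{N-1})$, $\mathcal{M}_N=\mathbb{1}\oplus\Theta(\beta_1)\oplus\cdots\oplus\Theta(\beta_{N-2})\oplus\mathbb{1}$,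 and for even $N$ $\mathcal{L}_N=\Theta(\beta_0)\oplus\cdots\oplus\Theta(\beta_{N-2})\oplus\mathbb{1}$, $\mathcal{M}_N=\mathbb{1}\oplus\Theta(\beta_1)\oplus\cdots\oplus\Theta(\beta_{N-1})$; $\mathcal{C}_0=\hat{\mathcal C}_0=\mathbb{1}$. The unitary truncations are: $\mathcal{C}_{(j,k)}=\mathcal{C}_{k-j}(\alpha_j,\dots,\alpha_{k-1})$ and $\hat{\mathcal{C}}_{(j,k)}=\hat{\mathcal{C}}_{k-j}(\alpha_j,\dots,\alpha_{k-1})$ for even $j$; $\mathcal{C}_{(j,k)}=\hat{\mathcal{C}}_{k-j}(\alpha_j,\dots,\alpha_{k-1})$ and $\hat{\mathcal{C}}_{(j,k)}=\mathcal{C}_{k-j}(\alpha_j,\dots,\alpha_{k-1})$ for odd $j$. $\mathbb{1}_m$ denotes the $md\times md$ identity ($\mathbb{1}_0$ absent), and direct sums are block diagonal. *)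

theory Defs
  imports "HOL-Analysis.Analysis" "Jordan_Normal_Form.Schur_Decomposition"
begin

definition psd_mat :: "nat \<Rightarrow> complex mat \<Rightarrow> bool" where
  "psd_mat n A \<longleftrightarrow> A \<in> carrier_mat n n \<and> mat_adjoint A = A \<and>
     (\<forall>v \<in> carrier_vec n. Re ((A *\<^sub>v v) \<bullet>c v) \<ge> 0)"

definition pd_mat :: "nat \<Rightarrow> complex mat \<Rightarrow> bool" where
  "pd_mat n A \<longleftrightarrow> A \<in> carrier_mat n n \<and> mat_adjoint A = A \<and>
     (\<forall>v \<in> carrier_vec n. v \<noteq> 0\<^sub>v n \<longrightarrow> Re ((A *\<^sub>v v) \<bullet>c v) > 0)"

definition msqrt :: "nat \<Rightarrow> complex mat \<Rightarrow> complex mat" where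
  "msqrt n A = (THE B. psd_mat n B \<and> B * B = A)"

definition minv :: "nat \<Rightarrow> complex mat \<Rightarrow> complex mat" where
  "minv n A = (THE B. B \<in> carrier_mat n n \<and> A * B = 1\<^sub>m n \<and> B * A = 1\<^sub>m n)"

definition dsum :: "complex mat \<Rightarrow> complex mat \<Rightarrow> complex mat" where
  "dsum A B = four_block_mat A (0\<^sub>m (dim_row A) (dim_col B)) (0\<^sub>m (dim_row B) (dim_col A)) B"

definition dsum_list :: "complex mat list \<Rightarrow> complex mat" where
  "dsum_list xs = foldr dsum xs (0\<^sub>m 0 0)"

text \<open>A d x d matrix measure mu on the unit circle is represented by a (scalar, positive)
  Borel measure M on the circle together with a density W, i.e. d mu = W dM.
  (Every matrix measure is of this form, e.g. with M its trace measure.)\<close>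

definition mat_int :: "complex measure \<Rightarrow> nat \<Rightarrow> (complex \<Rightarrow> complex mat) \<Rightarrow> complex mat" where
  "mat_int M n F = Matrix.mat n n (\<lambda>(a,b). integral\<^sup>L M (\<lambda>t. F t $$ (a,b)))"

definition matrix_measure :: "nat \<Rightarrow> complex measure \<Rightarrow> (complex \<Rightarrow> complex mat) \<Rightarrow> bool" where
  "matrix_measure d M W \<longleftrightarrow>
     sets M = sets (restrict_space borel (sphere (0::complex) 1)) \<and>
     (\<forall>t \<in> space M. psd_mat d (W t)) \<and>
     (\<forall>a<d. \<forall>b<d. integrable M (\<lambda>t. W t $$ (a,b))) \<and>
     mat_int M d W = 1\<^sub>m d"

fun vpeval :: "nat \<Rightarrow> complex vec list \<Rightarrow> complex \<Rightarrow> complex vec" where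
  "vpeval d [] z = 0\<^sub>v d"
| "vpeval d (v # vs) z = v + z \<cdot>\<^sub>v vpeval d vs z"

fun mpeval :: "nat \<Rightarrow> complex mat list \<Rightarrow> complex \<Rightarrow> complex mat" where
  "mpeval d [] z = 0\<^sub>m d d"
| "mpeval d (c # cs) z = c + z \<cdot>\<^sub>m mpeval d cs z"

definition nontrivial_mm :: "nat \<Rightarrow> complex measure \<Rightarrow> (complex \<Rightarrow> complex mat) \<Rightarrow> bool" where
  "nontrivial_mm d M W \<longleftrightarrow>
     (\<forall>vs. set vs \<subseteq> carrier_vec d \<and> (\<exists>v \<in> set vs. v \<noteq> 0\<^sub>v d) \<longrightarrow>
        integral\<^sup>L M (\<lambda>t. (W t *\<^sub>v vpeval d vs t) \<bullet>c vpeval d vs t) \<noteq> 0)"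

definition fill0 :: "nat \<Rightarrow> (complex \<Rightarrow> complex mat) \<Rightarrow> complex \<Rightarrow> complex mat" where
  "fill0 n g z = (if z = 0 then Matrix.mat n n (\<lambda>(a,b). Lim (at 0) (\<lambda>w. g w $$ (a,b))) else g z)"

definition carath :: "complex measure \<Rightarrow> (complex \<Rightarrow> complex mat) \<Rightarrow> nat \<Rightarrow> complex \<Rightarrow> complex mat" where
  "carath M V n z = mat_int M n (\<lambda>t. ((t + z) / (t - z)) \<cdot>\<^sub>m V t)"

text \<open>Schur function f = z^{-1} (F - 1)(F + 1)^{-1} (meaningful on the open unit disc).\<close>
definition schur_of :: "complex measure \<Rightarrow> (complex \<Rightarrow> complex mat) \<Rightarrow> nat \<Rightarrow> complex \<Rightarrow> complex mat" where
  "schur_of M V n = fill0 n (\<lambda>z. (1 / z) \<cdot>\<^sub>m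
      ((carath M V n z - 1\<^sub>m n) * minv n (carath M V n z + 1\<^sub>m n)))"

definition schur_fun :: "nat \<Rightarrow> (complex \<Rightarrow> complex mat) \<Rightarrow> bool" where
  "schur_fun d g \<longleftrightarrow> (\<forall>z \<in> ball 0 1. g z \<in> carrier_mat d d) \<and>
     (\<forall>a<d. \<forall>b<d. (\<lambda>z. g z $$ (a,b)) holomorphic_on ball 0 1) \<and>
     (\<forall>z \<in> ball 0 1. psd_mat d (1\<^sub>m d - mat_adjoint (g z) * g z))"

definition schur_step :: "nat \<Rightarrow> (complex \<Rightarrow> complex mat) \<Rightarrow> complex \<Rightarrow> complex mat" where
  "schur_step d g = (let \<beta> = g 0;
       \<rho>L = msqrt d (1\<^sub>m d - mat_adjoint \<beta> * \<beta>);
       \<rho>R = msqrt d (1\<^sub>m d - \<beta> * mat_adjoint \<beta>)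
     in fill0 d (\<lambda>z. (1 / z) \<cdot>\<^sub>m
          (minv d \<rho>R * (g z - \<beta>) * minv d (1\<^sub>m d - mat_adjoint \<beta> * g z) * \<rho>L)))"

definition schur_iter :: "nat \<Rightarrow> (complex \<Rightarrow> complex mat) \<Rightarrow> nat \<Rightarrow> complex \<Rightarrow> complex mat" where
  "schur_iter d g i = (schur_step d ^^ i) g"

definition schur_iterate :: "nat \<Rightarrow> complex measure \<Rightarrow> (complex \<Rightarrow> complex mat) \<Rightarrow> nat \<Rightarrow> complex \<Rightarrow> complex mat" where
  "schur_iterate d M W i = schur_iter d (schur_of M W d) i"

definition verblunsky :: "nat \<Rightarrow> complex measure \<Rightarrow> (complex \<Rightarrow> complex mat) \<Rightarrow> nat \<Rightarrow> complex mat" where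
  "verblunsky d M W i = schur_iterate d M W i 0"

text \<open>Inverse iterates b_i: the unique Schur function with parameters
  (-alpha_{i-1}^dagger, ..., -alpha_0^dagger) whose i-th iterate is identically 1
  (normalised to 0 off the open disc, where it is irrelevant).\<close>
definition inv_iterate :: "nat \<Rightarrow> complex measure \<Rightarrow> (complex \<Rightarrow> complex mat) \<Rightarrow> nat \<Rightarrow> complex \<Rightarrow> complex mat" where
  "inv_iterate d M W i = (THE g. schur_fun d g \<and> (\<forall>z. z \<notin> ball 0 1 \<longrightarrow> g z = 0\<^sub>m d d) \<and>
      (\<forall>m<i. schur_iter d g m 0 = - mat_adjoint (verblunsky d M W (i - 1 - m))) \<and>
      (\<forall>z \<in> ball 0 1. schur_iter d g i z = 1\<^sub>m d))"

definition lip :: "complex measure \<Rightarrow> (complex \<Rightarrow> complex mat) \<Rightarrow> nat \<Rightarrow>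
    (complex \<Rightarrow> complex mat) \<Rightarrow> (complex \<Rightarrow> complex mat) \<Rightarrow> complex mat" where
  "lip M W d g h = mat_int M d (\<lambda>t. h t * W t * mat_adjoint (g t))"

definition rip :: "complex measure \<Rightarrow> (complex \<Rightarrow> complex mat) \<Rightarrow> nat \<Rightarrow>
    (complex \<Rightarrow> complex mat) \<Rightarrow> (complex \<Rightarrow> complex mat) \<Rightarrow> complex mat" where
  "rip M W d g h = mat_int M d (\<lambda>t. mat_adjoint (g t) * W t * h t)"

fun orthL :: "complex measure \<Rightarrow> (complex \<Rightarrow> complex mat) \<Rightarrow> nat \<Rightarrow> nat \<Rightarrow> complex mat list" where
  "orthL M W d 0 = [1\<^sub>m d]"
| "orthL M W d (Suc n) = (THE cs. length cs = n + 2 \<and> set cs \<subseteq> carrier_mat d d \<and>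
      (\<forall>m\<le>n. lip M W d (\<lambda>t. (t ^ m) \<cdot>\<^sub>m 1\<^sub>m d) (mpeval d cs) = 0\<^sub>m d d) \<and>
      lip M W d (mpeval d cs) (mpeval d cs) = 1\<^sub>m d \<and>
      pd_mat d (last cs * minv d (last (orthL M W d n))))"

fun orthR :: "complex measure \<Rightarrow> (complex \<Rightarrow> complex mat) \<Rightarrow> nat \<Rightarrow> nat \<Rightarrow> complex mat list" where
  "orthR M W d 0 = [1\<^sub>m d]"
| "orthR M W d (Suc n) = (THE cs. length cs = n + 2 \<and> set cs \<subseteq> carrier_mat d d \<and>
      (\<forall>m\<le>n. rip M W d (\<lambda>t. (t ^ m) \<cdot>\<^sub>m 1\<^sub>m d) (mpeval d cs) = 0\<^sub>m d d) \<and>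
      rip M W d (mpeval d cs) (mpeval d cs) = 1\<^sub>m d \<and>
      pd_mat d (minv d (last (orthR M W d n)) * last cs))"

definition rev_adj :: "nat \<Rightarrow> complex mat list \<Rightarrow> complex \<Rightarrow> complex mat" where
  "rev_adj d cs z = mpeval d (map mat_adjoint cs) (inverse z)"

definition cmv_chi :: "nat \<Rightarrow> complex measure \<Rightarrow> (complex \<Rightarrow> complex mat) \<Rightarrow> nat \<Rightarrow> complex \<Rightarrow> complex mat" where
  "cmv_chi d M W i z = (if even i then (z ^ (i div 2)) \<cdot>\<^sub>m rev_adj d (orthL M W d i) z
                        else (inverse z ^ (i div 2)) \<cdot>\<^sub>m mpeval d (orthR M W d i) z)"

definition cmv_x :: "nat \<Rightarrow> complex measure \<Rightarrow> (complex \<Rightarrow> complex mat) \<Rightarrow> nat \<Rightarrow> complex \<Rightarrow> complex mat" where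
  "cmv_x d M W i z = (if even i then (inverse z ^ (i div 2)) \<cdot>\<^sub>m mpeval d (orthR M W d i) z
                      else (z ^ (i div 2)) \<cdot>\<^sub>m rev_adj d (orthL M W d i) z)"

definition block_density :: "nat \<Rightarrow> nat \<Rightarrow> nat \<Rightarrow> (nat \<Rightarrow> complex \<Rightarrow> complex mat) \<Rightarrow>
    (complex \<Rightarrow> complex mat) \<Rightarrow> complex \<Rightarrow> complex mat" where
  "block_density d n j B W t = Matrix.mat (n * d) (n * d)
     (\<lambda>(a,b). (mat_adjoint (B (j + a div d) t) * W t * B (j + b div d) t) $$ (a mod d, b mod d))"

definition Theta :: "nat \<Rightarrow> complex mat \<Rightarrow> complex mat" where
  "Theta d a = four_block_mat (mat_adjoint a) (msqrt d (1\<^sub>m d - mat_adjoint a * a))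
                              (msqrt d (1\<^sub>m d - a * mat_adjoint a)) (- a)"

definition LN :: "nat \<Rightarrow> (nat \<Rightarrow> complex mat) \<Rightarrow> nat \<Rightarrow> complex mat" where
  "LN d \<beta> N = dsum (dsum_list (map (\<lambda>i. Theta d (\<beta> (2 * i))) [0..<(N + 1) div 2]))
                    (if even N then 1\<^sub>m d else 0\<^sub>m 0 0)"

definition MN :: "nat \<Rightarrow> (nat \<Rightarrow> complex mat) \<Rightarrow> nat \<Rightarrow> complex mat" where
  "MN d \<beta> N = dsum (1\<^sub>m d) (dsum (dsum_list (map (\<lambda>i. Theta d (\<beta> (2 * i + 1))) [0..<N div 2]))
                    (if odd N then 1\<^sub>m d else 0\<^sub>m 0 0))"

definition CN :: "nat \<Rightarrow> (nat \<Rightarrow> complex mat) \<Rightarrow> nat \<Rightarrow> complex mat" where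
  "CN d \<beta> N = LN d \<beta> N * MN d \<beta> N"

definition CNhat :: "nat \<Rightarrow> (nat \<Rightarrow> complex mat) \<Rightarrow> nat \<Rightarrow> complex mat" where
  "CNhat d \<beta> N = MN d \<beta> N * LN d \<beta> N"

definition cmv_trunc :: "nat \<Rightarrow> (nat \<Rightarrow> complex mat) \<Rightarrow> nat \<Rightarrow> nat \<Rightarrow> complex mat" where
  "cmv_trunc d \<alpha> j k = (if even j then CN d (\<lambda>i. \<alpha> (j + i)) (k - j)
                         else CNhat d (\<lambda>i. \<alpha> (j + i)) (k - j))"

definition cmv_trunc_hat :: "nat \<Rightarrow> (nat \<Rightarrow> complex mat) \<Rightarrow> nat \<Rightarrow> nat \<Rightarrow> complex mat" where
  "cmv_trunc_hat d \<alpha> j k = (if even j then CNhat d (\<lambda>i. \<alpha> (j + i)) (k - j)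
                             else CN d (\<lambda>i. \<alpha> (j + i)) (k - j))"

end

theory Submission
  imports Defs "HOL-Complex_Analysis.Conformal_Mappings" "Jordan_Normal_Form.Spectral_Radius"
begin

text \<open>Let \<open>u\<^sub>r\<close> run through the chosen CMV basis and put \<open>D\<^sub>r\<^sub>s = \<integral> t/(t-z) u\<^sub>r\<^sup>\<dagger> d\<mu> u\<^sub>s\<close>,
  \<open>N\<^sub>r\<^sub>s = \<integral> 1/(t-z) u\<^sub>r\<^sup>\<dagger> d\<mu> u\<^sub>s\<close> for \<open>j \<le> r, s \<le> k\<close>. The Schur function \<open>f\<close> of the block measure is
  characterised by \<open>N = f D\<close>. By the Szego recursion, multiplication by \<open>t\<close> factors into two block diagonal
  transformations with blocks \<open>\<Theta>(\<alpha>\<^sub>i)\<close>, passing through the dual CMV basis; restricted to \<open>j, \<dots>, k\<close> they give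
  \<open>C\<^sup>\<dagger>\<close> up to the two blocks cut at the ends.

  At the right end, orthogonality gives
  \<open>\<integral> 1/(t-z) (\<phi>\<^sub>k\<^sup>R)\<^sup>\<dagger> d\<mu> h = F\<^sub>k(z) \<integral> t/(t-z) (\<phi>\<^sub>k\<^sup>L\<^sup>*)\<^sup>\<dagger> d\<mu> h\<close> for all polynomials \<open>h\<close> of degree at most \<open>k\<close>, with a factor
  independent of \<open>h\<close>. The Szego recursion turns into the Schur algorithm for the \<open>F\<^sub>k\<close>, and \<open>F\<^sub>0 = f\<^sub>0\<close>, so \<open>F\<^sub>k = f\<^sub>k\<close>;
  evaluation at \<open>0\<close> identifies the recursion coefficients with the Schur parameters (Geronimus). At the left end,
  \<open>\<integral> t/(t-z) (\<phi>\<^sub>j\<^sup>L\<^sup>*)\<^sup>\<dagger> d\<mu> h = b\<^sub>j(z) \<integral> t/(t-z) (\<phi>\<^sub>j\<^sup>R)\<^sup>\<dagger> d\<mu> h\<close> for all \<open>h\<close> orthogonal to polynomials of degree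
  below \<open>j\<close>, by induction on \<open>j\<close>. These two relations replace the missing blocks by \<open>f\<^sub>k\<close> and \<open>b\<^sub>j\<close>.\<close>

section \<open>Matrices, positivity and square roots\<close>

text \<open>The characterisation N = f D comes from the kernels: t/(t-z) - z/(t-z) = 1 and t/(t-z) +
  z/(t-z) = (t+z)/(t-z), so D - zN = 1 and the Caratheodory function is F = D + zN; hence F - 1 =
  2zN and F + 1 = 2D. A statement about quotients becomes a set of linear relations between
  pairings, which can be checked one block row at a time because the factors contributed by the two
  ends are the same for every column. Square roots, inverses, orthonormal polynomials and inverse
  iterates are definite descriptions, so each needs an explicit candidate and a uniqueness argument.
  Values of Schur functions at 0 are limits, so identities are computed for z different from 0 and
  extended by continuity at 0. Nothing commutes; the left and right defect roots are linked by the
  intertwining a rhoL = rhoR a, which is obtained from a Sylvester equation. The two CMV bases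
  differ by a shift of parity, so a parameter p in {0, 1} treats both formulas at once.\<close>

lemma dim_mat_adjoint [simp]: "dim_row (mat_adjoint A) = dim_col A" "dim_col (mat_adjoint A) = dim_row A"
  by (simp_all add: mat_adjoint_def)

lemma mat_adjoint_carrier [simp, intro]: "A \<in> carrier_mat n m \<Longrightarrow> mat_adjoint A \<in> carrier_mat m n"
  by auto

lemma index_mat_adjoint [simp]:
  "i < dim_col A \<Longrightarrow> j < dim_row A \<Longrightarrow> mat_adjoint A $$ (i, j) = conjugate (A $$ (j, i))"
  by (simp add: mat_adjoint_def mat_of_rows_index)

lemma mat_adjoint_mat_adjoint [simp]: "mat_adjoint (mat_adjoint A) = A"
  by (rule eq_matI) auto

text \<open>The side conditions are equations between dimensions instead of memberships in
  \<open>carrier_mat\<close>, so that these rules can rewrite long products without a dimension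
  having to be guessed.\<close>

lemma mat_assoc: "dim_col A = dim_row B \<Longrightarrow> dim_col B = dim_row C \<Longrightarrow> A * B * C = A * (B * C)"
  for A B C :: "'a::semiring_0 mat"
  by (rule assoc_mult_mat) auto

lemma mat_distrib_left: "dim_row B = dim_row C \<Longrightarrow> dim_col B = dim_col C \<Longrightarrow> dim_col A = dim_row B \<Longrightarrow>
    A * (B + C) = A * B + A * C" for A B C :: "'a::semiring_0 mat"
  by (rule mult_add_distrib_mat) auto

lemma mat_distrib_right: "dim_row B = dim_row C \<Longrightarrow> dim_col B = dim_col C \<Longrightarrow> dim_row A = dim_col B \<Longrightarrow>
    (B + C) * A = B * A + C * A" for A B C :: "'a::semiring_0 mat"
  by (rule add_mult_distrib_mat) auto

lemma mat_diff_distrib_left: "dim_row B = dim_row C \<Longrightarrow> dim_col B = dim_col C \<Longrightarrow> dim_col A = dim_row B \<Longrightarrow>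
    A * (B - C) = A * B - A * C" for A B C :: "'a::ring mat"
  by (rule mult_minus_distrib_mat) auto

lemma mat_diff_distrib_right: "dim_row B = dim_row C \<Longrightarrow> dim_col B = dim_col C \<Longrightarrow> dim_row A = dim_col B \<Longrightarrow>
    (B - C) * A = B * A - C * A" for A B C :: "'a::ring mat"
  by (rule minus_mult_distrib_mat) auto

lemma mat_smult_left: "dim_col A = dim_row B \<Longrightarrow> (k \<cdot>\<^sub>m A) * B = k \<cdot>\<^sub>m (A * B)"
  for A B :: "'a::comm_semiring_0 mat"
  by (rule mult_smult_assoc_mat) auto

lemma mat_smult_right: "dim_col A = dim_row B \<Longrightarrow> A * (k \<cdot>\<^sub>m B) = k \<cdot>\<^sub>m (A * B)"
  for A B :: "'a::comm_semiring_0 mat"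
  by (rule mult_smult_distrib) auto

lemma mat_uminus_left: "dim_col A = dim_row B \<Longrightarrow> (- A) * B = - (A * B)" for A B :: "'a::ring mat"
  by (rule uminus_mult_left_mat) auto

lemma mat_uminus_right: "dim_col A = dim_row B \<Longrightarrow> A * (- B) = - (A * B)" for A B :: "'a::ring mat"
  by (rule uminus_mult_right_mat) auto

lemma mat_one_left: "dim_row A = n \<Longrightarrow> 1\<^sub>m n * A = A" for A :: "'a::semiring_1 mat"
  by (rule left_mult_one_mat) auto

lemma mat_one_right: "dim_col A = n \<Longrightarrow> A * 1\<^sub>m n = A" for A :: "'a::semiring_1 mat"
  by (rule right_mult_one_mat) auto

lemma mat_adjoint_mult: "dim_col A = dim_row B \<Longrightarrow> mat_adjoint (A * B) = mat_adjoint B * mat_adjoint A"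
  for A B :: "complex mat"
  by (rule eq_matI) (auto simp: scalar_prod_def mult.commute)

lemma mat_adjoint_add: "dim_row A = dim_row B \<Longrightarrow> dim_col A = dim_col B \<Longrightarrow>
    mat_adjoint (A + B) = mat_adjoint A + mat_adjoint B" for A B :: "complex mat"
  by (rule eq_matI) auto

lemma mat_adjoint_diff: "dim_row A = dim_row B \<Longrightarrow> dim_col A = dim_col B \<Longrightarrow>
    mat_adjoint (A - B) = mat_adjoint A - mat_adjoint B" for A B :: "complex mat"
  by (rule eq_matI) auto

lemma mat_adjoint_uminus: "mat_adjoint (- A) = - mat_adjoint A" for A :: "complex mat"
  by (rule eq_matI) auto

lemma mat_adjoint_smult: "mat_adjoint (k \<cdot>\<^sub>m A) = cnj k \<cdot>\<^sub>m mat_adjoint A"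
  by (rule eq_matI) auto

lemma mat_adjoint_one [simp]: "mat_adjoint (1\<^sub>m n) = (1\<^sub>m n :: complex mat)"
  by (rule eq_matI) auto

lemma mat_adjoint_zero [simp]: "mat_adjoint (0\<^sub>m n m) = (0\<^sub>m m n :: complex mat)"
  by (rule eq_matI) auto

lemma mat_uminus_uminus: "- (- A) = A" for A :: "complex mat"
  by (rule eq_matI) auto

lemmas mat_algebra = mat_assoc mat_distrib_left mat_distrib_right mat_diff_distrib_left
  mat_diff_distrib_right mat_smult_left mat_smult_right mat_uminus_left mat_uminus_right
  mat_one_left mat_one_right mat_uminus_uminus

lemmas mat_adj = mat_adjoint_mult mat_adjoint_add mat_adjoint_diff mat_adjoint_uminus mat_adjoint_smult

lemma zero_mat_left: "dim_row A = m \<Longrightarrow> 0\<^sub>m n m * A = 0\<^sub>m n (dim_col A)" for A :: "'a::semiring_0 mat"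
  by (rule left_mult_zero_mat) auto

lemma zero_mat_right: "dim_col A = m \<Longrightarrow> A * 0\<^sub>m m n = 0\<^sub>m (dim_row A) n" for A :: "'a::semiring_0 mat"
  by (rule right_mult_zero_mat) auto

section \<open>Sesquilinear forms of complex matrices\<close>

lemma adjoint_quadratic:
  fixes A X Y :: "complex mat"
  assumes "A \<in> carrier_mat n n" "X \<in> carrier_mat n m" "Y \<in> carrier_mat n l" "i < m" "j < l"
  shows "(mat_adjoint X * A * Y) $$ (i, j) = (A *\<^sub>v col Y j) \<bullet>c col X i"
proof -
  have "(mat_adjoint X * A * Y) $$ (i, j) = (mat_adjoint X * (A * Y)) $$ (i, j)"
    using assms by (subst mat_assoc) auto
  also have "\<dots> = (A *\<^sub>v col Y j) \<bullet>c col X i"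
    using assms by (auto simp: scalar_prod_def mult.commute)
  finally show ?thesis .
qed

lemma cscalar_mult_mat_vec:
  fixes A :: "complex mat"
  assumes "A \<in> carrier_mat n m" "v \<in> carrier_vec m" "w \<in> carrier_vec n"
  shows "(A *\<^sub>v v) \<bullet>c w = v \<bullet>c (mat_adjoint A *\<^sub>v w)"
proof -
  have "(A *\<^sub>v v) \<bullet>c w = (\<Sum>i<n. \<Sum>k<m. A $$ (i,k) * v $ k * cnj (w $ i))"
    using assms by (auto simp: scalar_prod_def sum_distrib_right atLeast0LessThan)
  also have "\<dots> = (\<Sum>k<m. \<Sum>i<n. A $$ (i,k) * v $ k * cnj (w $ i))"
    by (rule sum.swap)
  also have "\<dots> = v \<bullet>c (mat_adjoint A *\<^sub>v w)"
    using assms by (auto simp: scalar_prod_def sum_distrib_left atLeast0LessThan mult_ac)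
  finally show ?thesis .
qed

lemma cscalar_self: "v \<bullet>c v = of_real (\<Sum>i<dim_vec v. (cmod (v $ i))\<^sup>2)" for v :: "complex Matrix.vec"
  by (auto simp: scalar_prod_def atLeast0LessThan complex_norm_square[symmetric])

lemma cscalar_self_nonneg: "Re (v \<bullet>c v) \<ge> 0" for v :: "complex Matrix.vec"
  unfolding cscalar_self by (auto intro: sum_nonneg)

lemma cscalar_self_eq_0:
  fixes v :: "complex Matrix.vec" assumes "v \<in> carrier_vec n" "Re (v \<bullet>c v) \<le> 0" shows "v = 0\<^sub>v n"
proof -
  have "(\<Sum>i<n. (cmod (v $ i))\<^sup>2) = 0"
    using assms by (intro antisym sum_nonneg) (auto simp: cscalar_self)
  then have "\<forall>i<n. v $ i = 0"
    by (subst (asm) sum_nonneg_eq_0_iff) auto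
  then show ?thesis using assms by (intro eq_vecI) auto
qed

section \<open>Positive matrices and inverses\<close>

lemma psd_matD: assumes "psd_mat n A"
  shows "A \<in> carrier_mat n n" "mat_adjoint A = A" "v \<in> carrier_vec n \<Longrightarrow> Re ((A *\<^sub>v v) \<bullet>c v) \<ge> 0"
  using assms by (auto simp: psd_mat_def)

lemma pd_matD: assumes "pd_mat n A"
  shows "A \<in> carrier_mat n n" "mat_adjoint A = A"
    "v \<in> carrier_vec n \<Longrightarrow> v \<noteq> 0\<^sub>v n \<Longrightarrow> Re ((A *\<^sub>v v) \<bullet>c v) > 0"
  using assms by (auto simp: pd_mat_def)

lemma pd_imp_psd: "pd_mat n A \<Longrightarrow> psd_mat n A"
  unfolding pd_mat_def psd_mat_def
  by (metis carrier_vecD index_mult_mat_vec(1) dim_mult_mat_vec less_eq_real_def order_refl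
      conjugate_zero_vec scalar_prod_right_zero mult_mat_vec_carrier zero_carrier_vec zero_complex.simps(1))

lemma psd_adjoint_mult:
  fixes C :: "complex mat"
  assumes "C \<in> carrier_mat m n" shows "psd_mat n (mat_adjoint C * C)"
  unfolding psd_mat_def
proof (intro conjI ballI)
  fix v :: "complex Matrix.vec" assume v: "v \<in> carrier_vec n"
  have "((mat_adjoint C * C) *\<^sub>v v) \<bullet>c v = (mat_adjoint C *\<^sub>v (C *\<^sub>v v)) \<bullet>c v"
    using assms v by (subst assoc_mult_mat_vec) auto
  also have "\<dots> = (C *\<^sub>v v) \<bullet>c (C *\<^sub>v v)"
    using assms v by (subst cscalar_mult_mat_vec) auto
  finally show "Re (((mat_adjoint C * C) *\<^sub>v v) \<bullet>c v) \<ge> 0"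
    by (simp add: cscalar_self_nonneg)
qed (use assms in \<open>auto simp: mat_adj\<close>)

lemma pd_injective:
  assumes "pd_mat n A" "v \<in> carrier_vec n" "A *\<^sub>v v = 0\<^sub>v n" shows "v = 0\<^sub>v n"
  using assms pd_matD(3)[OF assms(1,2)] by (auto simp: scalar_prod_left_zero)

lemma mat_right_inverse_imp_left:
  fixes A B :: "complex mat"
  assumes "A \<in> carrier_mat n n" "B \<in> carrier_mat n n" "A * B = 1\<^sub>m n" shows "B * A = 1\<^sub>m n"
  using mat_mult_left_right_inverse[OF assms] .

text \<open>For square matrices a right inverse is two-sided and unique, hence one multiplication is
  enough to resolve the description \<open>minv\<close>.\<close>

lemma minv_eq:
  assumes "A \<in> carrier_mat n n" "B \<in> carrier_mat n n" "A * B = 1\<^sub>m n"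
  shows "minv n A = B"
  unfolding minv_def
proof (rule the_equality)
  fix C assume C: "C \<in> carrier_mat n n \<and> A * C = 1\<^sub>m n \<and> C * A = 1\<^sub>m n"
  have "C = C * (A * B)" using C right_mult_one_mat[of C n n] by (simp add: assms(3))
  also have "\<dots> = (C * A) * B" using C assms by (subst mat_assoc) auto
  also have "\<dots> = B" using C assms by simp
  finally show "C = B" .
qed (use assms mat_right_inverse_imp_left[OF assms] in auto)

text \<open>Cramer's rule exhibits the entries of the inverse as rational functions of the entries
  of \<open>A\<close>; continuity and holomorphy of inverses are later read off from this
  form.\<close>

lemma minv_cramer:
  assumes A: "A \<in> carrier_mat n n" and det: "Determinant.det A \<noteq> 0"
  shows "minv n A = inverse (Determinant.det A) \<cdot>\<^sub>m adj_mat A"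
proof (rule minv_eq[OF A])
  show "inverse (Determinant.det A) \<cdot>\<^sub>m adj_mat A \<in> carrier_mat n n" using adj_mat(1)[OF A] by simp
  show "A * (inverse (Determinant.det A) \<cdot>\<^sub>m adj_mat A) = 1\<^sub>m n"
    using A adj_mat[OF A] det by (subst mat_smult_right) (auto intro!: eq_matI)
qed

lemma minv_inverse:
  assumes A: "A \<in> carrier_mat n n" and det: "Determinant.det A \<noteq> 0"
  shows "minv n A \<in> carrier_mat n n" "A * minv n A = 1\<^sub>m n" "minv n A * A = 1\<^sub>m n"
proof -
  show 1: "minv n A \<in> carrier_mat n n" using adj_mat(1)[OF A] by (simp add: minv_cramer[OF assms])
  show 2: "A * minv n A = 1\<^sub>m n"
    using A adj_mat[OF A] det unfolding minv_cramer[OF assms]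
    by (subst mat_smult_right) (auto intro!: eq_matI)
  show "minv n A * A = 1\<^sub>m n" by (rule mat_right_inverse_imp_left[OF A 1 2])
qed

lemma det_nonzero_if_injective:
  fixes A :: "complex mat"
  assumes A: "A \<in> carrier_mat n n" and inj: "\<And>v. v \<in> carrier_vec n \<Longrightarrow> A *\<^sub>v v = 0\<^sub>v n \<Longrightarrow> v = 0\<^sub>v n"
  shows "Determinant.det A \<noteq> 0"
  using det_0_iff_vec_prod_zero_field[OF A] inj by auto

lemma det_nonzero_if_right_inverse:
  fixes A B :: "complex mat"
  assumes "A \<in> carrier_mat n n" "B \<in> carrier_mat n n" "A * B = 1\<^sub>m n" shows "Determinant.det A \<noteq> 0"
  using det_mult[OF assms(1,2)] assms(3) by auto

lemma pd_det: assumes "pd_mat n A" shows "Determinant.det A \<noteq> 0"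
  by (rule det_nonzero_if_injective[OF pd_matD(1)[OF assms] pd_injective[OF assms]])

lemma index_mult_adjoint_left:
  fixes X Y :: "complex mat"
  assumes "X \<in> carrier_mat n m" "Y \<in> carrier_mat n l" "i < m" "j < l"
  shows "(mat_adjoint X * Y) $$ (i, j) = col Y j \<bullet>c col X i"
  using assms by (auto simp: scalar_prod_def mult.commute)

text \<open>A basis beginning with \<open>v\<close> is orthogonalised, which leaves its first member
  alone, and then scaled to unit length. The scaling is why column 0 is a nonzero multiple of
  \<open>v\<close> and not \<open>v\<close> itself.\<close>

lemma unitary_completion:
  fixes v :: "complex Matrix.vec"
  assumes v: "v \<in> carrier_vec n" "v \<noteq> 0\<^sub>v n"
  obtains W c where "W \<in> carrier_mat n n" "mat_adjoint W * W = 1\<^sub>m n" "col W 0 = c \<cdot>\<^sub>v v" "c \<noteq> 0"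
proof -
  interpret cof_vec_space n "TYPE(complex)" .
  have n: "n > 0" using v by (cases n) auto
  define b where "b = basis_completion v"
  define ws where "ws = gram_schmidt n b"
  from basis_completion[OF v, folded b_def]
  have dist_b: "distinct b" and indep: "\<not> lin_dep (set b)" and b: "set b \<subseteq> carrier_vec n"
    and hdb: "hd b = v" and len_b: "length b = n" by auto
  from hdb len_b n obtain vs where bv: "b = v # vs" by (cases b, auto)
  from gram_schmidt_result[OF b dist_b indep refl, folded ws_def]
  have ws: "set ws \<subseteq> carrier_vec n" "corthogonal ws" "length ws = n"
    by (auto simp: len_b)
  from gram_schmidt_hd[OF v(1), of vs, folded bv] have hdws: "hd ws = v" unfolding ws_def .
  have ws0: "ws ! 0 = v" using hdws ws(3) n by (cases ws) auto
  define nrm where "nrm i = complex_of_real (sqrt (Re (ws ! i \<bullet>c ws ! i)))" for i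
  define W where "W = Matrix.mat n n (\<lambda>(a, i). inverse (nrm i) * ws ! i $ a)"
  have wsc: "ws ! i \<in> carrier_vec n" if "i < n" for i using ws that by auto
  have orth: "(ws ! i \<bullet>c ws ! j = 0) = (i \<noteq> j)" if "i < n" "j < n" for i j
    using ws(2,3) that by (auto simp: corthogonal_def)
  have sq: "nrm i * nrm i = ws ! i \<bullet>c ws ! i" "nrm i \<noteq> 0" if "i < n" for i
  proof -
    have r: "ws ! i \<bullet>c ws ! i = complex_of_real (Re (ws ! i \<bullet>c ws ! i))"
      by (simp only: cscalar_self Re_complex_of_real)
    have "Re (ws ! i \<bullet>c ws ! i) \<ge> 0" by (rule cscalar_self_nonneg)
    then show "nrm i * nrm i = ws ! i \<bullet>c ws ! i"
      unfolding nrm_def of_real_mult[symmetric] by (subst (3) r) simp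
    with orth[OF that that] show "nrm i \<noteq> 0" by auto
  qed
  have W: "W \<in> carrier_mat n n" by (simp add: W_def)
  have colW: "col W i = inverse (nrm i) \<cdot>\<^sub>v ws ! i" if "i < n" for i
    using that wsc[OF that] by (intro eq_vecI) (auto simp: W_def)
  have "mat_adjoint W * W = 1\<^sub>m n"
  proof (rule eq_matI)
    fix i j assume ij: "i < dim_row (1\<^sub>m n :: complex mat)" "j < dim_col (1\<^sub>m n :: complex mat)"
    then have ij: "i < n" "j < n" by auto
    have "(mat_adjoint W * W) $$ (i, j) = col W j \<bullet>c col W i"
      using W ij by (rule index_mult_adjoint_left[OF W])
    also have "\<dots> = inverse (nrm j) * cnj (inverse (nrm i)) * (ws ! j \<bullet>c ws ! i)"
      using wsc[OF ij(1)] wsc[OF ij(2)]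
      by (simp add: colW ij scalar_prod_def sum_distrib_left mult_ac)
    also have "\<dots> = (1\<^sub>m n) $$ (i, j)"
      using orth[OF ij(2,1)] sq[OF ij(1)] ij
      by (auto simp: nrm_def simp del: of_real_mult) (metis inverse_mult_distrib left_inverse)
    finally show "(mat_adjoint W * W) $$ (i, j) = (1\<^sub>m n) $$ (i, j)" .
  qed (use W in auto)
  with W colW[OF n] sq(2)[OF n] ws0 that show ?thesis by (metis nonzero_imp_inverse_nonzero)
qed

text \<open>Spectral theorem by deflation: a unitary whose first column is an eigenvector splits off
  a 1 x 1 block, and the rest is Hermitian of smaller size.\<close>

lemma hermitian_diagonalize:
  fixes A :: "complex mat"
  assumes "A \<in> carrier_mat n n" "mat_adjoint A = A"
  shows "\<exists>U (r :: nat \<Rightarrow> real). U \<in> carrier_mat n n \<and> mat_adjoint U * U = 1\<^sub>m n \<and>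
    A = U * Matrix.mat n n (\<lambda>(i,j). if i = j then of_real (r i) else 0) * mat_adjoint U"
  using assms
proof (induction n arbitrary: A)
  case 0
  then show ?case by (intro exI[of _ "1\<^sub>m 0"] exI[of _ "\<lambda>_. 0"]) (auto intro!: eq_matI)
next
  case (Suc n A)
  note A = Suc.prems
  obtain e where "eigenvalue A e"
    using spectrum_non_empty[OF A(1)] by (auto simp: spectrum_def)
  then obtain v where v: "v \<in> carrier_vec (Suc n)" "v \<noteq> 0\<^sub>v (Suc n)" "A *\<^sub>v v = e \<cdot>\<^sub>v v"
    using A by (auto simp: eigenvalue_def eigenvector_def)
  from unitary_completion[OF v(1,2)] obtain W c where
    W: "W \<in> carrier_mat (Suc n) (Suc n)" "mat_adjoint W * W = 1\<^sub>m (Suc n)" "col W 0 = c \<cdot>\<^sub>v v" by blast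
  have W': "W * mat_adjoint W = 1\<^sub>m (Suc n)"
    by (rule mat_right_inverse_imp_left[OF mat_adjoint_carrier[OF W(1)] W(1) W(2)])
  define A' where "A' = mat_adjoint W * A * W"
  have A': "A' \<in> carrier_mat (Suc n) (Suc n)" using A W by (auto simp: A'_def)
  have hA': "mat_adjoint A' = A'" using A W by (auto simp: A'_def mat_adj mat_algebra)
  have col0: "A' $$ (i, 0) = (if i = 0 then e else 0)" if "i < Suc n" for i
  proof -
    have "A' $$ (i, 0) = (A *\<^sub>v col W 0) \<bullet>c col W i"
      unfolding A'_def using A W that by (intro adjoint_quadratic) auto
    also have "A *\<^sub>v col W 0 = e \<cdot>\<^sub>v col W 0"
      using A W v by (simp add: mult_mat_vec smult_smult_assoc mult.commute)
    also have "(e \<cdot>\<^sub>v col W 0) \<bullet>c col W i = e * (col W 0 \<bullet>c col W i)"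
      using W(1,3) that v by (intro smult_scalar_prod_distrib[of _ "Suc n"]) auto
    also have "col W 0 \<bullet>c col W i = (mat_adjoint W * W) $$ (i, 0)"
      using W that by (intro index_mult_adjoint_left[symmetric]) auto
    also have "e * \<dots> = (if i = 0 then e else 0)" using that W by auto
    finally show ?thesis .
  qed
  \<comment> \<open>Hermitian symmetry transfers the zeros of the first column to the first row and
    makes the corner entry \<open>e\<close> real.\<close>
  have herm: "A' $$ (i, j) = cnj (A' $$ (j, i))" if "i < Suc n" "j < Suc n" for i j
  proof -
    have "A' $$ (i, j) = mat_adjoint A' $$ (i, j)" by (simp add: hA')
    also have "\<dots> = cnj (A' $$ (j, i))" using that A' by (subst index_mat_adjoint) auto
    finally show ?thesis .
  qed
  have e: "e = of_real (Re e)" using herm[of 0 0] by (simp add: col0 complex_eq_iff)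
  define A3 where "A3 = Matrix.mat n n (\<lambda>(i,j). A' $$ (Suc i, Suc j))"
  have A3: "A3 \<in> carrier_mat n n" "mat_adjoint A3 = A3"
  proof -
    show "mat_adjoint A3 = A3"
    proof (rule eq_matI)
      fix i j assume "i < dim_row A3" "j < dim_col A3"
      then show "mat_adjoint A3 $$ (i, j) = A3 $$ (i, j)"
        using herm[of "Suc i" "Suc j"] by (simp add: A3_def)
    qed (simp_all add: A3_def)
  qed (simp add: A3_def)
  have blk: "A' = four_block_mat (Matrix.mat 1 1 (\<lambda>_. e)) (0\<^sub>m 1 n) (0\<^sub>m n 1) A3"
  proof (rule eq_matI)
    fix i j assume "i < dim_row (four_block_mat (Matrix.mat 1 1 (\<lambda>_. e)) (0\<^sub>m 1 n) (0\<^sub>m n 1) A3)"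
      "j < dim_col (four_block_mat (Matrix.mat 1 1 (\<lambda>_. e)) (0\<^sub>m 1 n) (0\<^sub>m n 1) A3)"
    then have ij: "i < Suc n" "j < Suc n" using A3 by auto
    show "A' $$ (i, j) = four_block_mat (Matrix.mat 1 1 (\<lambda>_. e)) (0\<^sub>m 1 n) (0\<^sub>m n 1) A3 $$ (i, j)"
    proof (cases j)
      case 0
      then show ?thesis using ij col0[OF ij(1)] by (cases i) (simp_all add: A3_def)
    next
      case (Suc j')
      show ?thesis
      proof (cases i)
        case 0
        have "A' $$ (0, j) = 0" using herm[of 0 j] col0[OF ij(2)] ij Suc by simp
        then show ?thesis using ij by (simp add: 0 Suc A3_def)
      qed (use ij in \<open>simp add: Suc A3_def\<close>)
    qed
  qed (use A' A3 in auto)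
  from Suc.IH[OF A3] obtain U and r :: "nat \<Rightarrow> real" where
    U: "U \<in> carrier_mat n n" "mat_adjoint U * U = 1\<^sub>m n" and
    AU: "A3 = U * Matrix.mat n n (\<lambda>(i,j). if i = j then of_real (r i) else 0) * mat_adjoint U" by blast
  let ?D = "Matrix.mat n n (\<lambda>(i,j). if i = j then of_real (r i) else 0)"
  define s where "s i = (case i of 0 \<Rightarrow> Re e | Suc j \<Rightarrow> r j)" for i
  let ?E = "Matrix.mat (Suc n) (Suc n) (\<lambda>(i,j). if i = j then of_real (s i) else 0) :: complex mat"
  define V where "V = four_block_mat (1\<^sub>m 1) (0\<^sub>m 1 n) (0\<^sub>m n 1) U"
  have V: "V \<in> carrier_mat (Suc n) (Suc n)" using U by (auto simp: V_def)
  have adjV: "mat_adjoint V = four_block_mat (1\<^sub>m 1) (0\<^sub>m 1 n) (0\<^sub>m n 1) (mat_adjoint U)"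
    using U by (intro eq_matI) (auto simp: V_def)
  have VV: "mat_adjoint V * V = 1\<^sub>m (Suc n)"
  proof -
    have "mat_adjoint V * V = four_block_mat (1\<^sub>m 1) (0\<^sub>m 1 n) (0\<^sub>m n 1) (1\<^sub>m n)"
      unfolding adjV unfolding V_def
      using U by (subst mult_four_block_mat[of _ 1 1 _ n _ n _ _ 1 _ n]) auto
    then show ?thesis by (auto intro!: eq_matI)
  qed
  have E: "?E = four_block_mat (Matrix.mat 1 1 (\<lambda>_. e)) (0\<^sub>m 1 n) (0\<^sub>m n 1) ?D"
  proof (rule eq_matI)
    fix i j assume "i < dim_row (four_block_mat (Matrix.mat 1 1 (\<lambda>_. e)) (0\<^sub>m 1 n) (0\<^sub>m n 1) ?D)"
      "j < dim_col (four_block_mat (Matrix.mat 1 1 (\<lambda>_. e)) (0\<^sub>m 1 n) (0\<^sub>m n 1) ?D)"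
    then show "?E $$ (i, j) = four_block_mat (Matrix.mat 1 1 (\<lambda>_. e)) (0\<^sub>m 1 n) (0\<^sub>m n 1) ?D $$ (i, j)"
      by (cases i; cases j) (simp_all add: s_def flip: e)
  qed auto
  have A'V: "A' = V * ?E * mat_adjoint V"
  proof -
    have 1: "V * ?E = four_block_mat (Matrix.mat 1 1 (\<lambda>_. e)) (0\<^sub>m 1 n) (0\<^sub>m n 1) (U * ?D)"
      unfolding E V_def using U by (subst mult_four_block_mat[of _ 1 1 _ n _ n _ _ 1 _ n]) auto
    show ?thesis
      unfolding 1 adjV blk AU
      using U by (subst mult_four_block_mat[of _ 1 1 _ n _ n _ _ 1 _ n]) auto
  qed
  have "A = (W * mat_adjoint W) * A * (W * mat_adjoint W)" using A(1) by (simp add: W')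
  also have "\<dots> = W * A' * mat_adjoint W" using A(1) W(1) by (auto simp: A'_def mat_algebra)
  also have "\<dots> = (W * V) * ?E * mat_adjoint (W * V)"
    unfolding A'V using W(1) V by (auto simp: mat_algebra mat_adj)
  finally have "A = (W * V) * ?E * mat_adjoint (W * V)" .
  moreover have "mat_adjoint (W * V) * (W * V) = mat_adjoint V * (mat_adjoint W * W) * V"
    using W(1) V by (simp add: mat_assoc mat_adj)
  then have "mat_adjoint (W * V) * (W * V) = 1\<^sub>m (Suc n)"
    using V by (simp add: W(2) VV mat_algebra)
  moreover have "W * V \<in> carrier_mat (Suc n) (Suc n)" using W V by simp
  ultimately show ?case by blast
qed

definition cdiag :: "nat \<Rightarrow> (nat \<Rightarrow> real) \<Rightarrow> complex mat" where
  "cdiag n r = Matrix.mat n n (\<lambda>(i,j). if i = j then of_real (r i) else 0)"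

lemma cdiag_dim [simp]: "dim_row (cdiag n r) = n" "dim_col (cdiag n r) = n" "cdiag n r \<in> carrier_mat n n"
  by (auto simp: cdiag_def)

lemma cdiag_mult: "cdiag n r * cdiag n s = cdiag n (\<lambda>i. r i * s i)"
  by (rule eq_matI) (auto simp: cdiag_def scalar_prod_def if_distrib[of "\<lambda>x. x * _"] cong: if_cong)

lemma cdiag_adjoint: "mat_adjoint (cdiag n r) = cdiag n r"
  by (rule eq_matI) (auto simp: cdiag_def)

text \<open>The eigenvalue \<open>r i\<close> is the value of the quadratic form of \<open>A\<close>
  at the i-th column of \<open>U\<close>, hence non-negative.\<close>

lemma psd_diagonalize:
  assumes "psd_mat n A"
  obtains U r where "U \<in> carrier_mat n n" "mat_adjoint U * U = 1\<^sub>m n" "U * mat_adjoint U = 1\<^sub>m n"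
    "A = U * cdiag n r * mat_adjoint U" "\<And>i. i < n \<Longrightarrow> r i \<ge> 0"
proof -
  from hermitian_diagonalize[OF psd_matD(1,2)[OF assms]] obtain U and r :: "nat \<Rightarrow> real" where
    U: "U \<in> carrier_mat n n" "mat_adjoint U * U = 1\<^sub>m n" and A: "A = U * cdiag n r * mat_adjoint U"
    by (auto simp: cdiag_def)
  have "r i \<ge> 0" if i: "i < n" for i
  proof -
    have "mat_adjoint U * A * U = (mat_adjoint U * U) * cdiag n r * (mat_adjoint U * U)"
      unfolding A using U(1) by (auto simp: mat_assoc)
    also have "\<dots> = cdiag n r" by (simp add: U(2) mat_algebra)
    finally have "complex_of_real (r i) = (mat_adjoint U * A * U) $$ (i, i)" using i by (simp add: cdiag_def)
    also have "\<dots> = (A *\<^sub>v col U i) \<bullet>c col U i"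
      using U psd_matD[OF assms] i by (intro adjoint_quadratic) auto
    finally have "r i = Re ((A *\<^sub>v col U i) \<bullet>c col U i)" by (metis Re_complex_of_real)
    then show ?thesis using psd_matD(3)[OF assms, of "col U i"] U(1) i by auto
  qed
  then show ?thesis
    using that[OF U mat_right_inverse_imp_left[OF mat_adjoint_carrier[OF U(1)] U] A] by blast
qed

section \<open>Square roots of positive matrices\<close>

lemma psd_sqrt_exists:
  assumes "psd_mat n A"
  obtains B where "psd_mat n B" "B * B = A"
proof -
  from psd_diagonalize[OF assms] obtain U r where
    U: "U \<in> carrier_mat n n" "mat_adjoint U * U = 1\<^sub>m n" and
    A: "A = U * cdiag n r * mat_adjoint U" and r: "\<And>i. i < n \<Longrightarrow> r i \<ge> 0" by metis
  \<comment> \<open>Fourth roots of the eigenvalues: the wanted root then has the form adj(C) C,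
    which makes its positivity automatic.\<close>
  define C where "C = cdiag n (\<lambda>i. sqrt (sqrt (r i))) * mat_adjoint U"
  have C: "C \<in> carrier_mat n n" using U by (auto simp: C_def)
  have [simp]: "dim_row U = n" "dim_col U = n" using U by auto
  have B: "mat_adjoint C * C = U * cdiag n (\<lambda>i. sqrt (r i)) * mat_adjoint U"
  proof -
    have "mat_adjoint C * C = U * (cdiag n (\<lambda>i. sqrt (sqrt (r i))) * cdiag n (\<lambda>i. sqrt (sqrt (r i)))) * mat_adjoint U"
      by (simp add: C_def mat_adj cdiag_adjoint mat_assoc)
    also have "cdiag n (\<lambda>i. sqrt (sqrt (r i))) * cdiag n (\<lambda>i. sqrt (sqrt (r i))) = cdiag n (\<lambda>i. sqrt (r i))"
      unfolding cdiag_mult by (rule eq_matI) (auto simp: cdiag_def r)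
    finally show ?thesis .
  qed
  have "(mat_adjoint C * C) * (mat_adjoint C * C)
      = U * cdiag n (\<lambda>i. sqrt (r i)) * (mat_adjoint U * U) * cdiag n (\<lambda>i. sqrt (r i)) * mat_adjoint U"
    unfolding B by (simp add: mat_assoc)
  also have "\<dots> = U * (cdiag n (\<lambda>i. sqrt (r i)) * cdiag n (\<lambda>i. sqrt (r i))) * mat_adjoint U"
    by (simp add: U mat_assoc mat_one_left)
  also have "cdiag n (\<lambda>i. sqrt (r i)) * cdiag n (\<lambda>i. sqrt (r i)) = cdiag n r"
    unfolding cdiag_mult by (rule eq_matI) (auto simp: cdiag_def r)
  finally have "(mat_adjoint C * C) * (mat_adjoint C * C) = A" by (simp add: A)
  with psd_adjoint_mult[OF C] that show ?thesis by blast
qed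

text \<open>With a Hermitian root B of A, the form at v is the squared length of Bv; if it vanishes,
  so do Bv and Av = B(Bv).\<close>

lemma psd_quadratic_zero:
  assumes "psd_mat n A" "v \<in> carrier_vec n" "Re ((A *\<^sub>v v) \<bullet>c v) \<le> 0"
  shows "A *\<^sub>v v = 0\<^sub>v n"
proof -
  from psd_sqrt_exists[OF assms(1)] obtain B where B: "psd_mat n B" "B * B = A" .
  note B' = psd_matD(1,2)[OF B(1)]
  have "(A *\<^sub>v v) \<bullet>c v = (B *\<^sub>v (B *\<^sub>v v)) \<bullet>c v"
    using B' assms by (simp flip: B(2))
  also have "\<dots> = (B *\<^sub>v v) \<bullet>c (B *\<^sub>v v)"
    using B' assms by (subst cscalar_mult_mat_vec) auto
  finally have "B *\<^sub>v v = 0\<^sub>v n"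
    using assms B' by (intro cscalar_self_eq_0) auto
  then have "B *\<^sub>v (B *\<^sub>v v) = 0\<^sub>v n" using B' by (auto intro!: eq_vecI)
  then show ?thesis using B' assms by (simp flip: B(2))
qed

lemma psd_injective_imp_pd:
  assumes "psd_mat n A" "\<And>v. v \<in> carrier_vec n \<Longrightarrow> A *\<^sub>v v = 0\<^sub>v n \<Longrightarrow> v = 0\<^sub>v n"
  shows "pd_mat n A"
  unfolding pd_mat_def
proof (intro conjI ballI impI)
  fix v :: "complex Matrix.vec" assume "v \<in> carrier_vec n" "v \<noteq> 0\<^sub>v n"
  then show "Re ((A *\<^sub>v v) \<bullet>c v) > 0"
    using psd_quadratic_zero[OF assms(1)] assms(2) not_le by blast
qed (use psd_matD[OF assms(1)] in auto)

lemma pd_inverse_imp_pd: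
  fixes A :: "complex mat"
  assumes "psd_mat n A" "B \<in> carrier_mat n n" "B * A = 1\<^sub>m n"
  shows "pd_mat n A"
proof (rule psd_injective_imp_pd[OF assms(1)])
  fix v :: "complex Matrix.vec" assume v: "v \<in> carrier_vec n" "A *\<^sub>v v = 0\<^sub>v n"
  have "v = (B * A) *\<^sub>v v" using v assms by simp
  also have "\<dots> = B *\<^sub>v (A *\<^sub>v v)" using v assms psd_matD[OF assms(1)] by (intro assoc_mult_mat_vec) auto
  also have "\<dots> = 0\<^sub>v n" using v assms by (auto intro!: eq_vecI)
  finally show "v = 0\<^sub>v n" .
qed

text \<open>In an eigenbasis of \<open>Q\<close> the equation decouples: a column y satisfies Py =
  -ry with r at least 0, which positive definiteness of \<open>P\<close> permits only for y = 0. It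
  yields both the uniqueness of square roots and the intertwining of the two defect roots.\<close>

lemma sylvester_zero:
  assumes P: "pd_mat n P" and Q: "psd_mat m Q" and X: "X \<in> carrier_mat n m"
    and eq: "P * X + X * Q = 0\<^sub>m n m"
  shows "X = 0\<^sub>m n m"
proof -
  from psd_diagonalize[OF Q] obtain U r where
    U: "U \<in> carrier_mat m m" "mat_adjoint U * U = 1\<^sub>m m" "U * mat_adjoint U = 1\<^sub>m m" and
    QU: "Q = U * cdiag m r * mat_adjoint U" and r: "\<And>i. i < m \<Longrightarrow> r i \<ge> 0" by metis
  note P' = pd_matD(1,2)[OF P]
  have [simp]: "dim_row U = m" "dim_col U = m" "dim_row P = n" "dim_col P = n" "dim_row X = n" "dim_col X = m"
    using U P' X by auto
  define Y where "Y = X * U"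
  have Y: "Y \<in> carrier_mat n m" by (auto simp: Y_def)
  have YD: "P * Y + Y * cdiag m r = 0\<^sub>m n m"
  proof -
    have "P * Y + Y * cdiag m r = (P * X + X * Q) * U"
      by (simp add: Y_def QU mat_assoc mat_distrib_right U(2) mat_one_right)
    then show ?thesis by (simp add: eq zero_mat_left)
  qed
  have "col Y i = 0\<^sub>v n" if i: "i < m" for i
  proof (rule ccontr)
    assume "col Y i \<noteq> 0\<^sub>v n"
    then have "Re ((P *\<^sub>v col Y i) \<bullet>c col Y i) > 0" using pd_matD(3)[OF P] Y i by auto
    moreover have "P *\<^sub>v col Y i = - (of_real (r i) \<cdot>\<^sub>v col Y i)"
    proof (rule eq_vecI)
      fix a assume "a < dim_vec (- (of_real (r i) \<cdot>\<^sub>v col Y i))"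
      then have a: "a < n" using Y by auto
      have "(P * Y + Y * cdiag m r) $$ (a, i) = 0" using YD a i by simp
      then have "(P *\<^sub>v col Y i) $ a + (Y * cdiag m r) $$ (a, i) = 0"
        using a i Y by (simp add: )
      moreover have "(Y * cdiag m r) $$ (a, i) = Y $$ (a, i) * of_real (r i)"
        using a i Y by (simp add: scalar_prod_def cdiag_def if_distrib cong: if_cong)
      ultimately show "(P *\<^sub>v col Y i) $ a = (- (of_real (r i) \<cdot>\<^sub>v col Y i)) $ a"
        using a i Y by (simp add: eq_neg_iff_add_eq_0 mult.commute)
    qed (use Y in auto)
    moreover have "(- (of_real (r i) \<cdot>\<^sub>v col Y i)) \<bullet>c col Y i = - (of_real (r i) * (col Y i \<bullet>c col Y i))"
      using Y i by (simp add: scalar_prod_def sum_distrib_left sum_negf mult_ac)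
    moreover have "Re (of_real (r i) * (col Y i \<bullet>c col Y i)) \<ge> 0"
      using r[OF i] cscalar_self_nonneg[of "col Y i"] by simp
    ultimately show False by simp
  qed
  then have "Y $$ (a, i) = 0" if "a < n" "i < m" for a i
    using that Y by (metis carrier_matD(1) carrier_matD(2) index_col index_zero_vec(1))
  then have "Y = 0\<^sub>m n m" using Y by (intro eq_matI) auto
  then have "Y * mat_adjoint U = 0\<^sub>m n m" by (simp add: zero_mat_left)
  then show ?thesis by (simp add: Y_def mat_assoc U(3) mat_one_right)
qed

text \<open>From B(B - C) + (B - C)C = BB - CC = 0 the difference solves a homogeneous Sylvester
  equation; \<open>B\<close> is definite because its square is.\<close>

lemma pd_sqrt_unique:
  assumes "psd_mat n B" "psd_mat n C" "B * B = C * C" "pd_mat n (C * C)"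
  shows "B = C"
proof -
  note B = psd_matD(1,2)[OF assms(1)] and C = psd_matD(1,2)[OF assms(2)]
  have [simp]: "dim_row B = n" "dim_col B = n" "dim_row C = n" "dim_col C = n" using B C by auto
  have "pd_mat n B"
  proof (rule psd_injective_imp_pd[OF assms(1)])
    fix v :: "complex Matrix.vec" assume v: "v \<in> carrier_vec n" "B *\<^sub>v v = 0\<^sub>v n"
    have "(B * B) *\<^sub>v v = B *\<^sub>v (B *\<^sub>v v)" using v B by (intro assoc_mult_mat_vec) auto
    also have "\<dots> = 0\<^sub>v n" using v B by (auto intro!: eq_vecI)
    finally show "v = 0\<^sub>v n" using pd_injective[OF assms(4) v(1)] by (simp add: assms(3))
  qed
  then have "B - C = 0\<^sub>m n n"
  proof (rule sylvester_zero[OF _ assms(2)])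
    show "B - C \<in> carrier_mat n n" by (rule minus_carrier_mat[OF C(1)])
    show "B * (B - C) + (B - C) * C = 0\<^sub>m n n"
      by (simp add: mat_algebra assms(3)) (rule eq_matI, simp_all del: index_mult_mat(1))
  qed
  then have "\<And>i j. i < n \<Longrightarrow> j < n \<Longrightarrow> (B - C) $$ (i, j) = 0" by simp
  then show "B = C" by (intro eq_matI) auto
qed

lemma msqrt_eq: "psd_mat n B \<Longrightarrow> B * B = A \<Longrightarrow> pd_mat n A \<Longrightarrow> msqrt n A = B"
  unfolding msqrt_def using pd_sqrt_unique by (intro the_equality) auto

lemma msqrt_pd:
  assumes "pd_mat n A"
  shows "pd_mat n (msqrt n A)" "msqrt n A * msqrt n A = A"
proof -
  from psd_sqrt_exists[OF pd_imp_psd[OF assms]] obtain B where B: "psd_mat n B" "B * B = A" .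
  note B' = psd_matD(1,2)[OF B(1)]
  have m: "msqrt n A = B" by (rule msqrt_eq[OF B assms])
  show "msqrt n A * msqrt n A = A" by (simp add: m B)
  have "pd_mat n B"
  proof (rule psd_injective_imp_pd[OF B(1)])
    fix v :: "complex Matrix.vec" assume v: "v \<in> carrier_vec n" "B *\<^sub>v v = 0\<^sub>v n"
    have "A *\<^sub>v v = B *\<^sub>v (B *\<^sub>v v)" unfolding B(2)[symmetric] using v B' by (intro assoc_mult_mat_vec) auto
    also have "\<dots> = 0\<^sub>v n" using v B' by (auto intro!: eq_vecI)
    finally show "v = 0\<^sub>v n" using pd_injective[OF assms v(1)] by simp
  qed
  then show "pd_mat n (msqrt n A)" by (simp add: m)
qed

text \<open>Substituting v = Aw turns the form of the inverse at v into the form of \<open>A\<close>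
  at w.\<close>

lemma pd_minv: assumes "pd_mat n A" shows "pd_mat n (minv n A)"
proof -
  note A = pd_matD(1,2)[OF assms] and I = minv_inverse[OF pd_matD(1)[OF assms] pd_det[OF assms]]
  have [simp]: "dim_row A = n" "dim_col A = n" "dim_row (minv n A) = n" "dim_col (minv n A) = n"
    using A I by auto
  have h: "mat_adjoint (minv n A) = minv n A"
  proof (rule minv_eq[symmetric, OF A(1)])
    have "A * mat_adjoint (minv n A) = mat_adjoint (minv n A * A)" by (simp add: mat_adj A(2))
    then show "A * mat_adjoint (minv n A) = 1\<^sub>m n" by (simp add: I)
  qed (use I in auto)
  have psd: "psd_mat n (minv n A)"
    unfolding psd_mat_def
  proof (intro conjI ballI h I)
    fix v :: "complex Matrix.vec" assume v: "v \<in> carrier_vec n"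
    define w where "w = minv n A *\<^sub>v v"
    have w: "w \<in> carrier_vec n" using I v by (auto simp: w_def)
    have "A *\<^sub>v w = (A * minv n A) *\<^sub>v v"
      unfolding w_def using I A v by (intro assoc_mult_mat_vec[symmetric]) auto
    then have 1: "A *\<^sub>v w = v" using v by (simp add: I)
    have "w \<bullet>c (A *\<^sub>v w) = (A *\<^sub>v w) \<bullet>c w"
      using A w cscalar_mult_mat_vec[of A n n w w] by simp
    then show "Re ((minv n A *\<^sub>v v) \<bullet>c v) \<ge> 0"
      using psd_matD(3)[OF pd_imp_psd[OF assms] w] unfolding w_def[symmetric] 1 by simp
  qed
  show ?thesis by (rule pd_inverse_imp_pd[OF psd A(1) I(2)])
qed

section \<open>Matrix-valued functions\<close>

text \<open>Continuity and holomorphy of matrix-valued functions are handled uniformly: both are closed under the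
  operations in Cramer's rule.\<close>

locale fun_algebra =
  fixes S :: "complex set" and \<Phi> :: "(complex \<Rightarrow> complex) \<Rightarrow> bool"
  assumes const: "\<Phi> (\<lambda>_. c)"
    and add: "\<Phi> f \<Longrightarrow> \<Phi> g \<Longrightarrow> \<Phi> (\<lambda>z. f z + g z)"
    and mult: "\<Phi> f \<Longrightarrow> \<Phi> g \<Longrightarrow> \<Phi> (\<lambda>z. f z * g z)"
    and cong: "(\<And>z. z \<in> S \<Longrightarrow> f z = g z) \<Longrightarrow> \<Phi> f \<Longrightarrow> \<Phi> g"
    and inverse: "\<Phi> f \<Longrightarrow> (\<And>z. z \<in> S \<Longrightarrow> f z \<noteq> 0) \<Longrightarrow> \<Phi> (\<lambda>z. inverse (f z))"

lemmas fun_algebraD = fun_algebra.const fun_algebra.add fun_algebra.mult fun_algebra.cong fun_algebra.inverse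

lemma fun_algebra_holomorphic: "fun_algebra S (\<lambda>f. f holomorphic_on S)"
  by unfold_locales (auto intro!: holomorphic_intros intro: holomorphic_transform)

text \<open>Continuity at \<open>a\<close> depends on a whole neighbourhood; openness of
  \<open>S\<close> provides one, as the congruence axiom requires.\<close>

lemma fun_algebra_isCont:
  assumes "open S" "a \<in> S" shows "fun_algebra S (\<lambda>f. isCont f a)"
proof
  fix f g :: "complex \<Rightarrow> complex" assume "\<And>z. z \<in> S \<Longrightarrow> f z = g z" "isCont f a"
  moreover have "eventually (\<lambda>z. z \<in> S) (nhds a)" using assms by (simp add: eventually_nhds_in_open)
  ultimately show "isCont g a"
    by (subst isCont_cong[of g f]) (auto elim: eventually_mono)
qed (use assms in \<open>auto intro!: continuous_intros\<close>)

lemma fun_algebra_sum: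
  assumes "fun_algebra S \<Phi>" "\<And>i. i \<in> I \<Longrightarrow> \<Phi> (f i)" shows "\<Phi> (\<lambda>z. \<Sum>i\<in>I. f i z)"
  using assms(2) by (induction I rule: infinite_finite_induct) (auto intro: fun_algebraD[OF assms(1)])

lemma fun_algebra_prod:
  assumes "fun_algebra S \<Phi>" "\<And>i. i \<in> I \<Longrightarrow> \<Phi> (f i)" shows "\<Phi> (\<lambda>z. \<Prod>i\<in>I. f i z)"
  using assms(2) by (induction I rule: infinite_finite_induct) (auto intro: fun_algebraD[OF assms(1)])

text \<open>Dimensions are prescribed on \<open>S\<close> only, since the values elsewhere, for
  instance off the disc, are arbitrary.\<close>

definition mat_fun :: "complex set \<Rightarrow> ((complex \<Rightarrow> complex) \<Rightarrow> bool) \<Rightarrow> nat \<Rightarrow> nat \<Rightarrow> (complex \<Rightarrow> complex mat) \<Rightarrow> bool" where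
  "mat_fun S \<Phi> n m f \<longleftrightarrow> (\<forall>z\<in>S. f z \<in> carrier_mat n m) \<and> (\<forall>a<n. \<forall>b<m. \<Phi> (\<lambda>z. f z $$ (a, b)))"

lemma mat_funD:
  assumes "mat_fun S \<Phi> n m f"
  shows "z \<in> S \<Longrightarrow> f z \<in> carrier_mat n m" "a < n \<Longrightarrow> b < m \<Longrightarrow> \<Phi> (\<lambda>z. f z $$ (a, b))"
  using assms unfolding mat_fun_def by blast+

lemma mat_fun_const: "fun_algebra S \<Phi> \<Longrightarrow> A \<in> carrier_mat n m \<Longrightarrow> mat_fun S \<Phi> n m (\<lambda>_. A)"
  by (auto simp: mat_fun_def intro: fun_algebraD)

lemma mat_fun_mult:
  assumes "fun_algebra S \<Phi>" and f: "mat_fun S \<Phi> n m f" and g: "mat_fun S \<Phi> m l g"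
  shows "mat_fun S \<Phi> n l (\<lambda>z. f z * g z)"
  unfolding mat_fun_def
proof (intro conjI allI impI ballI)
  fix a b assume ab: "a < n" "b < l"
  have "\<Phi> (\<lambda>z. \<Sum>k<m. f z $$ (a,k) * g z $$ (k,b))"
    by (intro fun_algebra_sum[OF assms(1)] fun_algebraD(3)[OF assms(1)])
       (auto intro: mat_funD[OF f] mat_funD[OF g] ab)
  then show "\<Phi> (\<lambda>z. (f z * g z) $$ (a, b))"
  proof (rule fun_algebraD(4)[OF assms(1), rotated])
    fix z assume "z \<in> S"
    then show "(\<Sum>k<m. f z $$ (a,k) * g z $$ (k,b)) = (f z * g z) $$ (a, b)"
      using mat_funD(1)[OF f, of z] mat_funD(1)[OF g, of z] ab
      by (auto simp: scalar_prod_def atLeast0LessThan)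
  qed
qed (use mult_carrier_mat[OF mat_funD(1)[OF f] mat_funD(1)[OF g]] in blast)

lemma mat_fun_add:
  assumes "fun_algebra S \<Phi>" and f: "mat_fun S \<Phi> n m f" and g: "mat_fun S \<Phi> n m g"
  shows "mat_fun S \<Phi> n m (\<lambda>z. f z + g z)"
  unfolding mat_fun_def
proof (intro conjI allI impI ballI)
  fix a b assume ab: "a < n" "b < m"
  have "\<Phi> (\<lambda>z. f z $$ (a,b) + g z $$ (a,b))"
    by (intro fun_algebraD(2)[OF assms(1)] mat_funD(2)[OF f] mat_funD(2)[OF g] ab)
  then show "\<Phi> (\<lambda>z. (f z + g z) $$ (a, b))"
  proof (rule fun_algebraD(4)[OF assms(1), rotated])
    fix z assume "z \<in> S"
    then show "f z $$ (a,b) + g z $$ (a,b) = (f z + g z) $$ (a, b)"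
      using mat_funD(1)[OF f, of z] mat_funD(1)[OF g, of z] ab by auto
  qed
qed (use mat_funD(1)[OF f] mat_funD(1)[OF g] in auto)

lemma mat_fun_smult:
  assumes "fun_algebra S \<Phi>" and c: "\<Phi> c" and g: "mat_fun S \<Phi> n m g"
  shows "mat_fun S \<Phi> n m (\<lambda>z. c z \<cdot>\<^sub>m g z)"
  unfolding mat_fun_def
proof (intro conjI allI impI ballI)
  fix a b assume ab: "a < n" "b < m"
  have "\<Phi> (\<lambda>z. c z * g z $$ (a,b))"
    by (intro fun_algebraD(3)[OF assms(1)] c mat_funD(2)[OF g] ab)
  then show "\<Phi> (\<lambda>z. (c z \<cdot>\<^sub>m g z) $$ (a, b))"
  proof (rule fun_algebraD(4)[OF assms(1), rotated])
    fix z assume "z \<in> S"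
    then show "c z * g z $$ (a,b) = (c z \<cdot>\<^sub>m g z) $$ (a, b)"
      using mat_funD(1)[OF g, of z] ab by auto
  qed
qed (use mat_funD(1)[OF g] in auto)

lemma mat_fun_cong:
  assumes "fun_algebra S \<Phi>" and f: "mat_fun S \<Phi> n m f" and eq: "\<And>z. z \<in> S \<Longrightarrow> f z = g z"
  shows "mat_fun S \<Phi> n m g"
  unfolding mat_fun_def
proof (intro conjI allI impI ballI)
  fix a b assume ab: "a < n" "b < m"
  from mat_funD(2)[OF f ab] show "\<Phi> (\<lambda>z. g z $$ (a, b))"
    by (rule fun_algebraD(4)[OF assms(1), rotated]) (simp add: eq)
qed (use mat_funD(1)[OF f] eq in auto)

lemma mat_fun_diff:
  assumes alg: "fun_algebra S \<Phi>" and f: "mat_fun S \<Phi> n m f" and g: "mat_fun S \<Phi> n m g"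
  shows "mat_fun S \<Phi> n m (\<lambda>z. f z - g z)"
proof (rule mat_fun_cong[OF alg mat_fun_add[OF alg f
      mat_fun_smult[OF alg fun_algebraD(1)[OF alg, of "-1"] g]]])
  fix z assume "z \<in> S"
  with mat_funD(1)[OF f] mat_funD(1)[OF g] have "f z \<in> carrier_mat n m" "g z \<in> carrier_mat n m" by auto
  then show "f z + - 1 \<cdot>\<^sub>m g z = f z - g z" by (intro eq_matI) auto
qed

lemma mat_fun_det:
  assumes "fun_algebra S \<Phi>" and f: "mat_fun S \<Phi> n n f" shows "\<Phi> (\<lambda>z. Determinant.det (f z))"
proof -
  have "\<Phi> (\<lambda>z. \<Sum>p | p permutes {0..<n}. signof p * (\<Prod>i = 0..<n. f z $$ (i, p i)))"
  proof (rule fun_algebra_sum[OF assms(1)], rule fun_algebraD(3)[OF assms(1)],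
      rule fun_algebraD(1)[OF assms(1)], rule fun_algebra_prod[OF assms(1)])
    fix p i assume "p \<in> {p. p permutes {0..<n}}" "i \<in> {0..<n}"
    then show "\<Phi> (\<lambda>z. f z $$ (i, p i))"
      by (intro mat_funD(2)[OF f]) (auto simp: permutes_in_image dest: permutes_in_image[of p _ i])
  qed
  then show ?thesis
    by (rule fun_algebraD(4)[OF assms(1), rotated]) (simp add: det_def'[OF mat_funD(1)[OF f]])
qed

text \<open>By Cramer's rule an entry of the inverse is a signed minor over the determinant, and
  both are polynomial in the entries of \<open>f\<close>.\<close>

lemma mat_fun_minv:
  assumes alg: "fun_algebra S \<Phi>" and f: "mat_fun S \<Phi> n n f"
    and det: "\<And>z. z \<in> S \<Longrightarrow> Determinant.det (f z) \<noteq> 0"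
  shows "mat_fun S \<Phi> n n (\<lambda>z. minv n (f z))"
proof -
  have "mat_fun S \<Phi> n n (\<lambda>z. inverse (Determinant.det (f z)) \<cdot>\<^sub>m adj_mat (f z))"
  proof (rule mat_fun_smult[OF alg])
    show "\<Phi> (\<lambda>z. inverse (Determinant.det (f z)))"
      by (intro fun_algebraD(5)[OF alg] mat_fun_det[OF alg f] det)
    show "mat_fun S \<Phi> n n (\<lambda>z. adj_mat (f z))"
      unfolding mat_fun_def
    proof (intro conjI allI impI ballI)
      fix a b assume ab: "a < n" "b < n"
      have "mat_fun S \<Phi> (n - 1) (n - 1) (\<lambda>z. mat_delete (f z) b a)"
        unfolding mat_fun_def
      proof (intro conjI allI impI ballI)
        fix i j assume ij: "i < n - 1" "j < n - 1"
        have "\<Phi> (\<lambda>z. f z $$ (if i < b then i else Suc i, if j < a then j else Suc j))"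
          using ij by (intro mat_funD(2)[OF f]) auto
        then show "\<Phi> (\<lambda>z. mat_delete (f z) b a $$ (i, j))"
        proof (rule fun_algebraD(4)[OF alg, rotated])
          fix z assume "z \<in> S"
          then show "f z $$ (if i < b then i else Suc i, if j < a then j else Suc j) = mat_delete (f z) b a $$ (i, j)"
            using mat_funD(1)[OF f, of z] ij by (auto simp: mat_delete_def)
        qed
      next
        fix z assume "z \<in> S"
        from mat_funD(1)[OF f this] show "mat_delete (f z) b a \<in> carrier_mat (n - 1) (n - 1)"
          by (rule mat_delete_carrier)
      qed
      from mat_fun_det[OF alg this] have 1: "\<Phi> (\<lambda>z. Determinant.det (mat_delete (f z) b a))" .
      have "\<Phi> (\<lambda>z. (-1) ^ (b + a) * Determinant.det (mat_delete (f z) b a))"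
        by (rule fun_algebraD(3)[OF alg, OF fun_algebraD(1)[OF alg, of "(-1) ^ (b + a)"] 1])
      then show "\<Phi> (\<lambda>z. adj_mat (f z) $$ (a, b))"
      proof (rule fun_algebraD(4)[OF alg, rotated])
        fix z assume "z \<in> S"
        then show "(-1) ^ (b + a) * Determinant.det (mat_delete (f z) b a) = adj_mat (f z) $$ (a, b)"
          using mat_funD(1)[OF f, of z] ab by (simp add: adj_mat_def cofactor_def)
      qed
    qed (use adj_mat(1)[OF mat_funD(1)[OF f]] in auto)
  qed
  then show ?thesis
    by (rule mat_fun_cong[OF alg]) (rule minv_cramer[OF mat_funD(1)[OF f] det, symmetric])
qed

text \<open>The value at 0 is a limit over the punctured disc, so it is fixed by any
  \<open>h\<close> that is continuous at 0 and agrees with \<open>G\<close> there. Through this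
  lemma identities of Schur functions are computed at nonzero points.\<close>

lemma fill0_continuous:
  assumes "r > 0" and eq: "\<And>z. z \<in> ball 0 r \<Longrightarrow> z \<noteq> 0 \<Longrightarrow> G z = h z" and h0: "h 0 \<in> carrier_mat n n"
    and cont: "\<And>a b. a < n \<Longrightarrow> b < n \<Longrightarrow> isCont (\<lambda>z. h z $$ (a, b)) 0" and z: "z \<in> ball 0 r"
  shows "fill0 n G z = h z"
proof (cases "z = 0")
  case True
  have "Lim (at 0) (\<lambda>w. G w $$ (a, b)) = h 0 $$ (a, b)" if "a < n" "b < n" for a b
  proof -
    have "eventually (\<lambda>w. w \<in> ball 0 r \<and> w \<noteq> 0) (at (0::complex))"
      using assms(1) eventually_at_in_open[of "ball 0 r" 0] by (auto simp: eventually_conj_iff elim: eventually_mono)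
    then have "eventually (\<lambda>w. G w $$ (a, b) = h w $$ (a, b)) (at 0)"
      by (rule eventually_mono) (simp add: eq)
    then have "Lim (at 0) (\<lambda>w. G w $$ (a, b)) = Lim (at 0) (\<lambda>w. h w $$ (a, b))"
      by (rule Lim_cong) simp
    also have "\<dots> = h 0 $$ (a, b)"
      using cont[OF that] by (intro tendsto_Lim) (auto simp: isCont_def)
    finally show ?thesis .
  qed
  then show ?thesis using h0 by (auto simp: fill0_def True intro!: eq_matI)
next
  case False
  then show ?thesis using eq[OF z] by (simp add: fill0_def)
qed

section \<open>Contractions and the Schur step\<close>

definition contraction :: "nat \<Rightarrow> complex mat \<Rightarrow> bool" where
  "contraction d a \<longleftrightarrow> a \<in> carrier_mat d d \<and> psd_mat d (1\<^sub>m d - mat_adjoint a * a)"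

text \<open>Positivity of both defects makes \<open>rhoL\<close> and \<open>rhoR\<close> available
  as positive definite roots at the same time.\<close>

definition strict_contraction :: "nat \<Rightarrow> complex mat \<Rightarrow> bool" where
  "strict_contraction d a \<longleftrightarrow> a \<in> carrier_mat d d \<and> pd_mat d (1\<^sub>m d - mat_adjoint a * a) \<and> pd_mat d (1\<^sub>m d - a * mat_adjoint a)"

definition rhoL :: "nat \<Rightarrow> complex mat \<Rightarrow> complex mat" where
  "rhoL d a = msqrt d (1\<^sub>m d - mat_adjoint a * a)"

definition rhoR :: "nat \<Rightarrow> complex mat \<Rightarrow> complex mat" where
  "rhoR d a = msqrt d (1\<^sub>m d - a * mat_adjoint a)"

lemma pd_props:
  assumes "pd_mat d A"
  shows "dim_row A = d" "dim_col A = d" "mat_adjoint A = A"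
    "dim_row (minv d A) = d" "dim_col (minv d A) = d" "A * minv d A = 1\<^sub>m d" "minv d A * A = 1\<^sub>m d"
  using pd_matD[OF assms] minv_inverse[OF pd_matD(1)[OF assms] pd_det[OF assms]] by auto

lemma pd_cancel:
  assumes "pd_mat d A" "dim_row B = d"
  shows "A * (minv d A * B) = B" "minv d A * (A * B) = B"
  using pd_props[OF assms(1)] assms(2) by (simp_all add: mat_assoc[symmetric] mat_one_left)

text \<open>The defects satisfy a(1 - adj(a) a) = (1 - a adj(a)) a. For X = a rhoL - rhoR a this
  gives rhoR X + X rhoL = 0, and the Sylvester lemma passes from the squares to the roots.\<close>

lemma rho_props:
  assumes a: "strict_contraction d a"
  shows "pd_mat d (rhoL d a)" "pd_mat d (rhoR d a)"
    "rhoL d a * rhoL d a = 1\<^sub>m d - mat_adjoint a * a" "rhoR d a * rhoR d a = 1\<^sub>m d - a * mat_adjoint a"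
    "a * rhoL d a = rhoR d a * a" "rhoL d a * mat_adjoint a = mat_adjoint a * rhoR d a"
proof -
  have [simp]: "dim_row a = d" "dim_col a = d" and ca: "a \<in> carrier_mat d d"
    using a by (auto simp: strict_contraction_def)
  show L: "pd_mat d (rhoL d a)" "rhoL d a * rhoL d a = 1\<^sub>m d - mat_adjoint a * a"
    using a msqrt_pd by (auto simp: strict_contraction_def rhoL_def)
  show R: "pd_mat d (rhoR d a)" "rhoR d a * rhoR d a = 1\<^sub>m d - a * mat_adjoint a"
    using a msqrt_pd by (auto simp: strict_contraction_def rhoR_def)
  note [simp] = pd_props(1-3)[OF L(1)] pd_props(1-3)[OF R(1)]
  define X where "X = a * rhoL d a - rhoR d a * a"
  have "X = 0\<^sub>m d d"
  proof (rule sylvester_zero[OF R(1) pd_imp_psd[OF L(1)]])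
    show "X \<in> carrier_mat d d" by (auto simp: X_def)
    have "rhoR d a * X + X * rhoL d a = a * (rhoL d a * rhoL d a) - (rhoR d a * rhoR d a) * a"
      by (simp add: X_def mat_assoc mat_diff_distrib_left mat_diff_distrib_right)
         (rule eq_matI, simp_all del: index_mult_mat(1))
    also have "\<dots> = 0\<^sub>m d d"
      unfolding L(2) R(2) by (simp add: mat_algebra) (rule eq_matI, simp_all del: index_mult_mat(1))
    finally show "rhoR d a * X + X * rhoL d a = 0\<^sub>m d d" .
  qed
  then have "\<And>i j. i < d \<Longrightarrow> j < d \<Longrightarrow> X $$ (i, j) = 0" by simp
  then show eq: "a * rhoL d a = rhoR d a * a"
    by (intro eq_matI) (simp_all add: X_def del: index_mult_mat(1))
  from arg_cong[OF this, of mat_adjoint] show "rhoL d a * mat_adjoint a = mat_adjoint a * rhoR d a"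
    by (simp add: mat_adj)
qed

lemma strict_contraction_neg_adjoint:
  assumes a: "strict_contraction d a" shows "strict_contraction d (- mat_adjoint a)"
proof -
  have [simp]: "dim_row a = d" "dim_col a = d" "a \<in> carrier_mat d d" using a by (auto simp: strict_contraction_def)
  show ?thesis using a by (simp add: strict_contraction_def mat_adj mat_algebra)
qed

text \<open>Inverse iterates have parameters -adj(a); such a parameter exchanges the roles of the
  two defect roots.\<close>

lemma rho_neg_adjoint:
  assumes a: "a \<in> carrier_mat d d"
  shows "rhoL d (- mat_adjoint a) = rhoR d a" "rhoR d (- mat_adjoint a) = rhoL d a"
  using a by (simp_all add: rhoL_def rhoR_def mat_adj mat_algebra)

lemma smult_mat_mult_vec: "dim_vec v = dim_col A \<Longrightarrow> (k \<cdot>\<^sub>m A) *\<^sub>v v = k \<cdot>\<^sub>v (A *\<^sub>v v)"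
  for A :: "complex mat"
  by (rule eq_vecI) (auto simp: scalar_prod_def sum_distrib_left mult.assoc)

lemma contraction_norm:
  assumes "contraction d a" "v \<in> carrier_vec d"
  shows "Re ((a *\<^sub>v v) \<bullet>c (a *\<^sub>v v)) \<le> Re (v \<bullet>c v)"
proof -
  have a: "a \<in> carrier_mat d d" using assms by (simp add: contraction_def)
  have "0 \<le> Re (((1\<^sub>m d - mat_adjoint a * a) *\<^sub>v v) \<bullet>c v)"
    using assms by (auto simp: contraction_def psd_mat_def)
  also have "(1\<^sub>m d - mat_adjoint a * a) *\<^sub>v v = v - mat_adjoint a *\<^sub>v (a *\<^sub>v v)"
    using a assms(2) by (subst minus_mult_distrib_mat_vec[of _ d d]) (auto simp: assoc_mult_mat_vec[of _ d d _ d])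
  also have "\<dots> \<bullet>c v = v \<bullet>c v - (mat_adjoint a *\<^sub>v (a *\<^sub>v v)) \<bullet>c v"
    using a assms(2) mult_mat_vec_carrier[OF mat_adjoint_carrier[OF a] mult_mat_vec_carrier[OF a assms(2)]]
    by (intro minus_scalar_prod_distrib[of _ d]) auto
  also have "(mat_adjoint a *\<^sub>v (a *\<^sub>v v)) \<bullet>c v = (a *\<^sub>v v) \<bullet>c (a *\<^sub>v v)"
    using a assms(2) by (subst cscalar_mult_mat_vec[of _ d d]) auto
  finally show ?thesis by simp
qed

lemma strict_imp_contraction: "strict_contraction d a \<Longrightarrow> contraction d a"
  by (auto simp: contraction_def strict_contraction_def intro: pd_imp_psd)

text \<open>A kernel vector satisfies v = z a b v, so its length is at most |z| times itself, which
  for |z| < 1 forces v = 0.\<close>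

lemma det_one_minus_contraction:
  assumes a: "contraction d a" and b: "contraction d b" and z: "cmod z < 1"
  shows "Determinant.det (1\<^sub>m d - z \<cdot>\<^sub>m (a * b)) \<noteq> 0"
proof (rule det_nonzero_if_injective)
  have c: "a \<in> carrier_mat d d" "b \<in> carrier_mat d d" using a b by (auto simp: contraction_def)
  show "1\<^sub>m d - z \<cdot>\<^sub>m (a * b) \<in> carrier_mat d d" using c by auto
  fix v :: "complex Matrix.vec" assume v: "v \<in> carrier_vec d" and eq: "(1\<^sub>m d - z \<cdot>\<^sub>m (a * b)) *\<^sub>v v = 0\<^sub>v d"
  define w where "w = a *\<^sub>v (b *\<^sub>v v)"
  have w: "w \<in> carrier_vec d" using c v by (auto simp: w_def)
  have "(1\<^sub>m d - z \<cdot>\<^sub>m (a * b)) *\<^sub>v v = v - z \<cdot>\<^sub>v w"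
    unfolding w_def using c v
    by (subst minus_mult_distrib_mat_vec[of _ d d]) (auto simp: smult_mat_mult_vec assoc_mult_mat_vec[of _ d d _ d])
  with eq have "v - z \<cdot>\<^sub>v w = 0\<^sub>v d" by simp
  then have veq: "v $ i = z * w $ i" if "i < d" for i
    using that v w by (auto dest!: arg_cong[of _ _ "\<lambda>u. vec_index u i"])
  have "v \<bullet>c v = (\<Sum>i<d. v $ i * cnj (v $ i))" using v by (simp add: scalar_prod_def atLeast0LessThan)
  also have "\<dots> = (\<Sum>i<d. (z * cnj z) * (w $ i * cnj (w $ i)))"
    by (intro sum.cong refl) (simp add: veq)
  also have "\<dots> = (z * cnj z) * (w \<bullet>c w)"
    using w by (simp add: scalar_prod_def atLeast0LessThan sum_distrib_left)
  also have "z * cnj z = of_real ((cmod z)\<^sup>2)" by (rule complex_norm_square[symmetric])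
  finally have "Re (v \<bullet>c v) = (cmod z)\<^sup>2 * Re (w \<bullet>c w)" by simp
  also have "\<dots> \<le> (cmod z)\<^sup>2 * Re (v \<bullet>c v)"
  proof (intro mult_left_mono)
    have "Re (w \<bullet>c w) \<le> Re ((b *\<^sub>v v) \<bullet>c (b *\<^sub>v v))"
      unfolding w_def using c v by (intro contraction_norm[OF a]) auto
    also have "\<dots> \<le> Re (v \<bullet>c v)" by (rule contraction_norm[OF b v])
    finally show "Re (w \<bullet>c w) \<le> Re (v \<bullet>c v)" .
  qed auto
  finally have "(1 - (cmod z)\<^sup>2) * Re (v \<bullet>c v) \<le> 0" by (simp add: algebra_simps)
  moreover have "1 - (cmod z)\<^sup>2 > 0" using z by (simp add: abs_square_less_1)
  ultimately have "Re (v \<bullet>c v) \<le> 0" by (simp add: mult_le_0_iff)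
  then show "v = 0\<^sub>v d" by (rule cscalar_self_eq_0[OF v])
qed

abbreviation holo_mat :: "real \<Rightarrow> nat \<Rightarrow> (complex \<Rightarrow> complex mat) \<Rightarrow> bool" where
  "holo_mat r d \<equiv> mat_fun (ball 0 r) (\<lambda>f. f holomorphic_on ball 0 r) d d"

lemma holo_mat_subset: "holo_mat r d g \<Longrightarrow> s \<le> r \<Longrightarrow> holo_mat s d g"
  unfolding mat_fun_def by (meson holomorphic_on_subset subset_ball subset_eq)

lemma holo_mat_isCont: "holo_mat r d g \<Longrightarrow> r > 0 \<Longrightarrow> a < d \<Longrightarrow> b < d \<Longrightarrow> isCont (\<lambda>z. g z $$ (a, b)) 0"
  by (metis centre_in_ball continuous_on_eq_continuous_at holomorphic_on_imp_continuous_on mat_funD(2) open_ball)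

lemma schur_step_eq:
  "schur_step d g = fill0 d (\<lambda>z. (1 / z) \<cdot>\<^sub>m (minv d (rhoR d (g 0)) * (g z - g 0) *
      minv d (1\<^sub>m d - mat_adjoint (g 0) * g z) * rhoL d (g 0)))"
  by (simp add: schur_step_def rhoL_def rhoR_def Let_def)

lemma schur_iter_Suc: "schur_iter d g (Suc m) = schur_iter d (schur_step d g) m"
  by (simp add: schur_iter_def funpow_swap1)

lemma schur_iter_0: "schur_iter d g 0 = g"
  by (simp add: schur_iter_def)

text \<open>One inverse Schur step with parameter \<open>- mat_adjoint a\<close>.\<close>

definition mobius :: "nat \<Rightarrow> complex mat \<Rightarrow> complex \<Rightarrow> complex mat \<Rightarrow> complex mat" where
  "mobius d a z b = - mat_adjoint a + z \<cdot>\<^sub>m (rhoL d a * (b * (minv d (1\<^sub>m d - z \<cdot>\<^sub>m (a * b)) * rhoR d a)))"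

section \<open>The inverse Schur step and its contractivity\<close>

locale mobius_pair =
  fixes d :: nat and a b :: "complex mat" and z :: complex
  assumes a: "strict_contraction d a" and b: "contraction d b" and z: "cmod z < 1"
begin

text \<open>The fractional map is linearised by a feedback loop: \<open>X\<close> is the signal
  entering \<open>b\<close>, \<open>Y\<close> is the signal returned after multiplication by z, and
  inverting \<open>N\<close> solves X = rhoR + aY.\<close>

definition "N = 1\<^sub>m d - z \<cdot>\<^sub>m (a * b)"
definition "X = minv d N * rhoR d a"
definition "Y = z \<cdot>\<^sub>m (b * X)"

lemma dims [simp]: "dim_row a = d" "dim_col a = d" "dim_row b = d" "dim_col b = d" "dim_row N = d" "dim_col N = d"
  "a \<in> carrier_mat d d" "b \<in> carrier_mat d d" "N \<in> carrier_mat d d"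
  using a b by (auto simp: strict_contraction_def contraction_def N_def)

lemma N_inverse [simp]: "N * minv d N = 1\<^sub>m d" "minv d N * N = 1\<^sub>m d" "minv d N \<in> carrier_mat d d"
    "dim_row (minv d N) = d" "dim_col (minv d N) = d"
proof -
  note I = minv_inverse[OF dims(9) det_one_minus_contraction[OF strict_imp_contraction[OF a] b z, folded N_def]]
  from I show "N * minv d N = 1\<^sub>m d" "minv d N * N = 1\<^sub>m d" "minv d N \<in> carrier_mat d d" by auto
  from carrier_matD[OF I(1)] show "dim_row (minv d N) = d" "dim_col (minv d N) = d" by auto
qed

lemmas rho = rho_props[OF a]
lemmas rho_dims [simp] = pd_props(1,2,3,4,5)[OF rho(1)] pd_props(1,2,3,4,5)[OF rho(2)]

lemma dimsXY [simp]: "dim_row X = d" "dim_col X = d" "dim_row Y = d" "dim_col Y = d"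
  "X \<in> carrier_mat d d" "Y \<in> carrier_mat d d"
  by (auto simp: X_def Y_def)

lemma NX: "N * X = rhoR d a"
  by (simp add: X_def mat_assoc[symmetric] mat_one_left)

lemma X_eq: "X = rhoR d a + a * Y"
proof -
  have "N * X = X - a * Y" by (simp add: N_def Y_def mat_algebra)
  then have "rhoR d a = X - a * Y" by (simp add: NX)
  then show ?thesis by (simp del: index_mult_mat(1)) (rule eq_matI, simp_all del: index_mult_mat(1))
qed

lemma mobius_XY: "mobius d a z b = - mat_adjoint a + rhoL d a * Y"
  by (simp add: mobius_def Y_def X_def N_def mat_smult_right)

lemma mobius_dims [simp]: "dim_row (mobius d a z b) = d" "dim_col (mobius d a z b) = d"
  "mobius d a z b \<in> carrier_mat d d"
  by (auto simp: mobius_XY)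

text \<open>\<open>(mobius d a z b, X)\<close> is the image of \<open>(1, Y)\<close> under the unitary block matrix with rows
  \<open>(- mat_adjoint a, rhoL d a)\<close> and \<open>(rhoR d a, a)\<close>.\<close>

lemma one_minus_mobius: "1\<^sub>m d - mat_adjoint (mobius d a z b) * mobius d a z b = mat_adjoint X * X - mat_adjoint Y * Y"
proof -
  let ?L = "rhoL d a" and ?R = "rhoR d a"
  have LL: "?L * (?L * Z) = Z - mat_adjoint a * (a * Z)" if "dim_row Z = d" for Z
    using that by (simp add: mat_assoc[symmetric] rho mat_diff_distrib_right mat_one_left)
  have RaY: "?R * (a * Z) = a * (?L * Z)" if "dim_row Z = d" for Z
    using that by (simp add: mat_assoc[symmetric] rho)
  have aR: "mat_adjoint a * ?R = ?L * mat_adjoint a" by (simp add: rho)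
  have "mat_adjoint (mobius d a z b) * mobius d a z b = a * mat_adjoint a - a * (?L * Y)
       - mat_adjoint Y * (?L * mat_adjoint a) + mat_adjoint Y * (Y - mat_adjoint a * (a * Y))"
    by (simp add: mobius_XY mat_adj mat_algebra LL)
       (rule eq_matI, simp_all del: index_mult_mat(1))
  moreover have "mat_adjoint X * X = 1\<^sub>m d - a * mat_adjoint a + a * (?L * Y)
       + mat_adjoint Y * (?L * mat_adjoint a) + mat_adjoint Y * (mat_adjoint a * (a * Y))"
    by (simp add: X_eq mat_adj mat_algebra RaY aR rho(4))
       (rule eq_matI, simp_all del: index_mult_mat(1))
  ultimately show ?thesis
    by (simp add: mat_algebra) (rule eq_matI, simp_all del: index_mult_mat(1))
qed

text \<open>The defect of the image is adj(X) X - adj(Y) Y, and Y = z b X shortens every vector at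
  least as much as X does, because \<open>b\<close> is a contraction and |z| < 1.\<close>

lemma mobius_contraction: "contraction d (mobius d a z b)"
  unfolding contraction_def psd_mat_def
proof (intro conjI ballI)
  fix v :: "complex Matrix.vec" assume v: "v \<in> carrier_vec d"
  have sq: "((mat_adjoint Z * Z) *\<^sub>v v) \<bullet>c v = (Z *\<^sub>v v) \<bullet>c (Z *\<^sub>v v)" if "Z \<in> carrier_mat d d" for Z
    using that v mult_mat_vec_carrier[OF that v]
    by (subst assoc_mult_mat_vec[of _ d d _ d]) (auto simp: cscalar_mult_mat_vec[of _ d d])
  have Xv: "X *\<^sub>v v \<in> carrier_vec d" and Yv: "Y *\<^sub>v v \<in> carrier_vec d" by (rule mult_mat_vec_carrier[OF dimsXY(5) v] mult_mat_vec_carrier[OF dimsXY(6) v])+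
  have "((1\<^sub>m d - mat_adjoint (mobius d a z b) * mobius d a z b) *\<^sub>v v) \<bullet>c v
      = ((mat_adjoint X * X) *\<^sub>v v - (mat_adjoint Y * Y) *\<^sub>v v) \<bullet>c v"
    unfolding one_minus_mobius using v by (subst minus_mult_distrib_mat_vec[of _ d d]) auto
  also have "\<dots> = ((mat_adjoint X * X) *\<^sub>v v) \<bullet>c v - ((mat_adjoint Y * Y) *\<^sub>v v) \<bullet>c v"
    using v by (intro minus_scalar_prod_distrib[of _ d]) (auto intro!: mult_mat_vec_carrier)
  also have "\<dots> = (X *\<^sub>v v) \<bullet>c (X *\<^sub>v v) - (Y *\<^sub>v v) \<bullet>c (Y *\<^sub>v v)"
    by (simp add: sq)
  finally have 1: "Re (((1\<^sub>m d - mat_adjoint (mobius d a z b) * mobius d a z b) *\<^sub>v v) \<bullet>c v)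
      = Re ((X *\<^sub>v v) \<bullet>c (X *\<^sub>v v)) - Re ((Y *\<^sub>v v) \<bullet>c (Y *\<^sub>v v))" by simp
  have "Y *\<^sub>v v = z \<cdot>\<^sub>v (b *\<^sub>v (X *\<^sub>v v))"
    unfolding Y_def using v by (simp add: smult_mat_mult_vec assoc_mult_mat_vec[of _ d d _ d])
  then have "(Y *\<^sub>v v) \<bullet>c (Y *\<^sub>v v) = (z * cnj z) * ((b *\<^sub>v (X *\<^sub>v v)) \<bullet>c (b *\<^sub>v (X *\<^sub>v v)))"
    by (simp add: scalar_prod_def sum_distrib_left mult_ac)
  also have "z * cnj z = of_real ((cmod z)\<^sup>2)" by (rule complex_norm_square[symmetric])
  finally have "(Y *\<^sub>v v) \<bullet>c (Y *\<^sub>v v) = of_real ((cmod z)\<^sup>2) * ((b *\<^sub>v (X *\<^sub>v v)) \<bullet>c (b *\<^sub>v (X *\<^sub>v v)))" .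
  then have "Re ((Y *\<^sub>v v) \<bullet>c (Y *\<^sub>v v)) = (cmod z)\<^sup>2 * Re ((b *\<^sub>v (X *\<^sub>v v)) \<bullet>c (b *\<^sub>v (X *\<^sub>v v)))"
    by simp
  also have "\<dots> \<le> 1 * Re ((b *\<^sub>v (X *\<^sub>v v)) \<bullet>c (b *\<^sub>v (X *\<^sub>v v)))"
    using z by (intro mult_right_mono cscalar_self_nonneg) (simp add: abs_square_le_1)
  also have "\<dots> \<le> Re ((X *\<^sub>v v) \<bullet>c (X *\<^sub>v v))"
    using contraction_norm[OF b Xv] by simp
  finally show "0 \<le> Re (((1\<^sub>m d - mat_adjoint (mobius d a z b) * mobius d a z b) *\<^sub>v v) \<bullet>c v)"
    unfolding 1 by simp
qed (auto simp: one_minus_mobius mat_adj intro!: carrier_matI)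

text \<open>For the parameter -adj(a) the numerator of the Schur step is rhoL Y and its denominator
  is rhoR X; the outer defect roots cancel and leave Y times the inverse of X, which is z b.\<close>

lemma schur_step_mobius:
  "minv d (rhoR d (- mat_adjoint a)) * (mobius d a z b - (- mat_adjoint a)) *
      minv d (1\<^sub>m d - mat_adjoint (- mat_adjoint a) * mobius d a z b) * rhoL d (- mat_adjoint a) = z \<cdot>\<^sub>m b"
proof -
  let ?L = "rhoL d a" and ?R = "rhoR d a"
  have 1: "mobius d a z b - (- mat_adjoint a) = ?L * Y"
    unfolding mobius_XY by (rule eq_matI, simp_all del: index_mult_mat(1))
  have "1\<^sub>m d - mat_adjoint (- mat_adjoint a) * mobius d a z b = (1\<^sub>m d - a * mat_adjoint a) + a * (?L * Y)"
    by (simp add: mobius_XY mat_adj mat_algebra) (rule eq_matI, simp_all del: index_mult_mat(1))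
  also have "\<dots> = ?R * ?R + ?R * (a * Y)" by (simp add: rho mat_assoc[symmetric])
  also have "\<dots> = ?R * X" by (simp add: X_eq mat_distrib_left)
  finally have 2: "1\<^sub>m d - mat_adjoint (- mat_adjoint a) * mobius d a z b = ?R * X" .
  have 3: "minv d (?R * X) = minv d ?R * (N * minv d ?R)"
  proof (rule minv_eq)
    have "?R * X * (minv d ?R * (N * minv d ?R)) = ?R * (minv d N * (?R * (minv d ?R * (N * minv d ?R))))"
      by (simp add: X_def mat_assoc)
    also have "\<dots> = ?R * ((minv d N * N) * minv d ?R)"
      by (simp add: pd_cancel[OF rho(2)] mat_assoc del: N_inverse(1,2))
    also have "\<dots> = 1\<^sub>m d" by (simp add: pd_props[OF rho(2)] mat_one_left)
    finally show "?R * X * (minv d ?R * (N * minv d ?R)) = 1\<^sub>m d" .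
  qed (auto intro!: mult_carrier_mat carrier_matI)
  have "minv d ?L * (?L * Y) * (minv d ?R * (N * minv d ?R)) * ?R = Y * (minv d ?R * (N * (minv d ?R * ?R)))"
    by (simp add: mat_assoc pd_cancel[OF rho(1)])
  also have "\<dots> = z \<cdot>\<^sub>m (b * (minv d N * (?R * (minv d ?R * N))))"
    by (simp add: pd_props[OF rho(2)] mat_one_right Y_def X_def mat_assoc mat_smult_left)
  also have "\<dots> = z \<cdot>\<^sub>m b" by (simp add: pd_cancel[OF rho(2)] mat_one_right)
  finally show ?thesis
    unfolding 1 2 3 rho_neg_adjoint[OF dims(7)] .
qed

end

text \<open>The explicit candidate for the inverse iterates. The outermost step carries the newest
  coefficient, so that peeling off steps by the Schur algorithm produces the parameters in reverse
  order and ends at 1.\<close>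

fun inv_schur :: "nat \<Rightarrow> (nat \<Rightarrow> complex mat) \<Rightarrow> nat \<Rightarrow> complex \<Rightarrow> complex mat" where
  "inv_schur d \<alpha> 0 z = 1\<^sub>m d"
| "inv_schur d \<alpha> (Suc j) z = mobius d (\<alpha> j) z (inv_schur d \<alpha> j z)"

lemma inv_schur_contraction:
  assumes "\<And>m. m < j \<Longrightarrow> strict_contraction d (\<alpha> m)" "z \<in> ball 0 1"
  shows "contraction d (inv_schur d \<alpha> j z)"
  using assms(1)
proof (induction j)
  case 0
  have "1\<^sub>m d - 1\<^sub>m d = (mat_adjoint (0\<^sub>m d d) * 0\<^sub>m d d :: complex mat)" by (rule eq_matI) auto
  then have "psd_mat d (1\<^sub>m d - 1\<^sub>m d)"
    using psd_adjoint_mult[of "0\<^sub>m d d" d d] by (simp only: zero_carrier_mat)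
  then show ?case by (simp add: contraction_def mat_one_left)
next
  case (Suc j)
  then interpret mobius_pair d "\<alpha> j" "inv_schur d \<alpha> j z" z
    using assms(2) by unfold_locales auto
  show ?case using mobius_contraction by simp
qed

lemma inv_schur_holo:
  assumes "\<And>m. m < j \<Longrightarrow> strict_contraction d (\<alpha> m)"
  shows "holo_mat 1 d (inv_schur d \<alpha> j)"
  using assms
proof (induction j)
  case 0
  show ?case by (simp add: mat_fun_const[OF fun_algebra_holomorphic])
next
  case (Suc j)
  note alg = fun_algebra_holomorphic[of "ball 0 1"]
  have id: "(\<lambda>z. z) holomorphic_on ball 0 1" by simp
  have s: "strict_contraction d (\<alpha> j)" using Suc.prems by simp
  then have c: "\<alpha> j \<in> carrier_mat d d" by (simp add: strict_contraction_def)
  have IH: "holo_mat 1 d (inv_schur d \<alpha> j)" using Suc by simp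
  have det: "Determinant.det (1\<^sub>m d - z \<cdot>\<^sub>m (\<alpha> j * inv_schur d \<alpha> j z)) \<noteq> 0" if "z \<in> ball 0 1" for z
    using det_one_minus_contraction[OF strict_imp_contraction[OF s] inv_schur_contraction[OF _ that]] Suc.prems that
    by simp
  have L: "rhoL d (\<alpha> j) \<in> carrier_mat d d" and R: "rhoR d (\<alpha> j) \<in> carrier_mat d d"
    using pd_matD(1)[OF rho_props(1)[OF s]] pd_matD(1)[OF rho_props(2)[OF s]] by auto
  have "holo_mat 1 d (\<lambda>z. mobius d (\<alpha> j) z (inv_schur d \<alpha> j z))"
    unfolding mobius_def
    by (intro mat_fun_add[OF alg] mat_fun_smult[OF alg id] mat_fun_mult[OF alg, where n = d and m = d and l = d] mat_fun_const[OF alg]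
        mat_fun_minv[OF alg] mat_fun_diff[OF alg] IH det L R c uminus_carrier_mat mat_adjoint_carrier one_carrier_mat)
  then show ?case by simp
qed

lemma mobius_at_0:
  assumes "strict_contraction d a" "contraction d b" shows "mobius d a 0 b = - mat_adjoint a"
proof -
  interpret mobius_pair d a b 0 using assms by unfold_locales auto
  show ?thesis unfolding mobius_XY Y_def by (rule eq_matI) (auto simp: mat_smult_right)
qed

text \<open>Agreement is assumed on the disc only, because the inverse iterate is cut off to 0
  outside; the Schur step at z looks at \<open>g\<close> only at 0, at z and, for z = 0, near
  0.\<close>

lemma schur_step_inv_schur:
  assumes \<alpha>: "\<And>m. m \<le> j \<Longrightarrow> strict_contraction d (\<alpha> m)"
    and g: "\<And>z. z \<in> ball 0 1 \<Longrightarrow> g z = inv_schur d \<alpha> (Suc j) z" and z: "z \<in> ball 0 1"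
  shows "schur_step d g z = inv_schur d \<alpha> j z"
  unfolding schur_step_eq
proof (rule fill0_continuous[of 1])
  have h: "holo_mat 1 d (inv_schur d \<alpha> j)" using \<alpha> by (intro inv_schur_holo) auto
  show "inv_schur d \<alpha> j 0 \<in> carrier_mat d d" by (rule mat_funD(1)[OF h]) simp
  show "isCont (\<lambda>z. inv_schur d \<alpha> j z $$ (a, b)) 0" if "a < d" "b < d" for a b
    using holo_mat_isCont[OF h _ that] by simp
  have g0: "g 0 = - mat_adjoint (\<alpha> j)"
    using g[of 0] mobius_at_0[OF \<alpha>[of j] inv_schur_contraction[of j]] \<alpha> by simp
  fix w :: complex assume w: "w \<in> ball 0 1" "w \<noteq> 0"
  interpret mobius_pair d "\<alpha> j" "inv_schur d \<alpha> j w" w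
    using w \<alpha> by unfold_locales (auto intro: inv_schur_contraction)
  have "1 / w \<cdot>\<^sub>m (minv d (rhoR d (g 0)) * (g w - g 0) *
      minv d (1\<^sub>m d - mat_adjoint (g 0) * g w) * rhoL d (g 0)) = 1 / w \<cdot>\<^sub>m (w \<cdot>\<^sub>m inv_schur d \<alpha> j w)"
    using schur_step_mobius unfolding g0 g[OF w(1)] inv_schur.simps by simp
  also have "\<dots> = inv_schur d \<alpha> j w" using w(2) by (intro eq_matI) auto
  finally show "1 / w \<cdot>\<^sub>m (minv d (rhoR d (g 0)) * (g w - g 0) *
      minv d (1\<^sub>m d - mat_adjoint (g 0) * g w) * rhoL d (g 0)) = inv_schur d \<alpha> j w" .
qed (use z in auto)

lemma schur_iter_inv_schur:
  assumes "\<And>m. m < j \<Longrightarrow> strict_contraction d (\<alpha> m)"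
    and "\<And>z. z \<in> ball 0 1 \<Longrightarrow> g z = inv_schur d \<alpha> j z" and "z \<in> ball 0 1" and "m \<le> j"
  shows "schur_iter d g m z = inv_schur d \<alpha> (j - m) z"
  using assms
proof (induction m arbitrary: j g)
  case 0
  then show ?case by (simp add: schur_iter_0)
next
  case (Suc m)
  then obtain j' where j: "j = Suc j'" by (cases j) auto
  have "schur_step d g w = inv_schur d \<alpha> j' w" if "w \<in> ball 0 1" for w
    using Suc.prems that unfolding j by (intro schur_step_inv_schur) auto
  then have "schur_iter d (schur_step d g) m z = inv_schur d \<alpha> (j' - m) z"
    using Suc.prems by (intro Suc.IH) (auto simp: j)
  then show ?case by (simp add: schur_iter_Suc j)
qed

text \<open>Let E be the quotient in the middle. Then (1 + adj(\<beta>) E) (1 - adj(\<beta>) g) = 1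
  - adj(\<beta>) \<beta>, whose right side is invertible and free of g; so E determines the
  denominator, and g - \<beta> is E times the denominator.\<close>

lemma mobius_inj:
  assumes \<beta>: "strict_contraction d \<beta>" and g: "g \<in> carrier_mat d d" "g' \<in> carrier_mat d d"
    and det: "Determinant.det (1\<^sub>m d - mat_adjoint \<beta> * g) \<noteq> 0" "Determinant.det (1\<^sub>m d - mat_adjoint \<beta> * g') \<noteq> 0"
    and eq: "minv d (rhoR d \<beta>) * (g - \<beta>) * minv d (1\<^sub>m d - mat_adjoint \<beta> * g) * rhoL d \<beta> =
      minv d (rhoR d \<beta>) * (g' - \<beta>) * minv d (1\<^sub>m d - mat_adjoint \<beta> * g') * rhoL d \<beta>"
  shows "g = g'"
proof -
  define N where "N = 1\<^sub>m d - mat_adjoint \<beta> * g"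
  define N' where "N' = 1\<^sub>m d - mat_adjoint \<beta> * g'"
  have c\<beta>: "\<beta> \<in> carrier_mat d d" using \<beta> by (simp add: strict_contraction_def)
  have [simp]: "dim_row \<beta> = d" "dim_col \<beta> = d" "dim_row g = d" "dim_col g = d" "dim_row g' = d" "dim_col g' = d"
    "dim_row N = d" "dim_col N = d" "dim_row N' = d" "dim_col N' = d"
    using g c\<beta> by (auto simp: N_def N'_def)
  have NN: "N \<in> carrier_mat d d" "N' \<in> carrier_mat d d" by auto
  note I = minv_inverse[OF NN(1) det(1)[folded N_def]] minv_inverse[OF NN(2) det(2)[folded N'_def]]
  have [simp]: "dim_row (minv d N) = d" "dim_col (minv d N) = d" "dim_row (minv d N') = d" "dim_col (minv d N') = d"
    using I by auto
  note rho = rho_props[OF \<beta>]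
  note [simp] = pd_props(1,2,4,5)[OF rho(1)] pd_props(1,2,4,5)[OF rho(2)]
  define E where "E = (g - \<beta>) * minv d N"
  define E' where "E' = (g' - \<beta>) * minv d N'"
  have [simp]: "dim_row E = d" "dim_col E = d" "dim_row E' = d" "dim_col E' = d" by (auto simp: E_def E'_def)
  have "minv d (rhoR d \<beta>) * (E * rhoL d \<beta>) = minv d (rhoR d \<beta>) * (E' * rhoL d \<beta>)"
    using eq by (simp add: E_def E'_def mat_assoc flip: N_def N'_def)
  then have "rhoR d \<beta> * (minv d (rhoR d \<beta>) * (E * rhoL d \<beta>)) * minv d (rhoL d \<beta>)
      = rhoR d \<beta> * (minv d (rhoR d \<beta>) * (E' * rhoL d \<beta>)) * minv d (rhoL d \<beta>)" by simp
  then have EE: "E = E'"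
    by (simp add: pd_cancel[OF rho(2)] mat_assoc pd_props[OF rho(1)] mat_one_right)
  have 1: "g - \<beta> = E * N" by (simp add: E_def mat_assoc I mat_one_right)
  have 2: "g' - \<beta> = E * N'" unfolding EE by (simp add: E'_def mat_assoc I mat_one_right)
  define K where "K = 1\<^sub>m d - mat_adjoint \<beta> * \<beta>"
  have K: "pd_mat d K" using \<beta> by (simp add: K_def strict_contraction_def)
  note [simp] = pd_props(1,2,4,5)[OF K]
  define F where "F = 1\<^sub>m d + mat_adjoint \<beta> * E"
  have [simp]: "dim_row F = d" "dim_col F = d" by (auto simp: F_def)
  have FN: "F * N = K"
  proof -
    have "F * N = N + mat_adjoint \<beta> * (g - \<beta>)" by (simp add: F_def 1 mat_algebra)
    also have "\<dots> = K"
      by (simp add: N_def K_def mat_algebra) (rule eq_matI, simp_all del: index_mult_mat(1))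
    finally show ?thesis .
  qed
  have FN': "F * N' = K"
  proof -
    have "F * N' = N' + mat_adjoint \<beta> * (g' - \<beta>)" by (simp add: F_def 2 mat_algebra)
    also have "\<dots> = K"
      by (simp add: N'_def K_def mat_algebra) (rule eq_matI, simp_all del: index_mult_mat(1))
    finally show ?thesis .
  qed
  define L where "L = N * minv d K"
  have [simp]: "dim_row L = d" "dim_col L = d" by (auto simp: L_def)
  have "F * L = 1\<^sub>m d" by (simp add: L_def mat_assoc[symmetric] FN pd_props[OF K])
  then have LF: "L * F = 1\<^sub>m d" by (intro mat_right_inverse_imp_left[of F d L]) (auto intro: carrier_matI)
  have "N = L * F * N" by (simp add: LF mat_one_left)
  also have "\<dots> = L * F * N'" by (simp add: mat_assoc FN FN')
  also have "\<dots> = N'" by (simp add: LF mat_one_left)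
  finally have "N = N'" .
  then have "g - \<beta> = g' - \<beta>" by (simp add: 1 2)
  then have "(g - \<beta>) $$ (i, j) = (g' - \<beta>) $$ (i, j)" for i j by simp
  then show ?thesis by (intro eq_matI) (metis (no_types, lifting) \<open>dim_row \<beta> = d\<close> \<open>dim_col \<beta> = d\<close>
        \<open>dim_row g' = d\<close> \<open>dim_col g' = d\<close> diff_add_cancel index_minus_mat(1), simp_all)
qed

text \<open>The denominator is invertible at 0 by strictness and hence near 0, the numerator
  vanishes at 0, and dividing by z leaves a removable singularity. The radius may shrink.\<close>

lemma schur_step_holo:
  assumes "r > 0" and g: "holo_mat r d g" and \<beta>: "strict_contraction d (g 0)"
  obtains s where "s > 0" "s \<le> r" "holo_mat s d (schur_step d g)"
    "\<And>z. z \<in> ball 0 s \<Longrightarrow> Determinant.det (1\<^sub>m d - mat_adjoint (g 0) * g z) \<noteq> 0"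
proof -
  define N where "N z = 1\<^sub>m d - mat_adjoint (g 0) * g z" for z
  have c: "g 0 \<in> carrier_mat d d" using \<beta> by (simp add: strict_contraction_def)
  note alg = fun_algebra_holomorphic[of "ball 0 r"]
  have N: "holo_mat r d N"
    unfolding N_def by (intro mat_fun_diff[OF alg] mat_fun_mult[OF alg, where n = d and m = d and l = d] mat_fun_const[OF alg] g c
        mat_adjoint_carrier one_carrier_mat)
  have "isCont (\<lambda>z. Determinant.det (N z)) 0"
    using mat_fun_det[OF alg N] assms(1)
    by (metis centre_in_ball continuous_on_eq_continuous_at holomorphic_on_imp_continuous_on open_ball)
  moreover have "Determinant.det (N 0) \<noteq> 0"
    using \<beta> pd_det[of d "N 0"] by (simp add: N_def strict_contraction_def)
  ultimately obtain e where e: "e > 0" "\<And>y. dist 0 y < e \<Longrightarrow> Determinant.det (N y) \<noteq> 0"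
    using continuous_at_avoid by blast
  define s where "s = min r e"
  have s: "s > 0" "s \<le> r" "\<And>z. z \<in> ball 0 s \<Longrightarrow> Determinant.det (N z) \<noteq> 0"
    using e assms(1) by (auto simp: s_def)
  define T where "T z = minv d (rhoR d (g 0)) * (g z - g 0) * minv d (N z) * rhoL d (g 0)" for z
  note rho = rho_props[OF \<beta>]
  have cr: "minv d (rhoR d (g 0)) \<in> carrier_mat d d" "rhoL d (g 0) \<in> carrier_mat d d"
    using pd_props[OF rho(1)] pd_props[OF rho(2)] by (auto intro: carrier_matI)
  note alg' = fun_algebra_holomorphic[of "ball 0 s"]
  have T: "holo_mat s d T"
    unfolding T_def by (intro mat_fun_mult[OF alg', where n = d and m = d and l = d] mat_fun_diff[OF alg'] mat_fun_const[OF alg']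
       mat_fun_minv[OF alg'] holo_mat_subset[OF g] holo_mat_subset[OF N] s cr c)
  have T0: "T 0 $$ (a, b) = 0" if "a < d" "b < d" for a b
  proof -
    have "g 0 - g 0 = 0\<^sub>m d d" using c by (intro eq_matI) auto
    moreover have "0 \<in> ball 0 r" "0 \<in> ball 0 s" using s(1) assms(1) by auto
    then have "minv d (N 0) \<in> carrier_mat d d"
      by (intro minv_inverse(1) mat_funD(1)[OF N] s(3))
    ultimately have "T 0 = 0\<^sub>m d d"
      using cr by (simp add: T_def zero_mat_left zero_mat_right)
    then show ?thesis using that by simp
  qed
  \<comment> \<open>The difference quotient completed by the derivative at 0; this is the
    holomorphic continuation whose value at 0 is the limit taken by \<open>fill0\<close>.\<close>
  define q where "q a b z = (if z = 0 then deriv (\<lambda>z. T z $$ (a, b)) 0 else (T z $$ (a, b) - T 0 $$ (a, b)) / (z - 0))"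
    for a b z
  define Q where "Q z = Matrix.mat d d (\<lambda>(a, b). q a b z)" for z
  have q: "q a b holomorphic_on ball 0 s" if "a < d" "b < d" for a b
    unfolding q_def[abs_def] by (rule pole_lemma_open[OF mat_funD(2)[OF T that] open_ball])
  have Q: "holo_mat s d Q"
    unfolding mat_fun_def Q_def using q by auto
  have step: "schur_step d g z = Q z" if "z \<in> ball 0 s" for z
    unfolding schur_step_eq
  proof (rule fill0_continuous[OF s(1) _ _ _ that])
    show "Q 0 \<in> carrier_mat d d" by (simp add: Q_def)
    show "isCont (\<lambda>z. Q z $$ (a, b)) 0" if "a < d" "b < d" for a b
      by (rule holo_mat_isCont[OF Q s(1) that])
    fix w assume w: "w \<in> ball 0 s" "w \<noteq> (0::complex)"
    have "1 / w \<cdot>\<^sub>m T w = Q w"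
      using mat_funD(1)[OF T w(1)] w(2) by (intro eq_matI) (auto simp: Q_def q_def T0)
    then show "1 / w \<cdot>\<^sub>m (minv d (rhoR d (g 0)) * (g w - g 0) *
        minv d (1\<^sub>m d - mat_adjoint (g 0) * g w) * rhoL d (g 0)) = Q w"
      by (simp add: T_def N_def)
  qed
  have "holo_mat s d (schur_step d g)"
    by (rule mat_fun_cong[OF alg' Q]) (simp add: step)
  with s that show ?thesis by (auto simp: N_def)
qed

lemma smult_mat_cancel:
  fixes A B :: "complex mat" assumes "c \<noteq> 0" "c \<cdot>\<^sub>m A = c \<cdot>\<^sub>m B" shows "A = B"
proof -
  have 1: "X = (1 / c) \<cdot>\<^sub>m (c \<cdot>\<^sub>m X)" for X :: "complex mat" using assms(1) by (intro eq_matI) auto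
  have "A = (1 / c) \<cdot>\<^sub>m (c \<cdot>\<^sub>m A)" by (rule 1)
  also have "\<dots> = (1 / c) \<cdot>\<^sub>m (c \<cdot>\<^sub>m B)" by (simp only: assms(2))
  also have "\<dots> = B" by (rule 1[symmetric])
  finally show ?thesis .
qed

text \<open>Invertibility of the denominators is only needed near \<open>0\<close>, where it holds by continuity; the identity
  theorem then replaces the matrix Schwarz lemma.\<close>

lemma schur_iter_inj:
  assumes "\<And>m. m < i \<Longrightarrow> strict_contraction d (\<beta> m)" and "r > 0" "holo_mat r d g" "holo_mat r d g'"
    and "\<And>m. m < i \<Longrightarrow> schur_iter d g m 0 = \<beta> m" "\<And>m. m < i \<Longrightarrow> schur_iter d g' m 0 = \<beta> m"
    and "\<And>z. z \<in> ball 0 r \<Longrightarrow> schur_iter d g i z = schur_iter d g' i z"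
  shows "\<exists>s>0. s \<le> r \<and> (\<forall>z\<in>ball 0 s. g z = g' z)"
  using assms
proof (induction i arbitrary: g g' r \<beta>)
  case 0
  then show ?case by (intro exI[of _ r]) (auto simp: schur_iter_0)
next
  case (Suc i)
  have g0: "g 0 = \<beta> 0" "g' 0 = \<beta> 0" using Suc.prems(5,6)[of 0] by (simp_all add: schur_iter_0)
  have \<beta>: "strict_contraction d (\<beta> 0)" using Suc.prems(1) by simp
  obtain s where s: "s > 0" "s \<le> r" "holo_mat s d (schur_step d g)"
    "\<And>z. z \<in> ball 0 s \<Longrightarrow> Determinant.det (1\<^sub>m d - mat_adjoint (\<beta> 0) * g z) \<noteq> 0"
    using schur_step_holo[OF Suc.prems(2,3)] \<beta> unfolding g0 by metis
  obtain s' where s': "s' > 0" "s' \<le> r" "holo_mat s' d (schur_step d g')"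
    "\<And>z. z \<in> ball 0 s' \<Longrightarrow> Determinant.det (1\<^sub>m d - mat_adjoint (\<beta> 0) * g' z) \<noteq> 0"
    using schur_step_holo[OF Suc.prems(2,4)] \<beta> unfolding g0 by metis
  define t where "t = min s s'"
  have t: "t > 0" "t \<le> s" "t \<le> s'" using s s' by (auto simp: t_def)
  have "\<exists>u>0. u \<le> t \<and> (\<forall>z\<in>ball 0 u. schur_step d g z = schur_step d g' z)"
  proof (rule Suc.IH[of "\<lambda>m. \<beta> (Suc m)"])
    show "holo_mat t d (schur_step d g)" "holo_mat t d (schur_step d g')"
      using holo_mat_subset[OF s(3) t(2)] holo_mat_subset[OF s'(3) t(3)] by auto
    show "schur_iter d (schur_step d g) m 0 = \<beta> (Suc m)" if "m < i" for m
      using Suc.prems(5)[of "Suc m"] that by (simp add: schur_iter_Suc)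
    show "schur_iter d (schur_step d g') m 0 = \<beta> (Suc m)" if "m < i" for m
      using Suc.prems(6)[of "Suc m"] that by (simp add: schur_iter_Suc)
    show "schur_iter d (schur_step d g) i z = schur_iter d (schur_step d g') i z" if "z \<in> ball 0 t" for z
      using Suc.prems(7)[of z] that t(2) s(2) by (simp add: schur_iter_Suc)
  qed (use Suc.prems(1) t in auto)
  then obtain u where u: "u > 0" "u \<le> t" "\<And>z. z \<in> ball 0 u \<Longrightarrow> schur_step d g z = schur_step d g' z" by blast
  have "g z = g' z" if z: "z \<in> ball 0 u" for z
  proof (cases "z = 0")
    case False
    let ?T = "\<lambda>g. minv d (rhoR d (\<beta> 0)) * (g z - \<beta> 0) * minv d (1\<^sub>m d - mat_adjoint (\<beta> 0) * g z) * rhoL d (\<beta> 0)"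
    have "(1 / z) \<cdot>\<^sub>m ?T g = (1 / z) \<cdot>\<^sub>m ?T g'"
      using u(3)[OF z] False by (simp add: schur_step_eq fill0_def g0)
    moreover have "1 / z \<noteq> 0" using False by simp
    ultimately have "?T g = ?T g'" by (rule smult_mat_cancel[rotated])
    moreover have "z \<in> ball 0 s" "z \<in> ball 0 s'" "z \<in> ball 0 r" using z u(2) t(2,3) s(2) by auto
    ultimately show ?thesis
      by (intro mobius_inj[OF \<beta> mat_funD(1)[OF Suc.prems(3)] mat_funD(1)[OF Suc.prems(4)] s(4) s'(4)])
  qed (simp add: g0)
  then show ?case using u t s by (intro exI[of _ u]) auto
qed

lemma schur_fun_iff: "schur_fun d g \<longleftrightarrow> holo_mat 1 d g \<and> (\<forall>z\<in>ball 0 1. contraction d (g z))"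
  by (auto simp: schur_fun_def mat_fun_def contraction_def)

text \<open>Existence comes from \<open>inv_schur\<close>. For uniqueness, two candidates share all
  parameters and the terminal value, so they agree near 0 and then on the disc by the identity
  theorem.\<close>

lemma inv_iterate_eq:
  assumes \<alpha>: "\<And>m. m < j \<Longrightarrow> strict_contraction d (verblunsky d M W m)" and z: "z \<in> ball 0 1"
  shows "inv_iterate d M W j z = inv_schur d (verblunsky d M W) j z"
proof -
  let ?\<alpha> = "verblunsky d M W"
  \<comment> \<open>The cut-off matches the normalisation to 0 off the disc, which makes the
    described function unique everywhere.\<close>
  define b where "b z = (if z \<in> ball 0 1 then inv_schur d ?\<alpha> j z else 0\<^sub>m d d)" for z
  have bz: "b z = inv_schur d ?\<alpha> j z" if "z \<in> ball 0 1" for z using that by (simp add: b_def)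
  have b0: "b z = 0\<^sub>m d d" if "z \<notin> ball 0 1" for z using that by (auto simp: b_def)
  have hb: "holo_mat 1 d b"
    by (rule mat_fun_cong[OF fun_algebra_holomorphic inv_schur_holo[OF \<alpha>]]) (simp_all add: bz)
  have iter: "schur_iter d b m z = inv_schur d ?\<alpha> (j - m) z" if "m \<le> j" "z \<in> ball 0 1" for m z
    by (rule schur_iter_inv_schur[OF \<alpha> bz that(2,1)])
  have par: "schur_iter d b m 0 = - mat_adjoint (?\<alpha> (j - 1 - m))" if "m < j" for m
  proof -
    from that obtain l where l: "j - m = Suc l" "l < j" "j - 1 - m = l" by (cases "j - m") auto
    have "schur_iter d b m 0 = mobius d (?\<alpha> l) 0 (inv_schur d ?\<alpha> l 0)"
      using iter[of m 0] that by (simp add: l(1))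
    also have "\<dots> = - mat_adjoint (?\<alpha> l)"
      using \<alpha> l by (intro mobius_at_0 inv_schur_contraction) auto
    finally show ?thesis by (simp only: l(3))
  qed
  have P: "schur_fun d b \<and> (\<forall>z. z \<notin> ball 0 1 \<longrightarrow> b z = 0\<^sub>m d d) \<and>
      (\<forall>m<j. schur_iter d b m 0 = - mat_adjoint (?\<alpha> (j - 1 - m))) \<and>
      (\<forall>z \<in> ball 0 1. schur_iter d b j z = 1\<^sub>m d)"
    using hb b0 par iter[of j] bz inv_schur_contraction[OF \<alpha>] by (simp add: schur_fun_iff)
  have "inv_iterate d M W j = b"
    unfolding inv_iterate_def
  proof (rule the_equality[where P = "\<lambda>g. schur_fun d g \<and> (\<forall>z. z \<notin> ball 0 1 \<longrightarrow> g z = 0\<^sub>m d d) \<and>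
      (\<forall>m<j. schur_iter d g m 0 = - mat_adjoint (?\<alpha> (j - 1 - m))) \<and>
      (\<forall>z \<in> ball 0 1. schur_iter d g j z = 1\<^sub>m d)", OF P])
    fix g assume g: "schur_fun d g \<and> (\<forall>z. z \<notin> ball 0 1 \<longrightarrow> g z = 0\<^sub>m d d) \<and>
      (\<forall>m<j. schur_iter d g m 0 = - mat_adjoint (?\<alpha> (j - 1 - m))) \<and>
      (\<forall>z \<in> ball 0 1. schur_iter d g j z = 1\<^sub>m d)"
    then have hg: "holo_mat 1 d g" by (simp add: schur_fun_iff)
    have "\<exists>s>0. s \<le> 1 \<and> (\<forall>z\<in>ball 0 s. g z = b z)"
      using g P \<alpha> by (intro schur_iter_inj[of j d "\<lambda>m. - mat_adjoint (?\<alpha> (j - 1 - m))"] hb hg)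
         (auto intro!: strict_contraction_neg_adjoint)
    then obtain s where s: "s > 0" "s \<le> 1" "\<And>z. z \<in> ball 0 s \<Longrightarrow> g z = b z" by blast
    have "g w = b w" if w: "w \<in> ball 0 1" for w
    proof (rule eq_matI)
      fix a c assume "a < dim_row (b w)" "c < dim_col (b w)"
      then have ac: "a < d" "c < d" using mat_funD(1)[OF hb w] by auto
      show "g w $$ (a, c) = b w $$ (a, c)"
      proof (rule analytic_continuation_open[where s = "ball 0 s" and s' = "ball 0 1"
            and f = "\<lambda>w. g w $$ (a, c)" and g = "\<lambda>w. b w $$ (a, c)"])
        show "(\<lambda>w. g w $$ (a, c)) holomorphic_on ball 0 1" by (rule mat_funD(2)[OF hg ac])
        show "(\<lambda>w. b w $$ (a, c)) holomorphic_on ball 0 1" by (rule mat_funD(2)[OF hb ac])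
      qed (use s w in auto)
    qed (use mat_funD(1)[OF hb w] mat_funD(1)[OF hg w] in auto)
    then show "g = b" using g b0 by (intro ext) metis
  qed
  then show ?thesis by (simp add: bz[OF z])
qed

section \<open>The matrix-valued inner product\<close>

definition circ :: "complex set" where "circ = sphere 0 1"

abbreviation cfun :: "nat \<Rightarrow> nat \<Rightarrow> (complex \<Rightarrow> complex mat) \<Rightarrow> bool" where
  "cfun \<equiv> mat_fun circ (continuous_on circ)"

lemma fun_algebra_continuous_on: "fun_algebra S (continuous_on S)"
  by unfold_locales (auto intro!: continuous_intros intro: continuous_on_eq)

lemmas cfun_intros = mat_fun_const[OF fun_algebra_continuous_on] mat_fun_add[OF fun_algebra_continuous_on]
  mat_fun_diff[OF fun_algebra_continuous_on] mat_fun_smult[OF fun_algebra_continuous_on]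
lemmas cfun_mult = mat_fun_mult[OF fun_algebra_continuous_on]

lemma cfun_adjoint:
  assumes "cfun n m g" shows "cfun m n (\<lambda>t. mat_adjoint (g t))"
  unfolding mat_fun_def
proof (intro conjI ballI allI impI)
  fix a b assume ab: "a < m" "b < n"
  have "continuous_on circ (\<lambda>t. cnj (g t $$ (b, a)))"
    by (intro continuous_intros mat_funD(2)[OF assms] ab)
  then show "continuous_on circ (\<lambda>t. mat_adjoint (g t) $$ (a, b))"
  proof (rule continuous_on_eq)
    fix t assume "t \<in> circ"
    from carrier_matD[OF mat_funD(1)[OF assms this]] ab
    show "cnj (g t $$ (b, a)) = mat_adjoint (g t) $$ (a, b)" by (subst index_mat_adjoint) auto
  qed
qed (use mat_funD(1)[OF assms] in \<open>auto intro: mat_adjoint_carrier\<close>)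

section \<open>Matrix polynomials given by coefficient lists\<close>

lemma mpeval_carrier: "set cs \<subseteq> carrier_mat d d \<Longrightarrow> mpeval d cs z \<in> carrier_mat d d"
  by (induction cs) auto

lemma mpeval_dim [simp]: "set cs \<subseteq> carrier_mat d d \<Longrightarrow> dim_row (mpeval d cs z) = d"
    "set cs \<subseteq> carrier_mat d d \<Longrightarrow> dim_col (mpeval d cs z) = d"
  using mpeval_carrier[of cs d z] by auto

lemma cfun_mpeval: "set cs \<subseteq> carrier_mat d d \<Longrightarrow> cfun d d (mpeval d cs)"
proof (induction cs)
  case Nil
  show ?case using cfun_intros(1)[of "0\<^sub>m d d" d d] by (simp add: fun_eq_iff)
next
  case (Cons c cs)
  have "cfun d d (\<lambda>z. c + z \<cdot>\<^sub>m mpeval d cs z)"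
    by (intro cfun_intros continuous_intros Cons.IH) (use Cons.prems in auto)
  then show ?case by (rule mat_fun_cong[OF fun_algebra_continuous_on]) simp
qed

lemma mpeval_index:
  assumes "set cs \<subseteq> carrier_mat d d" "a < d" "b < d"
  shows "mpeval d cs z $$ (a, b) = (\<Sum>i<length cs. z ^ i * cs ! i $$ (a, b))"
  using assms(1)
proof (induction cs)
  case (Cons c cs)
  then have "mpeval d (c # cs) z $$ (a, b) = c $$ (a, b) + z * mpeval d cs z $$ (a, b)"
    using assms by simp
  also have "\<dots> = (\<Sum>i<length (c # cs). z ^ i * (c # cs) ! i $$ (a, b))"
    using Cons by (simp add: sum.lessThan_Suc_shift sum_distrib_left mult.assoc del: sum.lessThan_Suc)
  finally show ?case .
qed (use assms in simp)

lemma mpeval_rev: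
  assumes cs: "set cs \<subseteq> carrier_mat d d" "length cs = Suc n" and z: "z \<noteq> 0"
  shows "mpeval d (rev cs) (inverse z) = inverse z ^ n \<cdot>\<^sub>m mpeval d cs z"
proof (rule eq_matI)
  fix a b assume "a < dim_row (inverse z ^ n \<cdot>\<^sub>m mpeval d cs z)" "b < dim_col (inverse z ^ n \<cdot>\<^sub>m mpeval d cs z)"
  then have ab: "a < d" "b < d" using cs by auto
  have "mpeval d (rev cs) (inverse z) $$ (a, b) = (\<Sum>i<Suc n. inverse z ^ i * rev cs ! i $$ (a, b))"
    using cs ab by (subst mpeval_index) auto
  also have "\<dots> = (\<Sum>i<Suc n. inverse z ^ (n - i) * cs ! i $$ (a, b))"
    by (subst sum.nat_diff_reindex[symmetric]) (use cs in \<open>auto simp: rev_nth intro!: sum.cong\<close>)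
  also have "\<dots> = (\<Sum>i<Suc n. inverse z ^ n * (z ^ i * cs ! i $$ (a, b)))"
  proof (rule sum.cong)
    fix i assume "i \<in> {..<Suc n}"
    then have "inverse z ^ n = inverse z ^ (n - i) * inverse z ^ i" by (simp flip: power_add)
    then have "inverse z ^ n * z ^ i = inverse z ^ (n - i) * (inverse z * z) ^ i"
      by (simp add: power_mult_distrib mult.assoc)
    then have "inverse z ^ n * z ^ i = inverse z ^ (n - i)" using z by simp
    then show "inverse z ^ (n - i) * cs ! i $$ (a, b) = inverse z ^ n * (z ^ i * cs ! i $$ (a, b))"
      by (simp only: mult.assoc[symmetric])
  qed simp
  also have "\<dots> = (inverse z ^ n \<cdot>\<^sub>m mpeval d cs z) $$ (a, b)"
    using cs ab by (simp add: mpeval_index sum_distrib_left del: sum.lessThan_Suc)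
  finally show "mpeval d (rev cs) (inverse z) $$ (a, b) = (inverse z ^ n \<cdot>\<^sub>m mpeval d cs z) $$ (a, b)" .
qed (use cs in auto)

lemma mpeval_mult_right:
  assumes "set cs \<subseteq> carrier_mat d d" "C \<in> carrier_mat d d"
  shows "mpeval d (map (\<lambda>c. c * C) cs) z = mpeval d cs z * C"
  using assms by (induction cs) (auto simp: mat_distrib_right mat_smult_left zero_mat_left)

lemma mpeval_diff:
  assumes "length cs = length ds" "set cs \<subseteq> carrier_mat d d" "set ds \<subseteq> carrier_mat d d"
  shows "mpeval d (map2 (-) cs ds) z = mpeval d cs z - mpeval d ds z"
  using assms
proof (induction cs ds rule: list_induct2)
  case (Cons c cs e ds)
  then have [simp]: "dim_row c = d" "dim_col c = d" "dim_row e = d" "dim_col e = d" by auto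
  show ?case using Cons by simp (rule eq_matI, auto simp: algebra_simps)
qed (auto intro!: eq_matI)

lemma mpeval_append_zero:
  assumes "set cs \<subseteq> carrier_mat d d"
  shows "mpeval d (cs @ [0\<^sub>m d d]) z = mpeval d cs z"
  using assms by (induction cs) auto

lemma mpeval_cons_zero:
  assumes "set cs \<subseteq> carrier_mat d d"
  shows "mpeval d (0\<^sub>m d d # cs) z = z \<cdot>\<^sub>m mpeval d cs z"
  using mpeval_carrier[OF assms, of z] by simp

text \<open>Non-triviality is stated for vector polynomials; a matrix polynomial enters it through
  its action on a constant vector.\<close>

lemma vpeval_mpeval:
  assumes "set cs \<subseteq> carrier_mat d d" "v \<in> carrier_vec d"
  shows "vpeval d (map (\<lambda>c. c *\<^sub>v v) cs) z = mpeval d cs z *\<^sub>v v"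
  using assms
proof (induction cs)
  case Nil
  then show ?case by (auto intro!: eq_vecI)
next
  case (Cons c cs)
  then have "mpeval d (c # cs) z *\<^sub>v v = c *\<^sub>v v + (z \<cdot>\<^sub>m mpeval d cs z) *\<^sub>v v"
    using mpeval_carrier[of cs d z] by (simp add: add_mult_distrib_mat_vec[of _ d d])
  also have "(z \<cdot>\<^sub>m mpeval d cs z) *\<^sub>v v = z \<cdot>\<^sub>v (mpeval d cs z *\<^sub>v v)"
    using Cons.prems mpeval_carrier[of cs d z] by (intro smult_mat_mult_vec) auto
  finally show ?case using Cons by simp
qed

section \<open>Integration against a non-trivial matrix measure\<close>

locale matrix_meas =
  fixes d :: nat and M :: "complex measure" and W :: "complex \<Rightarrow> complex mat"
  assumes mm: "matrix_measure d M W" and nontrivial: "nontrivial_mm d M W"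
begin

lemma space_M: "space M = circ"
  using mm sets_eq_imp_space_eq[of M "restrict_space borel (sphere 0 1)"]
  by (simp add: matrix_measure_def space_restrict_space circ_def)

lemma W_carrier: "t \<in> circ \<Longrightarrow> W t \<in> carrier_mat d d"
  and W_psd: "t \<in> circ \<Longrightarrow> psd_mat d (W t)"
  using mm by (auto simp: matrix_measure_def psd_mat_def space_M)

lemma integrable_W: "a < d \<Longrightarrow> b < d \<Longrightarrow> integrable M (\<lambda>t. W t $$ (a, b))"
  using mm by (simp add: matrix_measure_def)

lemma measurable_continuous: 
  fixes c :: "complex \<Rightarrow> complex"
  assumes "continuous_on circ c" shows "c \<in> borel_measurable M"
proof -
  have "sets M = sets (restrict_space borel circ)" using mm by (simp add: matrix_measure_def circ_def)
  then show ?thesis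
    using borel_measurable_continuous_on_restrict[OF assms] by (simp cong: measurable_cong_sets)
qed

lemma integrable_continuous_mult:
  fixes c f :: "complex \<Rightarrow> complex"
  assumes c: "continuous_on circ c" and f: "integrable M f"
  shows "integrable M (\<lambda>t. c t * f t)"
proof -
  have "compact (c ` circ)" using c by (intro compact_continuous_image) (auto simp: circ_def)
  then obtain B where B: "\<And>t. t \<in> circ \<Longrightarrow> norm (c t) \<le> B"
    using compact_imp_bounded bounded_iff by (metis imageI)
  show ?thesis
  proof (rule Bochner_Integration.integrable_bound)
    show "integrable M (\<lambda>t. B * norm (f t))" using f by simp
    show "(\<lambda>t. c t * f t) \<in> borel_measurable M"
      using measurable_continuous[OF c] f by auto
    show "AE t in M. norm (c t * f t) \<le> norm (B * norm (f t))"
    proof (rule AE_I2)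
      fix t assume "t \<in> space M"
      then have "norm (c t) \<le> B" using B by (simp add: space_M)
      then have "norm (c t) * norm (f t) \<le> B * norm (f t)" by (rule mult_right_mono) simp
      then show "norm (c t * f t) \<le> norm (B * norm (f t))" by (simp add: norm_mult)
    qed
  qed
qed

text \<open>A rectangular form of \<open>mat_int\<close>, because later a d x d function is paired
  with a whole row of blocks.\<close>

definition mint :: "nat \<Rightarrow> nat \<Rightarrow> (complex \<Rightarrow> complex mat) \<Rightarrow> complex mat" where
  "mint n m F = Matrix.mat n m (\<lambda>(a,b). integral\<^sup>L M (\<lambda>t. F t $$ (a,b)))"

definition integrable_mat :: "nat \<Rightarrow> nat \<Rightarrow> (complex \<Rightarrow> complex mat) \<Rightarrow> bool" where
  "integrable_mat n m F \<longleftrightarrow> (\<forall>t\<in>circ. F t \<in> carrier_mat n m) \<and> (\<forall>a<n. \<forall>b<m. integrable M (\<lambda>t. F t $$ (a,b)))"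

lemma mint_dim [simp]: "dim_row (mint n m F) = n" "dim_col (mint n m F) = m" "mint n m F \<in> carrier_mat n m"
  by (simp_all add: mint_def)

lemma integral_cong_circ: "(\<And>t. t \<in> circ \<Longrightarrow> f t = g t) \<Longrightarrow> integral\<^sup>L M f = integral\<^sup>L M g"
  for f g :: "complex \<Rightarrow> complex"
  by (rule Bochner_Integration.integral_cong) (simp_all add: space_M)

lemma integrable_cong_circ: "(\<And>t. t \<in> circ \<Longrightarrow> f t = g t) \<Longrightarrow> integrable M f \<longleftrightarrow> integrable M g"
  for f g :: "complex \<Rightarrow> complex"
  by (rule Bochner_Integration.integrable_cong) (simp_all add: space_M)

lemma mint_cong: "(\<And>t. t \<in> circ \<Longrightarrow> F t = G t) \<Longrightarrow> mint n m F = mint n m G"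
  unfolding mint_def by (intro cong_mat) (auto intro!: integral_cong_circ)

lemma integrable_mat_sandwich:
  assumes A: "cfun n d A" and B: "cfun d m B"
  shows "integrable_mat n m (\<lambda>t. A t * W t * B t)"
  unfolding integrable_mat_def
proof (intro conjI ballI allI impI)
  fix a b assume ab: "a < n" "b < m"
  have "integrable M (\<lambda>t. \<Sum>k<d. \<Sum>l<d. (A t $$ (a,k) * B t $$ (l,b)) * W t $$ (k,l))"
    by (intro Bochner_Integration.integrable_sum integrable_continuous_mult continuous_intros integrable_W
        mat_funD(2)[OF A] mat_funD(2)[OF B] ab) auto
  moreover have "(A t * W t * B t) $$ (a, b) = (\<Sum>k<d. \<Sum>l<d. (A t $$ (a,k) * B t $$ (l,b)) * W t $$ (k,l))"
    if t: "t \<in> circ" for t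
    using mat_funD(1)[OF A t] mat_funD(1)[OF B t] W_carrier[OF t] ab
    by (simp add: scalar_prod_def atLeast0LessThan sum_distrib_left mult_ac)
  ultimately show "integrable M (\<lambda>t. (A t * W t * B t) $$ (a, b))"
    by (subst integrable_cong_circ) auto
next
  fix t assume t: "t \<in> circ"
  show "A t * W t * B t \<in> carrier_mat n m"
    by (rule mult_carrier_mat[OF mult_carrier_mat[OF mat_funD(1)[OF A t] W_carrier[OF t]] mat_funD(1)[OF B t]])
qed

lemma mint_add:
  assumes "integrable_mat n m F" "integrable_mat n m G"
  shows "mint n m (\<lambda>t. F t + G t) = mint n m F + mint n m G"
proof (rule eq_matI)
  fix a b assume "a < dim_row (mint n m F + mint n m G)" "b < dim_col (mint n m F + mint n m G)"
  then have ab: "a < n" "b < m" by auto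
  have "integral\<^sup>L M (\<lambda>t. (F t + G t) $$ (a,b)) = integral\<^sup>L M (\<lambda>t. F t $$ (a,b) + G t $$ (a,b))"
  proof (rule integral_cong_circ)
    fix t assume "t \<in> circ"
    with assms(2) have "G t \<in> carrier_mat n m" by (auto simp: integrable_mat_def)
    then show "(F t + G t) $$ (a,b) = F t $$ (a,b) + G t $$ (a,b)" using ab by simp
  qed
  also have "\<dots> = integral\<^sup>L M (\<lambda>t. F t $$ (a,b)) + integral\<^sup>L M (\<lambda>t. G t $$ (a,b))"
    using assms ab by (intro Bochner_Integration.integral_add) (auto simp: integrable_mat_def)
  finally show "mint n m (\<lambda>t. F t + G t) $$ (a, b) = (mint n m F + mint n m G) $$ (a, b)"
    using ab by (simp add: mint_def)
qed auto

lemma mint_mult_right: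
  assumes F: "integrable_mat n m F" and C: "C \<in> carrier_mat m l"
  shows "mint n l (\<lambda>t. F t * C) = mint n m F * C"
proof (rule eq_matI)
  fix a b assume "a < dim_row (mint n m F * C)" "b < dim_col (mint n m F * C)"
  then have ab: "a < n" "b < l" using C by auto
  have "integral\<^sup>L M (\<lambda>t. (F t * C) $$ (a,b)) = integral\<^sup>L M (\<lambda>t. \<Sum>k<m. F t $$ (a,k) * C $$ (k,b))"
  proof (rule integral_cong_circ)
    fix t assume "t \<in> circ"
    with F have "F t \<in> carrier_mat n m" by (auto simp: integrable_mat_def)
    then show "(F t * C) $$ (a,b) = (\<Sum>k<m. F t $$ (a,k) * C $$ (k,b))"
      using C ab by (simp add: scalar_prod_def atLeast0LessThan)
  qed
  also have "\<dots> = (\<Sum>k<m. integral\<^sup>L M (\<lambda>t. F t $$ (a,k)) * C $$ (k,b))"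
    using F ab by (subst Bochner_Integration.integral_sum) (auto simp: integrable_mat_def)
  finally show "mint n l (\<lambda>t. F t * C) $$ (a, b) = (mint n m F * C) $$ (a, b)"
    using ab C by (simp add: mint_def scalar_prod_def atLeast0LessThan)
qed (use C in auto)

lemma mint_adjoint:
  assumes F: "\<And>t. t \<in> circ \<Longrightarrow> F t \<in> carrier_mat n m"
  shows "mint m n (\<lambda>t. mat_adjoint (F t)) = mat_adjoint (mint n m F)"
proof (rule eq_matI)
  fix a b assume "a < dim_row (mat_adjoint (mint n m F))" "b < dim_col (mat_adjoint (mint n m F))"
  then have ab: "a < m" "b < n" by auto
  have "integral\<^sup>L M (\<lambda>t. mat_adjoint (F t) $$ (a,b)) = integral\<^sup>L M (\<lambda>t. cnj (F t $$ (b,a)))"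
  proof (rule integral_cong_circ)
    fix t assume "t \<in> circ"
    from carrier_matD[OF F[OF this]] ab show "mat_adjoint (F t) $$ (a,b) = cnj (F t $$ (b,a))"
      by (subst index_mat_adjoint) auto
  qed
  also have "\<dots> = cnj (integral\<^sup>L M (\<lambda>t. F t $$ (b,a)))" by simp
  finally show "mint m n (\<lambda>t. mat_adjoint (F t)) $$ (a,b) = mat_adjoint (mint n m F) $$ (a,b)"
    using ab by (simp add: mint_def)
qed auto

lemma mint_quadratic:
  assumes F: "integrable_mat n n F" and v: "v \<in> carrier_vec n"
  shows "(mint n n F *\<^sub>v v) \<bullet>c v = integral\<^sup>L M (\<lambda>t. (F t *\<^sub>v v) \<bullet>c v)"
    "integrable M (\<lambda>t. (F t *\<^sub>v v) \<bullet>c v)"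
proof -
  have eq: "(F t *\<^sub>v v) \<bullet>c v = (\<Sum>a<n. \<Sum>b<n. F t $$ (a,b) * (v $ b * cnj (v $ a)))" if "t \<in> circ" for t
  proof -
    have "F t \<in> carrier_mat n n" using F that by (auto simp: integrable_mat_def)
    then show ?thesis using v by (simp add: scalar_prod_def atLeast0LessThan sum_distrib_right mult.assoc)
  qed
  have "(mint n n F *\<^sub>v v) \<bullet>c v = (\<Sum>a<n. \<Sum>b<n. integral\<^sup>L M (\<lambda>t. F t $$ (a,b)) * (v $ b * cnj (v $ a)))"
    using v by (simp add: mint_def scalar_prod_def atLeast0LessThan sum_distrib_right mult.assoc)
  also have "\<dots> = integral\<^sup>L M (\<lambda>t. \<Sum>a<n. \<Sum>b<n. F t $$ (a,b) * (v $ b * cnj (v $ a)))"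
    using F by (subst Bochner_Integration.integral_sum; (intro Bochner_Integration.integrable_sum)?;
        auto simp: integrable_mat_def Bochner_Integration.integral_sum)
  also have "\<dots> = integral\<^sup>L M (\<lambda>t. (F t *\<^sub>v v) \<bullet>c v)"
    by (rule integral_cong_circ) (simp add: eq)
  finally show "(mint n n F *\<^sub>v v) \<bullet>c v = integral\<^sup>L M (\<lambda>t. (F t *\<^sub>v v) \<bullet>c v)" .
  have "integrable M (\<lambda>t. \<Sum>a<n. \<Sum>b<n. F t $$ (a,b) * (v $ b * cnj (v $ a)))"
    using F by (intro Bochner_Integration.integrable_sum integrable_mult_left) (auto simp: integrable_mat_def)
  then show "integrable M (\<lambda>t. (F t *\<^sub>v v) \<bullet>c v)"
    by (subst integrable_cong_circ[OF eq]) auto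
qed

text \<open>The right inner product, extended to a second argument with \<open>m\<close>
  columns.\<close>

definition J :: "nat \<Rightarrow> (complex \<Rightarrow> complex mat) \<Rightarrow> (complex \<Rightarrow> complex mat) \<Rightarrow> complex mat" where
  "J m g h = mint d m (\<lambda>t. mat_adjoint (g t) * W t * h t)"

lemma J_dim [simp]: "dim_row (J m g h) = d" "dim_col (J m g h) = m" "J m g h \<in> carrier_mat d m"
  by (simp_all add: J_def)

lemma J_cong: "(\<And>t. t \<in> circ \<Longrightarrow> g t = g' t) \<Longrightarrow> (\<And>t. t \<in> circ \<Longrightarrow> h t = h' t) \<Longrightarrow> J m g h = J m g' h'"
  unfolding J_def by (intro mint_cong) simp

lemma integrable_J: "cfun d d g \<Longrightarrow> cfun d m h \<Longrightarrow> integrable_mat d m (\<lambda>t. mat_adjoint (g t) * W t * h t)"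
  by (intro integrable_mat_sandwich cfun_adjoint)

lemma cfun_dims: "cfun n m g \<Longrightarrow> t \<in> circ \<Longrightarrow> dim_row (g t) = n" "cfun n m g \<Longrightarrow> t \<in> circ \<Longrightarrow> dim_col (g t) = m"
  using mat_funD(1) by blast+

lemma W_dims: "t \<in> circ \<Longrightarrow> dim_row (W t) = d" "t \<in> circ \<Longrightarrow> dim_col (W t) = d"
  using W_carrier by blast+

lemma J_mult_right:
  assumes "cfun d d g" "cfun d m h" "C \<in> carrier_mat m l"
  shows "J l g (\<lambda>t. h t * C) = J m g h * C"
  unfolding J_def mint_mult_right[OF integrable_J[OF assms(1,2)] assms(3), symmetric]
  by (intro mint_cong) (use assms in \<open>simp add: mat_assoc cfun_dims W_dims\<close>)

lemma J_add_right:
  assumes "cfun d d g" "cfun d m h" "cfun d m h'"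
  shows "J m g (\<lambda>t. h t + h' t) = J m g h + J m g h'"
  unfolding J_def mint_add[OF integrable_J[OF assms(1,2)] integrable_J[OF assms(1,3)], symmetric]
  by (intro mint_cong) (use assms in \<open>simp add: mat_distrib_left cfun_dims W_dims\<close>)

lemma J_add_left:
  assumes "cfun d d g" "cfun d d g'" "cfun d m h"
  shows "J m (\<lambda>t. g t + g' t) h = J m g h + J m g' h"
  unfolding J_def mint_add[OF integrable_J[OF assms(1,3)] integrable_J[OF assms(2,3)], symmetric]
  by (intro mint_cong) (use assms in \<open>simp add: mat_distrib_right mat_adj cfun_dims W_dims\<close>)

text \<open>As conjugation is inversion on the circle, this is the device that moves powers of t
  from one argument to the other.\<close>

lemma J_scalar:
  assumes "cfun d d g" "cfun d m h"
  shows "J m (\<lambda>t. c t \<cdot>\<^sub>m g t) h = J m g (\<lambda>t. cnj (c t) \<cdot>\<^sub>m h t)"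
  unfolding J_def
  by (intro mint_cong) (use assms in \<open>simp add: mat_smult_right mat_smult_left mat_adj cfun_dims W_dims\<close>)

lemma J_adjoint:
  assumes "cfun d d g" "cfun d d h"
  shows "mat_adjoint (J d g h) = J d h g"
proof -
  have "mat_adjoint (J d g h) = mint d d (\<lambda>t. mat_adjoint (mat_adjoint (g t) * W t * h t))"
    unfolding J_def using integrable_J[OF assms] by (intro mint_adjoint[symmetric]) (auto simp: integrable_mat_def)
  also have "\<dots> = J d h g"
    unfolding J_def
    by (intro mint_cong) (use assms W_psd in \<open>simp add: mat_adj cfun_dims W_dims mat_assoc psd_matD(2)[of d]\<close>)
  finally show ?thesis .
qed

lemma J_smult_right:
  assumes "cfun d d g" "cfun d m h"
  shows "J m g (\<lambda>t. k \<cdot>\<^sub>m h t) = k \<cdot>\<^sub>m J m g h"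
proof -
  have "J m g (\<lambda>t. k \<cdot>\<^sub>m h t) = J m g (\<lambda>t. h t * (k \<cdot>\<^sub>m 1\<^sub>m m))"
    by (intro J_cong) (use assms in \<open>simp_all add: mat_smult_right mat_one_right cfun_dims\<close>)
  also have "\<dots> = k \<cdot>\<^sub>m J m g h"
    by (subst J_mult_right[OF assms]) (auto simp: mat_smult_right mat_one_right)
  finally show ?thesis .
qed

lemma J_mult_left:
  assumes "cfun d d g" "cfun d m h" "C \<in> carrier_mat d d"
  shows "J m (\<lambda>t. g t * C) h = mat_adjoint C * J m g h"
proof -
  have "J m (\<lambda>t. g t * C) h = mint d m (\<lambda>t. mat_adjoint (mat_adjoint (mat_adjoint (g t) * W t * h t) * C))"
    unfolding J_def by (intro mint_cong) (use assms in \<open>simp add: mat_adj cfun_dims W_dims mat_assoc\<close>)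
  also have "\<dots> = mat_adjoint (mint m d (\<lambda>t. mat_adjoint (mat_adjoint (g t) * W t * h t) * C))"
  proof (rule mint_adjoint)
    fix t assume "t \<in> circ"
    then have "mat_adjoint (g t) * W t * h t \<in> carrier_mat d m"
      using integrable_J[OF assms(1,2)] by (auto simp: integrable_mat_def)
    from mult_carrier_mat[OF mat_adjoint_carrier[OF this] assms(3)]
    show "mat_adjoint (mat_adjoint (g t) * W t * h t) * C \<in> carrier_mat m d" .
  qed
  also have "mint m d (\<lambda>t. mat_adjoint (mat_adjoint (g t) * W t * h t) * C)
      = mint m d (\<lambda>t. mat_adjoint (h t) * W t * g t * C)"
    by (intro mint_cong) (use assms W_psd in \<open>simp add: mat_adj cfun_dims W_dims mat_assoc psd_matD(2)[of d]\<close>)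
  also have "\<dots> = mint m d (\<lambda>t. mat_adjoint (h t) * W t * g t) * C"
    by (intro mint_mult_right integrable_mat_sandwich cfun_adjoint assms)
  also have "mint m d (\<lambda>t. mat_adjoint (h t) * W t * g t) = mint m d (\<lambda>t. mat_adjoint (mat_adjoint (g t) * W t * h t))"
    by (intro mint_cong) (use assms W_psd in \<open>simp add: mat_adj cfun_dims W_dims mat_assoc psd_matD(2)[of d]\<close>)
  also have "\<dots> = mat_adjoint (J m g h)"
    unfolding J_def using integrable_J[OF assms(1,2)] by (intro mint_adjoint) (auto simp: integrable_mat_def)
  finally show ?thesis using assms(3) by (simp add: mat_adj)
qed

lemma J_diff_right:
  assumes "cfun d d g" "cfun d m h" "cfun d m h'"
  shows "J m g (\<lambda>t. h t - h' t) = J m g h - J m g h'"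
proof -
  have "J m g (\<lambda>t. h t - h' t) = J m g (\<lambda>t. h t + (-1) \<cdot>\<^sub>m h' t)"
    by (intro J_cong refl eq_matI) (use assms in \<open>simp_all add: cfun_dims\<close>)
  also have "\<dots> = J m g h + J m g (\<lambda>t. (-1) \<cdot>\<^sub>m h' t)"
    by (intro J_add_right assms cfun_intros continuous_intros)
  also have "\<dots> = J m g h - J m g h'"
    unfolding J_smult_right[OF assms(1,3)] by (rule eq_matI) auto
  finally show ?thesis .
qed

lemma J_diff_left:
  assumes "cfun d d g" "cfun d d g'" "cfun d m h"
  shows "J m (\<lambda>t. g t - g' t) h = J m g h - J m g' h"
proof -
  have "J m (\<lambda>t. g t - g' t) h = J m (\<lambda>t. g t + g' t * ((-1) \<cdot>\<^sub>m 1\<^sub>m d)) h"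
    by (intro J_cong refl eq_matI)
       (use assms in \<open>simp_all add: mat_smult_right mat_one_right cfun_dims\<close>)
  also have "\<dots> = J m g h + J m (\<lambda>t. g' t * ((-1) \<cdot>\<^sub>m 1\<^sub>m d)) h"
    by (intro J_add_left assms cfun_mult[OF assms(2)] cfun_intros) auto
  also have "\<dots> = J m g h - J m g' h"
    by (subst J_mult_left[OF assms(2,3)])
       (auto simp: mat_adj mat_smult_left mat_one_left intro!: eq_matI)
  finally show ?thesis .
qed

lemma J_quadratic:
  assumes h: "cfun d d h" and v: "v \<in> carrier_vec d"
  shows "(J d h h *\<^sub>v v) \<bullet>c v = integral\<^sup>L M (\<lambda>t. (W t *\<^sub>v (h t *\<^sub>v v)) \<bullet>c (h t *\<^sub>v v))"
    "integrable M (\<lambda>t. (W t *\<^sub>v (h t *\<^sub>v v)) \<bullet>c (h t *\<^sub>v v))"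
    "Re ((J d h h *\<^sub>v v) \<bullet>c v) \<ge> 0"
proof -
  have eq: "((mat_adjoint (h t) * W t * h t) *\<^sub>v v) \<bullet>c v = (W t *\<^sub>v (h t *\<^sub>v v)) \<bullet>c (h t *\<^sub>v v)"
    if t: "t \<in> circ" for t
  proof -
    note c = mat_funD(1)[OF h t] W_carrier[OF t]
    note hv = mult_mat_vec_carrier[OF c(1) v]
    note Whv = mult_mat_vec_carrier[OF c(2) hv]
    have "(mat_adjoint (h t) * W t * h t) *\<^sub>v v = mat_adjoint (h t) *\<^sub>v (W t *\<^sub>v (h t *\<^sub>v v))"
      using c v hv by (simp add: assoc_mult_mat_vec[of _ d d _ d] mult_carrier_mat[of _ d d])
    then show ?thesis using c Whv v by (simp add: cscalar_mult_mat_vec[of _ d d])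
  qed
  show 1: "(J d h h *\<^sub>v v) \<bullet>c v = integral\<^sup>L M (\<lambda>t. (W t *\<^sub>v (h t *\<^sub>v v)) \<bullet>c (h t *\<^sub>v v))"
    unfolding J_def mint_quadratic(1)[OF integrable_J[OF h h] v] by (rule integral_cong_circ) (rule eq)
  show 2: "integrable M (\<lambda>t. (W t *\<^sub>v (h t *\<^sub>v v)) \<bullet>c (h t *\<^sub>v v))"
    using mint_quadratic(2)[OF integrable_J[OF h h] v] by (subst integrable_cong_circ[OF eq[symmetric]])
  have "Re ((J d h h *\<^sub>v v) \<bullet>c v) = integral\<^sup>L M (\<lambda>t. Re ((W t *\<^sub>v (h t *\<^sub>v v)) \<bullet>c (h t *\<^sub>v v)))"
    unfolding 1 using 2 by (rule integral_Re[symmetric])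
  also have "\<dots> \<ge> 0"
  proof (rule Bochner_Integration.integral_nonneg_AE[OF AE_I2])
    fix t assume "t \<in> space M"
    then have t: "t \<in> circ" by (simp add: space_M)
    show "0 \<le> Re ((W t *\<^sub>v (h t *\<^sub>v v)) \<bullet>c (h t *\<^sub>v v))"
      by (rule psd_matD(3)[OF W_psd[OF t] mult_mat_vec_carrier[OF mat_funD(1)[OF h t] v]])
  qed
  finally show "Re ((J d h h *\<^sub>v v) \<bullet>c v) \<ge> 0" .
qed

lemma J_psd: assumes "cfun d d h" shows "psd_mat d (J d h h)"
  using J_quadratic(3)[OF assms] J_adjoint[OF assms assms] by (auto simp: psd_mat_def)

text \<open>If one coefficient does not kill v, then the polynomial applied to v is a nonzero vector
  polynomial and non-triviality applies to it.\<close>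

lemma J_mpeval_nonzero:
  assumes cs: "set cs \<subseteq> carrier_mat d d" and c: "c \<in> set cs" and v: "v \<in> carrier_vec d" and nz: "c *\<^sub>v v \<noteq> 0\<^sub>v d"
  shows "(J d (mpeval d cs) (mpeval d cs) *\<^sub>v v) \<bullet>c v \<noteq> 0"
proof -
  let ?vs = "map (\<lambda>c. c *\<^sub>v v) cs"
  have "set ?vs \<subseteq> carrier_vec d" using cs v by (auto intro: mult_mat_vec_carrier)
  moreover have "\<exists>u \<in> set ?vs. u \<noteq> 0\<^sub>v d" using c nz by auto
  ultimately have "integral\<^sup>L M (\<lambda>t. (W t *\<^sub>v vpeval d ?vs t) \<bullet>c vpeval d ?vs t) \<noteq> 0"
    using nontrivial unfolding nontrivial_mm_def by blast
  then show ?thesis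
    unfolding J_quadratic(1)[OF cfun_mpeval[OF cs] v] vpeval_mpeval[OF cs v] .
qed

text \<open>An invertible coefficient kills no nonzero vector, so the positive semidefinite Gram
  matrix has no kernel.\<close>

lemma J_mpeval_pd:
  assumes cs: "set cs \<subseteq> carrier_mat d d" and c: "c \<in> set cs" "Determinant.det c \<noteq> 0"
  shows "pd_mat d (J d (mpeval d cs) (mpeval d cs))"
proof (rule psd_injective_imp_pd[OF J_psd[OF cfun_mpeval[OF cs]]])
  fix v :: "complex Matrix.vec"
  assume v: "v \<in> carrier_vec d" and zero: "J d (mpeval d cs) (mpeval d cs) *\<^sub>v v = 0\<^sub>v d"
  have "c *\<^sub>v v = 0\<^sub>v d"
    using J_mpeval_nonzero[OF cs c(1) v] zero v by (auto simp: scalar_prod_left_zero)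
  then show "v = 0\<^sub>v d"
    using det_0_iff_vec_prod_zero_field[of c d] c cs v by auto
qed

lemma J_mpeval_zero_imp:
  assumes cs: "set cs \<subseteq> carrier_mat d d" and zero: "J d (mpeval d cs) (mpeval d cs) = 0\<^sub>m d d" and c: "c \<in> set cs"
  shows "c = 0\<^sub>m d d"
proof (rule eq_matI)
  have cc: "c \<in> carrier_mat d d" using cs c by auto
  fix i j assume ij: "i < dim_row (0\<^sub>m d d :: complex mat)" "j < dim_col (0\<^sub>m d d :: complex mat)"
  have "c *\<^sub>v unit_vec d j = 0\<^sub>v d"
  proof (rule ccontr)
    assume "c *\<^sub>v unit_vec d j \<noteq> 0\<^sub>v d"
    from J_mpeval_nonzero[OF cs c unit_vec_carrier this] show False
      unfolding zero by (simp add: scalar_prod_def)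
  qed
  from arg_cong[OF this, of "\<lambda>u. vec_index u i"] show "c $$ (i, j) = 0\<^sub>m d d $$ (i, j)"
    using ij cc by simp
qed (use cs c in auto)

definition mpow :: "nat \<Rightarrow> complex \<Rightarrow> complex mat" where
  "mpow i t = t ^ i \<cdot>\<^sub>m 1\<^sub>m d"

lemma cfun_mpow: "cfun d d (mpow i)"
proof -
  have "cfun d d (\<lambda>t. t ^ i \<cdot>\<^sub>m 1\<^sub>m d)" by (intro cfun_intros continuous_intros) auto
  then show ?thesis by (simp add: mpow_def[abs_def])
qed

text \<open>Expanding in monomials leaves at most the term with index \<open>e\<close>. An
  \<open>e\<close> beyond the last coefficient makes this a vanishing statement, which is how
  orthogonality to a polynomial is derived below.\<close>

lemma J_mpow_mpeval:
  assumes cs: "set cs \<subseteq> carrier_mat d d" and h: "cfun d m h"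
    and zero: "\<And>i. i < length cs \<Longrightarrow> i \<noteq> e \<Longrightarrow> cs ! i = 0\<^sub>m d d \<or> J m (mpow (l + i)) h = 0\<^sub>m d m"
  shows "J m (\<lambda>t. t ^ l \<cdot>\<^sub>m mpeval d cs t) h =
    (if e < length cs then mat_adjoint (cs ! e) * J m (mpow (l + e)) h else 0\<^sub>m d m)"
  using cs zero
proof (induction cs arbitrary: l e)
  case Nil
  have "J m (\<lambda>t. t ^ l \<cdot>\<^sub>m mpeval d [] t) h = J m (\<lambda>t. 0\<^sub>m d d * 0\<^sub>m d d) h"
    by (intro J_cong) auto
  also have "\<dots> = 0\<^sub>m d m"
    using cfun_intros(1)[of "0\<^sub>m d d" d d] by (subst J_mult_left[OF _ h]) (auto simp: zero_mat_left)
  finally show ?case by simp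
next
  case (Cons c cs)
  have c: "c \<in> carrier_mat d d" and cs: "set cs \<subseteq> carrier_mat d d" using Cons.prems by auto
  have "J m (\<lambda>t. t ^ l \<cdot>\<^sub>m mpeval d (c # cs) t) h = J m (\<lambda>t. mpow l t * c + t ^ Suc l \<cdot>\<^sub>m mpeval d cs t) h"
    by (intro J_cong refl eq_matI) (use c cs in \<open>auto simp: mpow_def mat_smult_left mat_one_left algebra_simps\<close>)
  also have "\<dots> = J m (\<lambda>t. mpow l t * c) h + J m (\<lambda>t. t ^ Suc l \<cdot>\<^sub>m mpeval d cs t) h"
    by (intro J_add_left h cfun_mult[OF cfun_mpow] cfun_intros continuous_intros cfun_mpeval cs c)
  also have "J m (\<lambda>t. mpow l t * c) h = mat_adjoint c * J m (mpow l) h"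
    by (rule J_mult_left[OF cfun_mpow h c])
  finally have 1: "J m (\<lambda>t. t ^ l \<cdot>\<^sub>m mpeval d (c # cs) t) h =
    mat_adjoint c * J m (mpow l) h + J m (\<lambda>t. t ^ Suc l \<cdot>\<^sub>m mpeval d cs t) h" .
  show ?case
  proof (cases e)
    case 0
    \<comment> \<open>The surviving term was the head; in the tail the exceptional index is set to
      \<open>length cs\<close>, which is out of range.\<close>
    have "J m (\<lambda>t. t ^ Suc l \<cdot>\<^sub>m mpeval d cs t) h = (if length cs < length cs then mat_adjoint (cs ! length cs) * J m (mpow (Suc l + length cs)) h else 0\<^sub>m d m)"
    proof (rule Cons.IH[OF cs])
      fix i assume "i < length cs"
      then show "cs ! i = 0\<^sub>m d d \<or> J m (mpow (Suc l + i)) h = 0\<^sub>m d m"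
        using Cons.prems(2)[of "Suc i"] 0 by simp
    qed
    then have "J m (\<lambda>t. t ^ Suc l \<cdot>\<^sub>m mpeval d cs t) h = 0\<^sub>m d m" by simp
    then show ?thesis
      using 1 0 right_add_zero_mat[OF mult_carrier_mat[OF mat_adjoint_carrier[OF c] J_dim(3)]] by simp
  next
    case (Suc e')
    have "J m (\<lambda>t. t ^ Suc l \<cdot>\<^sub>m mpeval d cs t) h = (if e' < length cs then mat_adjoint (cs ! e') * J m (mpow (Suc l + e')) h else 0\<^sub>m d m)"
    proof (rule Cons.IH[OF cs])
      fix i assume "i < length cs" "i \<noteq> e'"
      then show "cs ! i = 0\<^sub>m d d \<or> J m (mpow (Suc l + i)) h = 0\<^sub>m d m"
        using Cons.prems(2)[of "Suc i"] Suc by simp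
    qed
    moreover have "mat_adjoint c * J m (mpow l) h = 0\<^sub>m d m"
      using Cons.prems(2)[of 0] Suc c by (auto simp: zero_mat_left zero_mat_right)
    moreover have "0\<^sub>m d m + X = X" if "X \<in> carrier_mat d m" for X :: "complex mat"
      using that by (rule left_add_zero_mat)
    moreover have "mat_adjoint (cs ! e') * J m (mpow (l + Suc e')) h \<in> carrier_mat d m" if "e' < length cs"
      using cs that by (intro mult_carrier_mat[of _ d d] mat_adjoint_carrier) auto
    ultimately show ?thesis using 1 Suc by auto
  qed
qed

end

section \<open>Szego recursion\<close>

lemma circ_cnj: "t \<in> circ \<Longrightarrow> cnj t * t = 1" "t \<in> circ \<Longrightarrow> t * cnj t = 1" "t \<in> circ \<Longrightarrow> t \<noteq> 0"
    "t \<in> circ \<Longrightarrow> inverse t = cnj t"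
proof -
  assume "t \<in> circ"
  then have n: "cmod t = 1" by (simp add: circ_def)
  show 1: "t * cnj t = 1" using complex_norm_square[of t] by (simp add: n)
  then show "cnj t * t = 1" by (simp add: mult.commute)
  show "t \<noteq> 0" using n by auto
  show "inverse t = cnj t" using 1 by (rule inverse_unique)
qed

lemma circ_pow: "t \<in> circ \<Longrightarrow> b \<le> a \<Longrightarrow> t ^ a * cnj t ^ b = t ^ (a - b)"
  "t \<in> circ \<Longrightarrow> a \<le> b \<Longrightarrow> t ^ a * cnj t ^ b = cnj t ^ (b - a)"
proof -
  assume t: "t \<in> circ"
  show "t ^ a * cnj t ^ b = t ^ (a - b)" if "b \<le> a"
  proof -
    have "t ^ a = t ^ (a - b) * t ^ b" using that by (simp flip: power_add)
    then have "t ^ a * cnj t ^ b = t ^ (a - b) * (t * cnj t) ^ b" by (simp add: power_mult_distrib mult.assoc)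
    then show ?thesis by (simp add: circ_cnj(2)[OF t])
  qed
  show "t ^ a * cnj t ^ b = cnj t ^ (b - a)" if "a \<le> b"
  proof -
    have "cnj t ^ b = cnj t ^ a * cnj t ^ (b - a)" using that by (simp flip: power_add)
    then have "t ^ a * cnj t ^ b = (t * cnj t) ^ a * cnj t ^ (b - a)" by (simp add: power_mult_distrib mult.assoc)
    then show ?thesis by (simp add: circ_cnj(2)[OF t])
  qed
qed

lemma smult_smult_mat_eq: "k \<cdot>\<^sub>m (l \<cdot>\<^sub>m A) = (k * l) \<cdot>\<^sub>m A" for A :: "complex mat"
  by (rule eq_matI) auto

lemma det_mat_adjoint: "A \<in> carrier_mat n n \<Longrightarrow> Determinant.det A \<noteq> 0 \<Longrightarrow> Determinant.det (mat_adjoint A) \<noteq> 0"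
  for A :: "complex mat"
proof -
  assume A: "A \<in> carrier_mat n n" and det: "Determinant.det A \<noteq> 0"
  have "mat_adjoint A * mat_adjoint (minv n A) = mat_adjoint (minv n A * A)"
    using A minv_inverse(1)[OF A det] by (intro mat_adjoint_mult[symmetric]) auto
  also have "\<dots> = 1\<^sub>m n" using minv_inverse(3)[OF A det] by simp
  finally show ?thesis
    using A minv_inverse(1)[OF A det]
    by (intro det_nonzero_if_right_inverse[of _ n "mat_adjoint (minv n A)"]) auto
qed

lemma left_cancel_zero:
  fixes A X :: "complex mat"
  assumes A: "A \<in> carrier_mat n n" "Determinant.det A \<noteq> 0" and X: "X \<in> carrier_mat n m" and eq: "A * X = 0\<^sub>m n m"
  shows "X = 0\<^sub>m n m"
proof -
  note I = minv_inverse[OF A]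
  have "X = (minv n A * A) * X" using X by (simp add: I(3))
  also have "\<dots> = minv n A * (A * X)" using A(1) X I(1) by (intro mat_assoc) auto
  also have "\<dots> = 0\<^sub>m n m" using I(1) by (simp add: eq)
  finally show ?thesis .
qed

context matrix_meas begin

text \<open>Multiplication by t is an isometry because |t| = 1 on the circle.\<close>

lemma J_shift:
  assumes "cfun d d g" "cfun d m h"
  shows "J m (\<lambda>t. t \<cdot>\<^sub>m g t) (\<lambda>t. t \<cdot>\<^sub>m h t) = J m g h"
proof -
  have "J m (\<lambda>t. t \<cdot>\<^sub>m g t) (\<lambda>t. t \<cdot>\<^sub>m h t) = J m g (\<lambda>t. cnj t \<cdot>\<^sub>m (t \<cdot>\<^sub>m h t))"
    by (intro J_scalar assms cfun_intros continuous_intros)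
  also have "\<dots> = J m g h"
    by (intro J_cong refl eq_matI) (simp_all add: mult.assoc[symmetric] circ_cnj)
  finally show ?thesis .
qed

text \<open>The orthonormal polynomials are built by the Szego recursion rather than by Gram-Schmidt. The first list holds the
  coefficients of \<open>\<phi>\<^sub>k\<^sup>R\<close>, the second those of the reversed polynomial
  \<open>z\<^sup>k (\<phi>\<^sub>k\<^sup>L(1/cnj z))\<^sup>\<dagger>\<close>; \<open>alpha\<close> turns out to be the Verblunsky coefficient.\<close>

primrec szego :: "nat \<Rightarrow> complex mat list \<times> complex mat list" where
  "szego 0 = ([1\<^sub>m d], [1\<^sub>m d])"
| "szego (Suc k) = (let r = fst (szego k); s = snd (szego k);
      a = mat_adjoint (J d (mpeval d s) (\<lambda>t. t \<cdot>\<^sub>m mpeval d r t)) in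
    (map (\<lambda>c. c * minv d (rhoR d a)) (map2 (-) (0\<^sub>m d d # r) (map (\<lambda>c. c * mat_adjoint a) (s @ [0\<^sub>m d d]))),
     map (\<lambda>c. c * minv d (rhoL d a)) (map2 (-) (s @ [0\<^sub>m d d]) (map (\<lambda>c. c * a) (0\<^sub>m d d # r)))))"

definition "Rlist k = fst (szego k)"
definition "Slist k = snd (szego k)"
definition "R k = mpeval d (Rlist k)"
definition "S k = mpeval d (Slist k)"
definition "alpha k = mat_adjoint (J d (S k) (\<lambda>t. t \<cdot>\<^sub>m R k t))"

lemma Rlist_Suc: "Rlist (Suc k) = map (\<lambda>c. c * minv d (rhoR d (alpha k)))
    (map2 (-) (0\<^sub>m d d # Rlist k) (map (\<lambda>c. c * mat_adjoint (alpha k)) (Slist k @ [0\<^sub>m d d])))"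
  and Slist_Suc: "Slist (Suc k) = map (\<lambda>c. c * minv d (rhoL d (alpha k)))
    (map2 (-) (Slist k @ [0\<^sub>m d d]) (map (\<lambda>c. c * alpha k) (0\<^sub>m d d # Rlist k)))"
  by (simp_all add: Rlist_def Slist_def R_def[abs_def] S_def alpha_def Let_def del: list.map)

text \<open>The orthogonality ranges are offset: \<open>R\<close> against the powers 0, ..., k-1 and
  \<open>S\<close> against 1, ..., k. The exempt power is the top one for \<open>R\<close> and the
  constant one for \<open>S\<close>, and there the coefficient is kept invertible.\<close>

definition "szego_inv k \<longleftrightarrow> length (Rlist k) = Suc k \<and> length (Slist k) = Suc k \<and>
   set (Rlist k) \<subseteq> carrier_mat d d \<and> set (Slist k) \<subseteq> carrier_mat d d \<and>
   Determinant.det (Rlist k ! k) \<noteq> 0 \<and> Determinant.det (Slist k ! 0) \<noteq> 0 \<and>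
   (\<forall>i<k. J d (mpow i) (R k) = 0\<^sub>m d d) \<and> (\<forall>i. 1 \<le> i \<longrightarrow> i \<le> k \<longrightarrow> J d (mpow i) (S k) = 0\<^sub>m d d) \<and>
   J d (R k) (R k) = 1\<^sub>m d \<and> J d (S k) (S k) = 1\<^sub>m d"

text \<open>Both tR and S are normalised and orthogonal to t, ..., t^k; their mutual pairing is the
  coefficient \<open>A\<close>. Subtracting from each its projection on the other gives Gram
  matrices 1 - aA and 1 - Aa, positive definite by non-triviality; this is at once the strict
  contractivity of \<open>alpha\<close> and the possibility to normalise by the inverse defect
  roots.\<close>

lemma szego_step:
  assumes inv: "szego_inv k"
  shows "strict_contraction d (alpha k)" "szego_inv (Suc k)"
    "R (Suc k) t = (t \<cdot>\<^sub>m R k t - S k t * mat_adjoint (alpha k)) * minv d (rhoR d (alpha k))"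
    "S (Suc k) t = (S k t - (t \<cdot>\<^sub>m R k t) * alpha k) * minv d (rhoL d (alpha k))"
    "Rlist (Suc k) ! Suc k = Rlist k ! k * minv d (rhoR d (alpha k))"
    "Slist (Suc k) ! 0 = Slist k ! 0 * minv d (rhoL d (alpha k))"
proof -
  note inv' = inv[unfolded szego_inv_def]
  have len: "length (Rlist k) = Suc k" "length (Slist k) = Suc k"
    and car: "set (Rlist k) \<subseteq> carrier_mat d d" "set (Slist k) \<subseteq> carrier_mat d d"
    and det: "Determinant.det (Rlist k ! k) \<noteq> 0" "Determinant.det (Slist k ! 0) \<noteq> 0"
    and oR: "\<And>i. i < k \<Longrightarrow> J d (mpow i) (R k) = 0\<^sub>m d d"
    and oS: "\<And>i. 1 \<le> i \<Longrightarrow> i \<le> k \<Longrightarrow> J d (mpow i) (S k) = 0\<^sub>m d d"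
    and nR: "J d (R k) (R k) = 1\<^sub>m d" and nS: "J d (S k) (S k) = 1\<^sub>m d"
    using inv' by auto
  define a where "a = alpha k"
  define A where "A = mat_adjoint a"
  have [simp]: "dim_row a = d" "dim_col a = d" "dim_row A = d" "dim_col A = d"
    by (auto simp: a_def A_def alpha_def)
  have ca: "a \<in> carrier_mat d d" "A \<in> carrier_mat d d" by (auto intro: carrier_matI)
  have cR: "cfun d d (R k)" and cS: "cfun d d (S k)"
    unfolding R_def S_def using car by (auto intro: cfun_mpeval)
  define T where "T t = t \<cdot>\<^sub>m R k t" for t
  have cT: "cfun d d T" unfolding T_def by (intro cfun_intros continuous_intros cR)
  have JST: "J d (S k) T = A" by (simp add: A_def a_def alpha_def T_def[abs_def])
  have JTS: "J d T (S k) = a" using J_adjoint[OF cS cT] by (simp add: JST A_def)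
  have JTT: "J d T T = 1\<^sub>m d" unfolding T_def[abs_def] by (simp add: J_shift[OF cR cR] nR)
  have oT: "J d (mpow i) T = 0\<^sub>m d d" if "1 \<le> i" "i \<le> k" for i
  proof -
    obtain i' where i: "i = Suc i'" using \<open>1 \<le> i\<close> by (cases i) auto
    have "J d (mpow i) T = J d (\<lambda>t. t \<cdot>\<^sub>m mpow i' t) (\<lambda>t. t \<cdot>\<^sub>m R k t)"
      by (intro J_cong eq_matI) (auto simp: mpow_def i T_def)
    also have "\<dots> = 0\<^sub>m d d" using that i by (simp add: J_shift[OF cfun_mpow cR] oR)
    finally show ?thesis .
  qed
  define q where "q t = T t - S k t * A" for t
  define q' where "q' t = S k t - T t * a" for t
  have cq: "cfun d d q" unfolding q_def
    by (intro cfun_intros cT cfun_mult[OF cS] ca)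
  have cq': "cfun d d q'" unfolding q'_def
    by (intro cfun_intros cS cfun_mult[OF cT] ca)
  have Jq: "J d g q = J d g T - J d g (S k) * A" if "cfun d d g" for g
    unfolding q_def[abs_def]
    by (simp add: J_diff_right[OF that cT cfun_mult[OF cS cfun_intros(1)[OF ca(2)]]] J_mult_right[OF that cS ca(2)])
  have Jq': "J d g q' = J d g (S k) - J d g T * a" if "cfun d d g" for g
    unfolding q'_def[abs_def]
    by (simp add: J_diff_right[OF that cS cfun_mult[OF cT cfun_intros(1)[OF ca(1)]]] J_mult_right[OF that cT ca(1)])
  have JSq: "J d (S k) q = 0\<^sub>m d d" using Jq[OF cS] by (simp add: JST nS mat_one_left) (auto intro!: eq_matI)
  have JTq': "J d T q' = 0\<^sub>m d d" using Jq'[OF cT] by (simp add: JTS JTT mat_one_left) (auto intro!: eq_matI)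
  have Jqq: "J d q q = 1\<^sub>m d - a * A"
  proof -
    have "J d q q = J d T q - mat_adjoint A * J d (S k) q"
      by (subst (1) q_def[abs_def])
         (simp add: J_diff_left[OF cT cfun_mult[OF cS cfun_intros(1)[OF ca(2)]] cq] J_mult_left[OF cS cq ca(2)])
    also have "\<dots> = J d T q" by (simp add: JSq zero_mat_right) (auto intro!: eq_matI)
    also have "\<dots> = 1\<^sub>m d - a * A" by (simp add: Jq[OF cT] JTT JTS)
    finally show ?thesis .
  qed
  have Jqq': "J d q' q' = 1\<^sub>m d - A * a"
  proof -
    have "J d q' q' = J d (S k) q' - mat_adjoint a * J d T q'"
      by (subst (1) q'_def[abs_def])
         (simp add: J_diff_left[OF cS cfun_mult[OF cT cfun_intros(1)[OF ca(1)]] cq'] J_mult_left[OF cT cq' ca(1)])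
    also have "\<dots> = J d (S k) q'" by (simp add: JTq' zero_mat_right) (auto intro!: eq_matI)
    also have "\<dots> = 1\<^sub>m d - A * a" by (simp add: Jq'[OF cS] nS JST)
    finally show ?thesis .
  qed
  define ql where "ql = map2 (-) (0\<^sub>m d d # Rlist k) (map (\<lambda>c. c * A) (Slist k @ [0\<^sub>m d d]))"
  define ql' where "ql' = map2 (-) (Slist k @ [0\<^sub>m d d]) (map (\<lambda>c. c * a) (0\<^sub>m d d # Rlist k))"
  have car2: "set (0\<^sub>m d d # Rlist k) \<subseteq> carrier_mat d d" "set (Slist k @ [0\<^sub>m d d]) \<subseteq> carrier_mat d d"
    "set (map (\<lambda>c. c * A) (Slist k @ [0\<^sub>m d d])) \<subseteq> carrier_mat d d" "set (map (\<lambda>c. c * a) (0\<^sub>m d d # Rlist k)) \<subseteq> carrier_mat d d"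
    using car ca by (auto intro!: mult_carrier_mat[of _ d d])
  have lenq: "length ql = Suc (Suc k)" "length ql' = Suc (Suc k)" by (auto simp: ql_def ql'_def len)
  have minus_set: "set (map2 (-) xs ys) \<subseteq> carrier_mat d d" if "set ys \<subseteq> carrier_mat d d" for xs ys :: "complex mat list"
    using that by (auto dest!: set_zip_rightD intro!: minus_carrier_mat)
  have cql: "set ql \<subseteq> carrier_mat d d" "set ql' \<subseteq> carrier_mat d d"
    unfolding ql_def ql'_def by (rule minus_set[OF car2(3)] minus_set[OF car2(4)])+
  have ev: "mpeval d ql t = q t" for t
    unfolding ql_def using car2 car ca
    by (subst mpeval_diff) (auto simp: len q_def T_def R_def S_def mpeval_mult_right mpeval_append_zero mpeval_cons_zero
        simp del: list.map map_append mpeval.simps)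
  have ev': "mpeval d ql' t = q' t" for t
    unfolding ql'_def using car2 car ca
    by (subst mpeval_diff) (auto simp: len q'_def T_def R_def S_def mpeval_mult_right mpeval_append_zero mpeval_cons_zero
        simp del: list.map map_append mpeval.simps)
  have rk: "Rlist k ! k \<in> carrier_mat d d" and s0: "Slist k ! 0 \<in> carrier_mat d d" using car len by auto
  have top: "ql ! Suc k = Rlist k ! k" unfolding ql_def using rk ca len
    by (simp add: nth_append zero_mat_left) (auto intro!: eq_matI)
  have bot: "ql' ! 0 = Slist k ! 0" unfolding ql'_def using s0 ca len
    by (simp add: nth_append zero_mat_left) (auto intro!: eq_matI)
  \<comment> \<open>Each residue inherits an invertible end coefficient, so its Gram matrix is
    definite.\<close>
  have pdR: "pd_mat d (1\<^sub>m d - a * A)"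
    using J_mpeval_pd[OF cql(1), of "ql ! Suc k"] lenq det unfolding ev[abs_def] Jqq top[symmetric] by simp
  have pdL: "pd_mat d (1\<^sub>m d - A * a)"
    using J_mpeval_pd[OF cql(2), of "ql' ! 0"] lenq det unfolding ev'[abs_def] Jqq' bot[symmetric] by simp
  show str: "strict_contraction d (alpha k)"
    using pdR pdL ca by (simp add: strict_contraction_def a_def A_def)
  note rho = rho_props[OF str, folded a_def]
  have cI: "minv d (rhoR d a) \<in> carrier_mat d d" "minv d (rhoL d a) \<in> carrier_mat d d"
    using pd_props[OF rho(1)] pd_props[OF rho(2)] by (auto intro: carrier_matI)
  have Rlist': "Rlist (Suc k) = map (\<lambda>c. c * minv d (rhoR d a)) ql" and Slist': "Slist (Suc k) = map (\<lambda>c. c * minv d (rhoL d a)) ql'"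
    by (simp_all add: Rlist_Suc Slist_Suc ql_def ql'_def a_def A_def del: list.map)
  have R': "R (Suc k) t = q t * minv d (rhoR d a)" for t
    unfolding R_def Rlist' by (simp add: mpeval_mult_right[OF cql(1) cI(1)] ev)
  have S': "S (Suc k) t = q' t * minv d (rhoL d a)" for t
    unfolding S_def Slist' by (simp add: mpeval_mult_right[OF cql(2) cI(2)] ev')
  show "R (Suc k) t = (t \<cdot>\<^sub>m R k t - S k t * mat_adjoint (alpha k)) * minv d (rhoR d (alpha k))"
    by (simp add: R' q_def T_def a_def A_def)
  show "S (Suc k) t = (S k t - (t \<cdot>\<^sub>m R k t) * alpha k) * minv d (rhoL d (alpha k))"
    by (simp add: S' q'_def T_def a_def A_def)
  show topR: "Rlist (Suc k) ! Suc k = Rlist k ! k * minv d (rhoR d (alpha k))"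
    using lenq by (simp add: Rlist' top a_def)
  show botS: "Slist (Suc k) ! 0 = Slist k ! 0 * minv d (rhoL d (alpha k))"
    using lenq by (simp add: Slist' bot a_def)
  have detI: "Determinant.det (minv d P) \<noteq> 0" if "pd_mat d P" for P using pd_det[OF pd_minv[OF that]] .
  have JR': "J d g (R (Suc k)) = J d g q * minv d (rhoR d a)" if "cfun d d g" for g
    unfolding R'[abs_def] by (rule J_mult_right[OF that cq cI(1)])
  have JS': "J d g (S (Suc k)) = J d g q' * minv d (rhoL d a)" if "cfun d d g" for g
    unfolding S'[abs_def] by (rule J_mult_right[OF that cq' cI(2)])
  \<comment> \<open>For positive powers both parts of \<open>q\<close> are orthogonal already. Power
    0 is obtained from J S q = 0: all other terms of S drop out, and its constant coefficient is
    invertible.\<close>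
  have q0: "J d (mpow i) q = 0\<^sub>m d d" if "i < Suc k" for i
  proof (cases i)
    case 0
    have "J d (S k) q = J d (\<lambda>t. t ^ 0 \<cdot>\<^sub>m mpeval d (Slist k) t) q"
      by (intro J_cong refl eq_matI) (auto simp: S_def)
    also have "\<dots> = (if 0 < length (Slist k) then mat_adjoint (Slist k ! 0) * J d (mpow (0 + 0)) q else 0\<^sub>m d d)"
      using oT oS len by (intro J_mpow_mpeval[OF car(2) cq]) (auto simp: Jq[OF cfun_mpow] zero_mat_left)
    finally have "mat_adjoint (Slist k ! 0) * J d (mpow 0) q = 0\<^sub>m d d" using len by (simp add: JSq)
    from left_cancel_zero[OF mat_adjoint_carrier[OF s0] det_mat_adjoint[OF s0 det(2)] J_dim(3) this]
    show ?thesis by (simp add: 0)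
  qed (use that oT oS in \<open>auto simp: Jq[OF cfun_mpow] zero_mat_left\<close>)
  \<comment> \<open>The mirror image: the new power k+1 follows from J T q' = 0, where only the top
    coefficient of tR survives.\<close>
  have q'0: "J d (mpow i) q' = 0\<^sub>m d d" if "1 \<le> i" "i \<le> Suc k" for i
  proof (cases "i = Suc k")
    case True
    have "J d T q' = J d (\<lambda>t. t ^ 1 \<cdot>\<^sub>m mpeval d (Rlist k) t) q'"
      by (intro J_cong refl eq_matI) (auto simp: R_def T_def)
    also have "\<dots> = (if k < length (Rlist k) then mat_adjoint (Rlist k ! k) * J d (mpow (1 + k)) q' else 0\<^sub>m d d)"
      using oT oS len by (intro J_mpow_mpeval[OF car(1) cq']) (auto simp: Jq'[OF cfun_mpow] zero_mat_left)
    finally have "mat_adjoint (Rlist k ! k) * J d (mpow (Suc k)) q' = 0\<^sub>m d d" using len by (simp add: JTq')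
    from left_cancel_zero[OF mat_adjoint_carrier[OF rk] det_mat_adjoint[OF rk det(1)] J_dim(3) this]
    show ?thesis by (simp add: True)
  qed (use that oT oS in \<open>auto simp: Jq'[OF cfun_mpow] zero_mat_left\<close>)
  show "szego_inv (Suc k)"
    unfolding szego_inv_def
  proof (intro conjI allI impI)
    show "set (Rlist (Suc k)) \<subseteq> carrier_mat d d" "set (Slist (Suc k)) \<subseteq> carrier_mat d d"
      unfolding Rlist' Slist' using cql cI by (auto intro!: mult_carrier_mat[of _ d d])
    show "Determinant.det (Rlist (Suc k) ! Suc k) \<noteq> 0"
      unfolding topR using rk cI det(1) detI[OF rho(2)] by (subst det_mult[of _ d]) (auto simp: a_def)
    show "Determinant.det (Slist (Suc k) ! 0) \<noteq> 0"
      unfolding botS using s0 cI det(2) detI[OF rho(1)] by (subst det_mult[of _ d]) (auto simp: a_def)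
    show "J d (mpow i) (R (Suc k)) = 0\<^sub>m d d" if "i < Suc k" for i
      using cI by (simp add: JR'[OF cfun_mpow] q0[OF that] zero_mat_left)
    show "J d (mpow i) (S (Suc k)) = 0\<^sub>m d d" if "1 \<le> i" "i \<le> Suc k" for i
      using cI by (simp add: JS'[OF cfun_mpow] q'0[OF that] zero_mat_left)
    have cR': "cfun d d (R (Suc k))" unfolding R'[abs_def] by (intro cfun_mult[OF cq] cfun_intros cI)
    have cS': "cfun d d (S (Suc k))" unfolding S'[abs_def] by (intro cfun_mult[OF cq'] cfun_intros cI)
    note [simp] = pd_props[OF rho(1)] pd_props[OF rho(2)] pd_props[OF pd_minv[OF rho(1)]] pd_props[OF pd_minv[OF rho(2)]]
    have "J d (R (Suc k)) (R (Suc k)) = mat_adjoint (minv d (rhoR d a)) * J d q q * minv d (rhoR d a)"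
      unfolding JR'[OF cR'] by (subst R'[abs_def]) (simp add: J_mult_left[OF cq cq cI(1)])
    also have "\<dots> = minv d (rhoR d a) * (rhoR d a * (rhoR d a * minv d (rhoR d a)))"
      unfolding Jqq A_def rho(4)[symmetric] by (simp add: mat_assoc)
    also have "\<dots> = 1\<^sub>m d" by (simp add: mat_one_right)
    finally show "J d (R (Suc k)) (R (Suc k)) = 1\<^sub>m d" .
    have "J d (S (Suc k)) (S (Suc k)) = mat_adjoint (minv d (rhoL d a)) * J d q' q' * minv d (rhoL d a)"
      unfolding JS'[OF cS'] by (subst S'[abs_def]) (simp add: J_mult_left[OF cq' cq' cI(2)])
    also have "\<dots> = minv d (rhoL d a) * (rhoL d a * (rhoL d a * minv d (rhoL d a)))"
      unfolding Jqq' A_def rho(3)[symmetric] by (simp add: mat_assoc)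
    also have "\<dots> = 1\<^sub>m d" by (simp add: mat_one_right)
    finally show "J d (S (Suc k)) (S (Suc k)) = 1\<^sub>m d" .
  qed (use lenq in \<open>auto simp: Rlist' Slist'\<close>)
qed

lemma J_one: "J d (\<lambda>t. 1\<^sub>m d) (\<lambda>t. 1\<^sub>m d) = 1\<^sub>m d"
proof -
  have "J d (\<lambda>t. 1\<^sub>m d) (\<lambda>t. 1\<^sub>m d) = mint d d W"
    unfolding J_def by (intro mint_cong) (simp add: mat_one_left mat_one_right W_dims)
  then show ?thesis using mm by (simp add: matrix_measure_def mint_def mat_int_def)
qed

lemma szego_inv: "szego_inv k"
proof (induction k)
  case 0
  have "R 0 = (\<lambda>t. 1\<^sub>m d)" "S 0 = (\<lambda>t. 1\<^sub>m d)"
    by (auto simp: R_def S_def Rlist_def Slist_def fun_eq_iff intro!: eq_matI)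
  then show ?case by (auto simp: szego_inv_def Rlist_def Slist_def J_one)
qed (rule szego_step(2))

text \<open>The exceptional index \<open>e\<close> is the top one for the right polynomials and \<open>0\<close> for the reversed left ones.\<close>

lemma orth_unique:
  assumes len: "length cs = Suc N" "length cs' = Suc N" and e: "e \<le> N"
    and car: "set cs \<subseteq> carrier_mat d d" "set cs' \<subseteq> carrier_mat d d" and K: "K \<in> carrier_mat d d"
    and orth: "\<And>i. i \<le> N \<Longrightarrow> i \<noteq> e \<Longrightarrow> J d (mpow i) (mpeval d cs) = 0\<^sub>m d d"
      "\<And>i. i \<le> N \<Longrightarrow> i \<noteq> e \<Longrightarrow> J d (mpow i) (mpeval d cs') = 0\<^sub>m d d"
    and norm: "J d (mpeval d cs) (mpeval d cs) = 1\<^sub>m d" "J d (mpeval d cs') (mpeval d cs') = 1\<^sub>m d"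
    and pd: "pd_mat d (K * cs ! e)" "pd_mat d (K * cs' ! e)"
  shows "cs = cs'"
proof -
  let ?c = "cs ! e" and ?c' = "cs' ! e" and ?p = "mpeval d cs" and ?p' = "mpeval d cs'"
  have c: "?c \<in> carrier_mat d d" "?c' \<in> carrier_mat d d" using len e car by auto
  have "Determinant.det ?c \<noteq> 0" using pd_det[OF pd(1)] det_mult[OF K c(1)] by auto
  note I = minv_inverse[OF c(1) this]
  \<comment> \<open>The right factor that matches the two coefficients at index \<open>e\<close>;
    the goal is to show that it is 1.\<close>
  define C where "C = minv d ?c * ?c'"
  have C: "C \<in> carrier_mat d d" using I c by (auto simp: C_def)
  have [simp]: "dim_row C = d" "dim_col C = d" "dim_row K = d" "dim_col K = d" "dim_row ?c = d" "dim_col ?c = d"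
      "dim_row ?c' = d" "dim_col ?c' = d" using C K c by auto
  have cC: "?c * C = ?c'" unfolding C_def using I(1,2) by (simp add: mat_assoc[symmetric] mat_one_left)
  have carC: "set (map (\<lambda>c. c * C) cs) \<subseteq> carrier_mat d d" using car C by (auto intro!: mult_carrier_mat[of _ d d])
  define ds where "ds = map2 (-) cs' (map (\<lambda>c. c * C) cs)"
  have cds: "set ds \<subseteq> carrier_mat d d" unfolding ds_def
    using carC by (auto dest!: set_zip_rightD intro!: minus_carrier_mat)
  have lds: "length ds = Suc N" using len by (simp add: ds_def)
  have dsi: "ds ! i = cs' ! i - cs ! i * C" if "i \<le> N" for i using that len by (simp add: ds_def)
  have ev: "mpeval d ds t = ?p' t - ?p t * C" for t
    unfolding ds_def using len car carC C by (subst mpeval_diff) (auto simp: mpeval_mult_right)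
  note cp = cfun_mpeval[OF car(1)] cfun_mpeval[OF car(2)] cfun_mpeval[OF cds]
  have Jds: "J d g (mpeval d ds) = J d g ?p' - J d g ?p * C" if "cfun d d g" for g
    unfolding ev[abs_def]
    by (simp add: J_diff_right[OF that cp(2) cfun_mult[OF cp(1) cfun_intros(1)[OF C]]] J_mult_right[OF that cp(1) C])
  \<comment> \<open>The coefficient at \<open>e\<close> has cancelled in the difference, which is
    orthogonal to all other powers; so it is orthogonal to itself and vanishes by
    non-triviality.\<close>
  have "J d (mpeval d ds) (mpeval d ds) = J d (\<lambda>t. t ^ 0 \<cdot>\<^sub>m mpeval d ds t) (mpeval d ds)"
    by (intro J_cong refl eq_matI) auto
  also have "\<dots> = (if Suc N < length ds then mat_adjoint (ds ! Suc N) * J d (mpow (0 + Suc N)) (mpeval d ds) else 0\<^sub>m d d)"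
  proof (rule J_mpow_mpeval[OF cds cp(3)])
    fix i assume i: "i < length ds" "i \<noteq> Suc N"
    show "ds ! i = 0\<^sub>m d d \<or> J d (mpow (0 + i)) (mpeval d ds) = 0\<^sub>m d d"
    proof (cases "i = e")
      case True
      have "ds ! i = 0\<^sub>m d d" using e by (simp add: True dsi cC) (auto intro!: eq_matI)
      then show ?thesis ..
    next
      case False
      then show ?thesis using i lds by (simp add: Jds[OF cfun_mpow] orth zero_mat_left)
    qed
  qed
  finally have Jz: "J d (mpeval d ds) (mpeval d ds) = 0\<^sub>m d d" by (simp add: lds)
  have csi: "cs' ! i = cs ! i * C" if "i \<le> N" for i
  proof -
    have "ds ! i = 0\<^sub>m d d" using J_mpeval_zero_imp[OF cds Jz] lds that by simp
    then have z: "cs' ! i - cs ! i * C = 0\<^sub>m d d" using dsi[OF that] by simp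
    have "cs ! i \<in> carrier_mat d d" "cs' ! i \<in> carrier_mat d d"
      using len that by (auto intro: subsetD[OF car(1)] subsetD[OF car(2)])
    then have [simp]: "dim_row (cs ! i) = d" "dim_col (cs ! i) = d" "dim_row (cs' ! i) = d" "dim_col (cs' ! i) = d"
      by auto
    have "(cs' ! i - cs ! i * C) $$ (x, y) = 0" if "x < d" "y < d" for x y using that by (simp add: z)
    then show ?thesis by (intro eq_matI) (simp_all del: index_mult_mat(1))
  qed
  have p'C: "?p' t = ?p t * C" for t
  proof -
    have "cs' = map (\<lambda>c. c * C) cs" using len csi by (intro nth_equalityI) auto
    then show ?thesis using mpeval_mult_right[OF car(1) C] by simp
  qed
  have "J d ?p' ?p' = mat_adjoint C * (J d ?p ?p * C)"
    unfolding p'C[abs_def] by (simp add: J_mult_left[OF cp(1) cfun_mult[OF cp(1) cfun_intros(1)[OF C]] C] J_mult_right[OF cp(1) cp(1) C])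
  then have CC: "mat_adjoint C * C = 1\<^sub>m d" by (simp add: norm mat_one_left)
  then have CC': "C * mat_adjoint C = 1\<^sub>m d"
    by (rule mat_right_inverse_imp_left[OF mat_adjoint_carrier[OF C] C])
  define P where "P = K * ?c"
  have KC: "K * ?c' = P * C" by (simp add: P_def cC[symmetric] mat_assoc)
  note pd' = pd[unfolded KC, folded P_def]
  note [simp] = pd_props(1,2)[OF pd'(1)]
  \<comment> \<open>\<open>C\<close> is unitary and PC is Hermitian, so the square of PC equals PC
    times its adjoint, that is PP. Uniqueness of the positive root gives PC = P, hence C = 1: this
    is where the sign condition on leading coefficients enters.\<close>
  have "P * C * (P * C) = P * C * mat_adjoint (P * C)" by (simp add: pd_props(3)[OF pd'(2)])
  also have "\<dots> = P * (C * mat_adjoint C) * P" by (simp add: mat_adj mat_assoc pd_props(3)[OF pd'(1)])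
  also have "\<dots> = P * P" by (simp add: CC' mat_one_right)
  finally have PP: "P * C * (P * C) = P * P" .
  have psdPP: "psd_mat d (P * P)" using psd_adjoint_mult[OF pd_matD(1)[OF pd'(1)]] by (simp add: pd_props(3)[OF pd'(1)])
  have "(minv d P * minv d P) * (P * P) = 1\<^sub>m d"
    by (simp add: pd_props[OF pd'(1)] mat_assoc pd_cancel[OF pd'(1)])
  then have "pd_mat d (P * P)"
    using pd_matD(1)[OF pd_minv[OF pd'(1)]] by (intro pd_inverse_imp_pd[OF psdPP, of "minv d P * minv d P"]) auto
  from pd_sqrt_unique[OF pd_imp_psd[OF pd'(2)] pd_imp_psd[OF pd'(1)] PP this] have "P * C = P" .
  then have "minv d P * (P * C) = minv d P * P" by simp
  then have "C = 1\<^sub>m d" by (simp add: pd_cancel[OF pd'(1)] pd_props[OF pd'(1)])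
  show "cs = cs'"
  proof (rule nth_equalityI)
    fix i assume "i < length cs"
    then have i: "i \<le> N" "cs ! i \<in> carrier_mat d d" using len by (auto intro: subsetD[OF car(1)])
    then show "cs ! i = cs' ! i" unfolding csi[OF i(1)] \<open>C = 1\<^sub>m d\<close> by simp
  qed (simp add: len)
qed

section \<open>Identification with the Gram-Schmidt polynomials\<close>

lemma szego_facts:
  shows "length (Rlist k) = Suc k" "length (Slist k) = Suc k" "set (Rlist k) \<subseteq> carrier_mat d d" "set (Slist k) \<subseteq> carrier_mat d d"
    "Rlist k ! k \<in> carrier_mat d d" "Slist k ! 0 \<in> carrier_mat d d"
    "Determinant.det (Rlist k ! k) \<noteq> 0" "Determinant.det (Slist k ! 0) \<noteq> 0"
    "i < k \<Longrightarrow> J d (mpow i) (R k) = 0\<^sub>m d d" "1 \<le> i \<Longrightarrow> i \<le> k \<Longrightarrow> J d (mpow i) (S k) = 0\<^sub>m d d"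
    "J d (R k) (R k) = 1\<^sub>m d" "J d (S k) (S k) = 1\<^sub>m d" "cfun d d (R k)" "cfun d d (S k)"
  using szego_inv[of k] unfolding szego_inv_def R_def S_def by (auto intro: cfun_mpeval)

lemma rip_J: "rip M W d (\<lambda>t. (t ^ m) \<cdot>\<^sub>m 1\<^sub>m d) h = J d (mpow m) h" "rip M W d g h = J d g h"
  by (simp_all add: rip_def J_def mint_def mat_int_def mpow_def[abs_def])

text \<open>The ratio of consecutive leading coefficients in the Szego recursion is the inverse of
  rhoR, which is positive definite; so the constructed list meets the normalisation in the
  description, and \<open>orth_unique\<close> excludes any other.\<close>

lemma orthR_eq: "orthR M W d k = Rlist k"
proof (induction k)
  case 0
  show ?case by (simp add: Rlist_def)
next
  case (Suc n)
  note f = szego_facts[where k = "Suc n"] and g = szego_facts[where k = n]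
  define K where "K = minv d (Rlist n ! n)"
  have K: "K \<in> carrier_mat d d" using minv_inverse(1)[OF g(5,7)] by (simp add: K_def)
  have lastn: "last (orthR M W d n) = Rlist n ! n" unfolding Suc using g(1) by (cases "Rlist n" rule: rev_cases) (auto simp: nth_append)
  have pdK: "pd_mat d (K * Rlist (Suc n) ! Suc n)"
  proof -
    note rho = rho_props(2)[OF szego_step(1)[OF szego_inv[of n]]]
    have "K * Rlist (Suc n) ! Suc n = K * Rlist n ! n * minv d (rhoR d (alpha n))"
      unfolding szego_step(5)[OF szego_inv] using K g(5) pd_props[OF rho] by (intro mat_assoc[symmetric]) auto
    also have "\<dots> = minv d (rhoR d (alpha n))"
      using minv_inverse(3)[OF g(5,7)] pd_props[OF rho] by (simp add: K_def mat_one_left)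
    finally show ?thesis using pd_minv[OF rho] by simp
  qed
  show ?case
    unfolding orthR.simps
  proof (rule the_equality)
    show "length (Rlist (Suc n)) = n + 2 \<and> set (Rlist (Suc n)) \<subseteq> carrier_mat d d \<and>
      (\<forall>m\<le>n. rip M W d (\<lambda>t. (t ^ m) \<cdot>\<^sub>m 1\<^sub>m d) (mpeval d (Rlist (Suc n))) = 0\<^sub>m d d) \<and>
      rip M W d (mpeval d (Rlist (Suc n))) (mpeval d (Rlist (Suc n))) = 1\<^sub>m d \<and>
      pd_mat d (minv d (last (orthR M W d n)) * last (Rlist (Suc n)))"
    proof (intro conjI allI impI)
      have l: "last (Rlist (Suc n)) = Rlist (Suc n) ! Suc n"
        using f(1) by (cases "Rlist (Suc n)" rule: rev_cases) (auto simp: nth_append)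
      show "pd_mat d (minv d (last (orthR M W d n)) * last (Rlist (Suc n)))"
        unfolding lastn l using pdK by (simp add: K_def)
      show "rip M W d (\<lambda>t. (t ^ m) \<cdot>\<^sub>m 1\<^sub>m d) (mpeval d (Rlist (Suc n))) = 0\<^sub>m d d" if "m \<le> n" for m
        unfolding rip_J(1) using f(9)[of m] that by (simp add: R_def)
      show "rip M W d (mpeval d (Rlist (Suc n))) (mpeval d (Rlist (Suc n))) = 1\<^sub>m d"
        unfolding rip_J(2) using f(11) by (simp add: R_def)
    qed (use f in auto)
  next
    fix cs assume cs: "length cs = n + 2 \<and> set cs \<subseteq> carrier_mat d d \<and>
      (\<forall>m\<le>n. rip M W d (\<lambda>t. (t ^ m) \<cdot>\<^sub>m 1\<^sub>m d) (mpeval d cs) = 0\<^sub>m d d) \<and>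
      rip M W d (mpeval d cs) (mpeval d cs) = 1\<^sub>m d \<and>
      pd_mat d (minv d (last (orthR M W d n)) * last cs)"
    then have l: "last cs = cs ! Suc n" by (cases cs rule: rev_cases) (auto simp: nth_append)
    show "cs = Rlist (Suc n)"
    proof (rule orth_unique[where N = "Suc n" and e = "Suc n", OF _ _ _ _ _ K])
      show "J d (mpow i) (mpeval d cs) = 0\<^sub>m d d" if "i \<le> Suc n" "i \<noteq> Suc n" for i
        using cs that unfolding rip_J(1) by auto
      show "J d (mpow i) (mpeval d (Rlist (Suc n))) = 0\<^sub>m d d" if "i \<le> Suc n" "i \<noteq> Suc n" for i
        using f(9)[of i] that by (simp add: R_def)
      show "J d (mpeval d cs) (mpeval d cs) = 1\<^sub>m d" using cs by (simp add: rip_J(2))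
      show "J d (mpeval d (Rlist (Suc n))) (mpeval d (Rlist (Suc n))) = 1\<^sub>m d" using f(11) by (simp add: R_def)
      show "pd_mat d (K * cs ! Suc n)" using cs by (simp add: lastn l K_def)
    qed (use cs f pdK in auto)
  qed
qed

lemma mpeval_adjoint_circ:
  assumes cs: "set cs \<subseteq> carrier_mat d d" "length cs = Suc N" and t: "t \<in> circ"
  shows "mat_adjoint (mpeval d cs t) = cnj t ^ N \<cdot>\<^sub>m mpeval d (rev (map mat_adjoint cs)) t"
proof -
  have adj: "mat_adjoint (mpeval d cs t) = mpeval d (map mat_adjoint cs) (cnj t)"
    using cs(1)
  proof (induction cs)
    case (Cons c cs)
    then have [simp]: "dim_row c = d" "dim_col c = d" "set cs \<subseteq> carrier_mat d d" by auto
    show ?case using Cons by (simp add: mat_adj)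
  qed simp
  have "set (rev (map mat_adjoint cs)) \<subseteq> carrier_mat d d" using cs by (auto intro: mat_adjoint_carrier)
  from mpeval_rev[OF this _ circ_cnj(3)[OF t], of N] cs
  show ?thesis by (simp add: adj circ_cnj(4)[OF t])
qed

text \<open>On the circle the adjoint of a polynomial is a negative power times its reversal, so
  left pairings become right pairings of reversed polynomials, with the power m replaced by N -
  m.\<close>

lemma lip_J:
  assumes cs: "set cs \<subseteq> carrier_mat d d" "length cs = Suc N"
  shows "m \<le> N \<Longrightarrow> lip M W d (\<lambda>t. (t ^ m) \<cdot>\<^sub>m 1\<^sub>m d) (mpeval d cs) =
      mat_adjoint (J d (mpow (N - m)) (mpeval d (rev (map mat_adjoint cs))))"
    "lip M W d (mpeval d cs) (mpeval d cs) =
      J d (mpeval d (rev (map mat_adjoint cs))) (mpeval d (rev (map mat_adjoint cs)))"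
proof -
  let ?s = "rev (map mat_adjoint cs)"
  have car: "set ?s \<subseteq> carrier_mat d d" using cs by (auto intro: mat_adjoint_carrier)
  note cp = cfun_mpeval[OF car]
  have lip: "lip M W d g (mpeval d cs) = J d (\<lambda>t. cnj t ^ N \<cdot>\<^sub>m mpeval d ?s t) (\<lambda>t. mat_adjoint (g t))" for g
  proof -
    have "lip M W d g (mpeval d cs) = mint d d (\<lambda>t. mpeval d cs t * W t * mat_adjoint (g t))"
      by (simp add: lip_def mint_def mat_int_def)
    also have "\<dots> = J d (\<lambda>t. mat_adjoint (mpeval d cs t)) (\<lambda>t. mat_adjoint (g t))" by (simp add: J_def)
    also have "\<dots> = J d (\<lambda>t. cnj t ^ N \<cdot>\<^sub>m mpeval d ?s t) (\<lambda>t. mat_adjoint (g t))"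
      by (intro J_cong mpeval_adjoint_circ cs refl)
    finally show ?thesis .
  qed
  show "lip M W d (\<lambda>t. (t ^ m) \<cdot>\<^sub>m 1\<^sub>m d) (mpeval d cs) =
      mat_adjoint (J d (mpow (N - m)) (mpeval d ?s))" if m: "m \<le> N"
  proof -
    have "lip M W d (\<lambda>t. (t ^ m) \<cdot>\<^sub>m 1\<^sub>m d) (mpeval d cs)
      = J d (\<lambda>t. cnj t ^ N \<cdot>\<^sub>m mpeval d ?s t) (\<lambda>t. cnj t ^ m \<cdot>\<^sub>m 1\<^sub>m d)"
      unfolding lip by (intro J_cong refl) (simp add: mat_adj)
    also have "\<dots> = J d (mpeval d ?s) (\<lambda>t. cnj (cnj t ^ N) \<cdot>\<^sub>m (cnj t ^ m \<cdot>\<^sub>m 1\<^sub>m d))"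
      by (intro J_scalar cp cfun_intros continuous_intros) auto
    also have "\<dots> = J d (mpeval d ?s) (mpow (N - m))"
      by (intro J_cong refl) (auto simp: mpow_def circ_pow(1)[OF _ m] smult_smult_mat_eq)
    also have "\<dots> = mat_adjoint (J d (mpow (N - m)) (mpeval d ?s))" by (rule J_adjoint[OF cfun_mpow cp, symmetric])
    finally show ?thesis .
  qed
  have "lip M W d (mpeval d cs) (mpeval d cs) = J d (\<lambda>t. cnj t ^ N \<cdot>\<^sub>m mpeval d ?s t) (\<lambda>t. cnj t ^ N \<cdot>\<^sub>m mpeval d ?s t)"
    unfolding lip by (intro J_cong mpeval_adjoint_circ cs refl)
  also have "\<dots> = J d (mpeval d ?s) (\<lambda>t. cnj (cnj t ^ N) \<cdot>\<^sub>m (cnj t ^ N \<cdot>\<^sub>m mpeval d ?s t))"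
    by (intro J_scalar cp cfun_intros continuous_intros)
  also have "\<dots> = J d (mpeval d ?s) (mpeval d ?s)"
    using circ_pow(1)[of _ N N] by (intro J_cong refl) (auto simp: smult_smult_mat_eq intro!: eq_matI)
  finally show "lip M W d (mpeval d cs) (mpeval d cs) = J d (mpeval d ?s) (mpeval d ?s)" .
qed

text \<open>Reversal carries the left orthogonality conditions to those of \<open>S\<close>, the
  leading coefficient turning into the adjoint of the constant one; uniqueness is then the case e =
  0 of \<open>orth_unique\<close>.\<close>

lemma orthL_eq: "orthL M W d k = rev (map mat_adjoint (Slist k))"
proof (induction k)
  case 0
  show ?case by (simp add: Slist_def)
next
  case (Suc n)
  note f = szego_facts[where k = "Suc n"] and g = szego_facts[where k = n]
  define K where "K = minv d (Slist n ! 0)"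
  have K: "K \<in> carrier_mat d d" using minv_inverse(1)[OF g(6,8)] by (simp add: K_def)
  have lastn: "last (orthL M W d n) = mat_adjoint (Slist n ! 0)"
    unfolding Suc using g by (cases "Slist n") auto
  have mK: "minv d (mat_adjoint (Slist n ! 0)) = mat_adjoint K"
  proof (rule minv_eq)
    show "mat_adjoint (Slist n ! 0) * mat_adjoint K = 1\<^sub>m d"
      using g(6) K minv_inverse(3)[OF g(6,8)] by (subst mat_adjoint_mult[symmetric]) (auto simp: K_def)
  qed (use g(6) K in auto)
  \<comment> \<open>Left leading ratios are adjoints of the products handled by
    \<open>orth_unique\<close>, and a positive definite matrix equals its adjoint.\<close>
  have pd_swap: "pd_mat d (mat_adjoint c * mat_adjoint K) \<longleftrightarrow> pd_mat d (K * c)" if "c \<in> carrier_mat d d" for c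
  proof -
    have "mat_adjoint c * mat_adjoint K = mat_adjoint (K * c)" using that K by (subst mat_adjoint_mult) auto
    then show ?thesis using pd_matD(2) by (metis mat_adjoint_mat_adjoint)
  qed
  have pdK: "pd_mat d (K * Slist (Suc n) ! 0)"
  proof -
    note rho = rho_props(1)[OF szego_step(1)[OF szego_inv[of n]]]
    have "K * Slist (Suc n) ! 0 = K * Slist n ! 0 * minv d (rhoL d (alpha n))"
      unfolding szego_step(6)[OF szego_inv] using K g(6) pd_props[OF rho] by (intro mat_assoc[symmetric]) auto
    also have "\<dots> = minv d (rhoL d (alpha n))"
      using minv_inverse(3)[OF g(6,8)] pd_props[OF rho] by (simp add: K_def mat_one_left)
    finally show ?thesis using pd_minv[OF rho] by simp
  qed
  define Q where "Q cs \<longleftrightarrow> length cs = n + 2 \<and> set cs \<subseteq> carrier_mat d d \<and>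
      (\<forall>m\<le>n. lip M W d (\<lambda>t. (t ^ m) \<cdot>\<^sub>m 1\<^sub>m d) (mpeval d cs) = 0\<^sub>m d d) \<and>
      lip M W d (mpeval d cs) (mpeval d cs) = 1\<^sub>m d \<and>
      pd_mat d (last cs * minv d (last (orthL M W d n)))" for cs
  have adj0: "mat_adjoint X = 0\<^sub>m d d \<longleftrightarrow> X = 0\<^sub>m d d" for X :: "complex mat"
    by (metis mat_adjoint_mat_adjoint mat_adjoint_zero)
  have Q: "Q (rev (map mat_adjoint s)) \<longleftrightarrow> (\<forall>i. 1 \<le> i \<longrightarrow> i \<le> Suc n \<longrightarrow> J d (mpow i) (mpeval d s) = 0\<^sub>m d d) \<and>
      J d (mpeval d s) (mpeval d s) = 1\<^sub>m d \<and> pd_mat d (K * s ! 0)"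
    if s: "length s = Suc (Suc n)" "set s \<subseteq> carrier_mat d d" for s
  proof -
    have c: "set (rev (map mat_adjoint s)) \<subseteq> carrier_mat d d" "length (rev (map mat_adjoint s)) = Suc (Suc n)"
      using s by (auto intro: mat_adjoint_carrier)
    have rr: "rev (map mat_adjoint (rev (map mat_adjoint s))) = s" by (simp add: rev_map o_def)
    have l: "last (rev (map mat_adjoint s)) = mat_adjoint (s ! 0)" using s by (cases s) auto
    have s0: "s ! 0 \<in> carrier_mat d d" using s by (cases s) auto
    have "(\<forall>m\<le>n. lip M W d (\<lambda>t. (t ^ m) \<cdot>\<^sub>m 1\<^sub>m d) (mpeval d (rev (map mat_adjoint s))) = 0\<^sub>m d d) \<longleftrightarrow>
       (\<forall>m\<le>n. J d (mpow (Suc n - m)) (mpeval d s) = 0\<^sub>m d d)"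
      using lip_J(1)[OF c] by (auto simp: rr adj0)
    also have "\<dots> \<longleftrightarrow> (\<forall>i. 1 \<le> i \<longrightarrow> i \<le> Suc n \<longrightarrow> J d (mpow i) (mpeval d s) = 0\<^sub>m d d)"
    proof (intro iffI allI impI)
      fix i assume "\<forall>m\<le>n. J d (mpow (Suc n - m)) (mpeval d s) = 0\<^sub>m d d" "1 \<le> i" "i \<le> Suc n"
      then show "J d (mpow i) (mpeval d s) = 0\<^sub>m d d" by (metis Suc_diff_le diff_diff_cancel diff_le_mono2 diff_Suc_1 One_nat_def)
    qed auto
    finally show ?thesis
      unfolding Q_def l lastn mK pd_swap[OF s0] lip_J(2)[OF c] rr using c by auto
  qed
  have Qs: "Q (rev (map mat_adjoint (Slist (Suc n))))"
    using f pdK by (subst Q) (auto simp: S_def)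
  show ?case
    unfolding orthL.simps Q_def[symmetric]
  proof (rule the_equality[where P = Q, OF Qs])
    fix cs assume Qcs: "Q cs"
    define s where "s = rev (map mat_adjoint cs)"
    have cs: "cs = rev (map mat_adjoint s)" by (simp add: s_def rev_map o_def)
    have s: "length s = Suc (Suc n)" "set s \<subseteq> carrier_mat d d"
      using Qcs by (auto simp: Q_def s_def intro: mat_adjoint_carrier)
    note q = Qcs[unfolded cs Q[OF s]]
    have "s = Slist (Suc n)"
    proof (rule orth_unique[where N = "Suc n" and e = 0, OF _ _ _ _ _ K])
      show "J d (mpow i) (mpeval d s) = 0\<^sub>m d d" if "i \<le> Suc n" "i \<noteq> 0" for i
        using q that by auto
      show "J d (mpow i) (mpeval d (Slist (Suc n))) = 0\<^sub>m d d" if "i \<le> Suc n" "i \<noteq> 0" for i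
        using f(10)[of i] that by (simp add: S_def)
      show "J d (mpeval d (Slist (Suc n))) (mpeval d (Slist (Suc n))) = 1\<^sub>m d" using f(12) by (simp add: S_def)
    qed (use q s f pdK in auto)
    then show "cs = rev (map mat_adjoint (Slist (Suc n)))" by (simp add: cs)
  qed
qed

end

section \<open>Cauchy transforms and the iterates of the Schur function\<close>

context matrix_meas begin

definition ck :: "complex \<Rightarrow> (complex \<Rightarrow> complex mat) \<Rightarrow> complex \<Rightarrow> complex mat" where
  "ck z h t = (1 / (t - z)) \<cdot>\<^sub>m h t"

definition sk :: "complex \<Rightarrow> (complex \<Rightarrow> complex mat) \<Rightarrow> complex \<Rightarrow> complex mat" where
  "sk z h t = (t / (t - z)) \<cdot>\<^sub>m h t"

lemma circ_neq: "t \<in> circ \<Longrightarrow> cmod z < 1 \<Longrightarrow> t - z \<noteq> 0"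
  by (auto simp: circ_def)

lemma continuous_kernel:
  assumes "cmod z < 1" shows "continuous_on circ (\<lambda>t. 1 / (t - z))" "continuous_on circ (\<lambda>t. t / (t - z))"
  using circ_neq[OF _ assms] by (auto intro!: continuous_intros)

lemma cfun_ck: "cmod z < 1 \<Longrightarrow> cfun n m h \<Longrightarrow> cfun n m (ck z h)"
  and cfun_sk: "cmod z < 1 \<Longrightarrow> cfun n m h \<Longrightarrow> cfun n m (sk z h)"
  unfolding ck_def[abs_def] sk_def[abs_def] by (intro cfun_intros continuous_kernel; assumption)+

lemma sk_eq:
  assumes z: "cmod z < 1" and g: "cfun d d g" and h: "cfun d m h"
  shows "J m g (sk z h) = J m g h + z \<cdot>\<^sub>m J m g (ck z h)"
proof -
  have "J m g (sk z h) = J m g (\<lambda>t. h t + z \<cdot>\<^sub>m ck z h t)"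
  proof (intro J_cong refl)
    fix t assume t: "t \<in> circ"
    have "t / (t - z) = 1 + z * (1 / (t - z))" using circ_neq[OF t z] by (simp add: field_simps)
    then show "sk z h t = h t + z \<cdot>\<^sub>m ck z h t" by (intro eq_matI) (auto simp: sk_def ck_def algebra_simps)
  qed
  also have "\<dots> = J m g h + z \<cdot>\<^sub>m J m g (ck z h)"
    by (simp add: J_add_right[OF g h cfun_intros(4)[OF continuous_on_const cfun_ck[OF z h]]]
        J_smult_right[OF g cfun_ck[OF z h]])
  finally show ?thesis .
qed

lemma J_shift_sk: "cfun d d g \<Longrightarrow> cmod z < 1 \<Longrightarrow> cfun d m h \<Longrightarrow> J m (\<lambda>t. t \<cdot>\<^sub>m g t) (sk z h) = J m g (ck z h)"
proof -
  assume g: "cfun d d g" and z: "cmod z < 1" and h: "cfun d m h"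
  have "J m (\<lambda>t. t \<cdot>\<^sub>m g t) (sk z h) = J m (\<lambda>t. t \<cdot>\<^sub>m g t) (\<lambda>t. t \<cdot>\<^sub>m ck z h t)"
    by (intro J_cong refl) (simp add: sk_def ck_def smult_smult_mat_eq)
  then show ?thesis by (simp add: J_shift[OF g cfun_ck[OF z h]])
qed

text \<open>The first argument enters the pairing through its adjoint, so the right factors of the
  recursion come out as their adjoints on the left; the inverse defect roots are cleared.\<close>

lemma Szego_J:
  assumes h: "cfun d m h"
  shows "rhoR d (alpha k) * J m (R (Suc k)) h = J m (\<lambda>t. t \<cdot>\<^sub>m R k t) h - alpha k * J m (S k) h"
    "rhoL d (alpha k) * J m (S (Suc k)) h = J m (S k) h - mat_adjoint (alpha k) * J m (\<lambda>t. t \<cdot>\<^sub>m R k t) h"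
proof -
  note f = szego_facts(13,14)[where k = k] and st = szego_step[OF szego_inv[of k]]
  note rho = rho_props[OF st(1)]
  have ca: "alpha k \<in> carrier_mat d d" using st(1) by (simp add: strict_contraction_def)
  have cI: "minv d (rhoR d (alpha k)) \<in> carrier_mat d d" "minv d (rhoL d (alpha k)) \<in> carrier_mat d d"
    using pd_props[OF rho(1)] pd_props[OF rho(2)] by (auto intro: carrier_matI)
  have cT: "cfun d d (\<lambda>t. t \<cdot>\<^sub>m R k t)" by (intro cfun_intros continuous_intros f)
  have c1: "cfun d d (\<lambda>t. S k t * mat_adjoint (alpha k))"
    by (intro cfun_mult[OF f(2)] cfun_intros mat_adjoint_carrier ca)
  have c2: "cfun d d (\<lambda>t. (t \<cdot>\<^sub>m R k t) * alpha k)"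
    by (intro cfun_mult[OF cT] cfun_intros ca)
  have 1: "J m (R (Suc k)) h = mat_adjoint (minv d (rhoR d (alpha k))) *
      (J m (\<lambda>t. t \<cdot>\<^sub>m R k t) h - alpha k * J m (S k) h)"
    unfolding st(3)[abs_def]
    by (simp add: J_mult_left[OF cfun_intros(3)[OF cT c1] h cI(1)] J_diff_left[OF cT c1 h]
        J_mult_left[OF f(2) h mat_adjoint_carrier[OF ca]])
  have 2: "J m (S (Suc k)) h = mat_adjoint (minv d (rhoL d (alpha k))) *
      (J m (S k) h - mat_adjoint (alpha k) * J m (\<lambda>t. t \<cdot>\<^sub>m R k t) h)"
    unfolding st(4)[abs_def]
    by (simp add: J_mult_left[OF cfun_intros(3)[OF f(2) c2] h cI(2)] J_diff_left[OF f(2) c2 h]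
        J_mult_left[OF cT h ca])
  note [simp] = pd_props(3)[OF pd_minv[OF rho(1)]] pd_props(3)[OF pd_minv[OF rho(2)]]
  have [simp]: "dim_row (alpha k) = d" "dim_col (alpha k) = d" using ca by auto
  show "rhoR d (alpha k) * J m (R (Suc k)) h = J m (\<lambda>t. t \<cdot>\<^sub>m R k t) h - alpha k * J m (S k) h"
    unfolding 1 by (simp add: pd_cancel[OF rho(2)])
  show "rhoL d (alpha k) * J m (S (Suc k)) h = J m (S k) h - mat_adjoint (alpha k) * J m (\<lambda>t. t \<cdot>\<^sub>m R k t) h"
    unfolding 2 by (simp add: pd_cancel[OF rho(1)])
qed

text \<open>Orthogonality makes the Cauchy-type moments a geometric sequence, so that such a functional acts on polynomials of
  small degree as evaluation at \<open>z\<close>.\<close>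

lemma moment_eval:
  assumes g: "cfun d d g" and \<kappa>: "continuous_on circ \<kappa>"
    and mom: "\<And>i. i \<le> k \<Longrightarrow> J d g (\<lambda>t. \<kappa> t \<cdot>\<^sub>m mpow i t) = z ^ i \<cdot>\<^sub>m J d g (\<lambda>t. \<kappa> t \<cdot>\<^sub>m mpow 0 t)"
    and cs: "set cs \<subseteq> carrier_mat d d" and len: "l + length cs \<le> Suc k"
  shows "J d g (\<lambda>t. \<kappa> t \<cdot>\<^sub>m (t ^ l \<cdot>\<^sub>m mpeval d cs t)) = J d g (\<lambda>t. \<kappa> t \<cdot>\<^sub>m mpow 0 t) * (z ^ l \<cdot>\<^sub>m mpeval d cs z)"
  using cs len
proof (induction cs arbitrary: l)
  case Nil
  have "J d g (\<lambda>t. \<kappa> t \<cdot>\<^sub>m (t ^ l \<cdot>\<^sub>m mpeval d [] t)) = J d g (\<lambda>t. 0\<^sub>m d d * 0\<^sub>m d d)"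
    by (intro J_cong) auto
  also have "\<dots> = 0\<^sub>m d d"
    using cfun_intros(1)[of "0\<^sub>m d d" d d] by (subst J_mult_right[OF g, of d]) (auto simp: zero_mat_right)
  finally show ?case by (simp add: zero_mat_right)
next
  case (Cons c cs)
  have c: "c \<in> carrier_mat d d" and cs: "set cs \<subseteq> carrier_mat d d" using Cons.prems by auto
  have cm: "cfun d d (\<lambda>t. \<kappa> t \<cdot>\<^sub>m mpow i t)" for i by (intro cfun_intros \<kappa> cfun_mpow)
  have [simp]: "dim_row c = d" "dim_col c = d" using c by auto
  have cpow: "continuous_on circ (\<lambda>t. t ^ n)" for n by (intro continuous_intros)
  have "J d g (\<lambda>t. \<kappa> t \<cdot>\<^sub>m (t ^ l \<cdot>\<^sub>m mpeval d (c # cs) t))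
      = J d g (\<lambda>t. (\<kappa> t \<cdot>\<^sub>m mpow l t) * c + \<kappa> t \<cdot>\<^sub>m (t ^ Suc l \<cdot>\<^sub>m mpeval d cs t))"
    by (intro J_cong refl eq_matI) (use cs in \<open>auto simp: mpow_def mat_smult_left mat_one_left algebra_simps\<close>)
  also have "\<dots> = J d g (\<lambda>t. (\<kappa> t \<cdot>\<^sub>m mpow l t) * c) + J d g (\<lambda>t. \<kappa> t \<cdot>\<^sub>m (t ^ Suc l \<cdot>\<^sub>m mpeval d cs t))"
    by (rule J_add_right[OF g cfun_mult[OF cm cfun_intros(1)[OF c]]
        cfun_intros(4)[OF \<kappa> cfun_intros(4)[OF cpow cfun_mpeval[OF cs]]]])
  also have "J d g (\<lambda>t. (\<kappa> t \<cdot>\<^sub>m mpow l t) * c) = (z ^ l \<cdot>\<^sub>m J d g (\<lambda>t. \<kappa> t \<cdot>\<^sub>m mpow 0 t)) * c"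
    unfolding J_mult_right[OF g cm c] by (subst mom) (use Cons.prems in auto)
  also have "J d g (\<lambda>t. \<kappa> t \<cdot>\<^sub>m (t ^ Suc l \<cdot>\<^sub>m mpeval d cs t)) =
      J d g (\<lambda>t. \<kappa> t \<cdot>\<^sub>m mpow 0 t) * (z ^ Suc l \<cdot>\<^sub>m mpeval d cs z)"
    using Cons.prems by (intro Cons.IH cs) auto
  also have "(z ^ l \<cdot>\<^sub>m J d g (\<lambda>t. \<kappa> t \<cdot>\<^sub>m mpow 0 t)) * c + \<dots> =
      J d g (\<lambda>t. \<kappa> t \<cdot>\<^sub>m mpow 0 t) * (z ^ l \<cdot>\<^sub>m c + z ^ Suc l \<cdot>\<^sub>m mpeval d cs z)"
    using cs by (simp add: mat_smult_left mat_smult_right mat_distrib_left)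
  also have "z ^ l \<cdot>\<^sub>m c + z ^ Suc l \<cdot>\<^sub>m mpeval d cs z = z ^ l \<cdot>\<^sub>m mpeval d (c # cs) z"
    using cs by (intro eq_matI) (auto simp: algebra_simps)
  finally show ?case .
qed

text \<open>Cauchy moments of order zero. Orthogonality reduces all moments up to order k to them,
  and \<open>fk\<close> is the factor F_k of the overview.\<close>

definition Pk :: "nat \<Rightarrow> complex \<Rightarrow> complex mat" where "Pk k z = J d (R k) (ck z (mpow 0))"
definition Qk :: "nat \<Rightarrow> complex \<Rightarrow> complex mat" where "Qk k z = J d (S k) (sk z (mpow 0))"
definition fk :: "nat \<Rightarrow> complex \<Rightarrow> complex mat" where "fk k z = Pk k z * minv d (Qk k z)"

text \<open>From t/(t-z) = 1 + z/(t-z). The inhomogeneous term is an ordinary moment, which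
  orthogonality removes for the orders used below.\<close>

lemma ck_mpow_Suc:
  assumes z: "cmod z < 1" and g: "cfun d d g"
  shows "J d g (ck z (mpow (Suc i))) = J d g (mpow i) + z \<cdot>\<^sub>m J d g (ck z (mpow i))"
proof -
  have "J d g (ck z (mpow (Suc i))) = J d g (sk z (mpow i))"
    by (intro J_cong refl) (simp add: ck_def sk_def mpow_def smult_smult_mat_eq)
  then show ?thesis by (simp add: sk_eq[OF z g cfun_mpow])
qed

lemma sk_mpow_Suc:
  assumes z: "cmod z < 1" and g: "cfun d d g"
  shows "J d g (sk z (mpow (Suc i))) = J d g (mpow (Suc i)) + z \<cdot>\<^sub>m J d g (sk z (mpow i))"
proof -
  have "ck z (mpow (Suc i)) = sk z (mpow i)"
    by (simp add: ck_def sk_def mpow_def smult_smult_mat_eq fun_eq_iff)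
  then show ?thesis by (simp add: sk_eq[OF z g, of d "mpow (Suc i)"] cfun_mpow)
qed

lemma Pk_mpow: "cmod z < 1 \<Longrightarrow> i \<le> k \<Longrightarrow> J d (R k) (ck z (mpow i)) = z ^ i \<cdot>\<^sub>m Pk k z"
proof (induction i)
  case 0
  then show ?case by (auto simp: Pk_def intro!: eq_matI)
next
  case (Suc i)
  have "J d (R k) (mpow i) = mat_adjoint (J d (mpow i) (R k))"
    by (rule J_adjoint[OF cfun_mpow szego_facts(13), symmetric])
  then have "J d (R k) (mpow i) = 0\<^sub>m d d" using szego_facts(9)[of i k] Suc.prems by simp
  then show ?case using Suc
    by (simp add: ck_mpow_Suc[OF _ szego_facts(13)] smult_smult_mat_eq) (auto intro!: eq_matI simp: Pk_def)
qed

lemma Qk_mpow: "cmod z < 1 \<Longrightarrow> i \<le> k \<Longrightarrow> J d (S k) (sk z (mpow i)) = z ^ i \<cdot>\<^sub>m Qk k z"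
proof (induction i)
  case 0
  then show ?case by (auto simp: Qk_def intro!: eq_matI)
next
  case (Suc i)
  have "J d (S k) (mpow (Suc i)) = mat_adjoint (J d (mpow (Suc i)) (S k))"
    by (rule J_adjoint[OF cfun_mpow szego_facts(14), symmetric])
  then have "J d (S k) (mpow (Suc i)) = 0\<^sub>m d d" using szego_facts(10)[of "Suc i" k] Suc.prems by simp
  then show ?case using Suc
    by (simp add: sk_mpow_Suc[OF _ szego_facts(14)] smult_smult_mat_eq) (auto intro!: eq_matI simp: Qk_def)
qed

lemma PQ_eval:
  assumes z: "cmod z < 1" and cs: "set cs \<subseteq> carrier_mat d d" and len: "l + length cs \<le> Suc k"
  shows "J d (R k) (ck z (\<lambda>t. t ^ l \<cdot>\<^sub>m mpeval d cs t)) = Pk k z * (z ^ l \<cdot>\<^sub>m mpeval d cs z)"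
    "J d (S k) (sk z (\<lambda>t. t ^ l \<cdot>\<^sub>m mpeval d cs t)) = Qk k z * (z ^ l \<cdot>\<^sub>m mpeval d cs z)"
proof -
  note f = szego_facts(13,14)[where k = k]
  have 1: "J d (R k) (\<lambda>t. (1 / (t - z)) \<cdot>\<^sub>m mpow i t) = z ^ i \<cdot>\<^sub>m J d (R k) (\<lambda>t. (1 / (t - z)) \<cdot>\<^sub>m mpow 0 t)"
    if "i \<le> k" for i using Pk_mpow[OF z that] unfolding Pk_def ck_def[abs_def] .
  have 2: "J d (S k) (\<lambda>t. (t / (t - z)) \<cdot>\<^sub>m mpow i t) = z ^ i \<cdot>\<^sub>m J d (S k) (\<lambda>t. (t / (t - z)) \<cdot>\<^sub>m mpow 0 t)"
    if "i \<le> k" for i using Qk_mpow[OF z that] unfolding Qk_def sk_def[abs_def] .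
  show "J d (R k) (ck z (\<lambda>t. t ^ l \<cdot>\<^sub>m mpeval d cs t)) = Pk k z * (z ^ l \<cdot>\<^sub>m mpeval d cs z)"
    using moment_eval[OF f(1) continuous_kernel(1)[OF z] 1 cs len] unfolding Pk_def ck_def[abs_def] .
  show "J d (S k) (sk z (\<lambda>t. t ^ l \<cdot>\<^sub>m mpeval d cs t)) = Qk k z * (z ^ l \<cdot>\<^sub>m mpeval d cs z)"
    using moment_eval[OF f(2) continuous_kernel(2)[OF z] 2 cs len] unfolding Qk_def sk_def[abs_def] .
qed

text \<open>With w = z cnj t the kernel is 1/(1-w), and this function of w maps the unit disc into
  the half-plane of real part above 1/2.\<close>

lemma Re_kernel_ge:
  assumes t: "t \<in> circ" and z: "cmod z < 1" shows "Re (t / (t - z)) \<ge> 1 / 2"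
proof -
  define w where "w = z * cnj t"
  have "cmod t = 1" using t by (simp add: circ_def)
  then have w: "cmod w < 1" using z by (simp add: w_def norm_mult)
  have t0: "t \<noteq> 0" using circ_cnj(3)[OF t] .
  have "t - z = t * (1 - w)" using circ_cnj(2)[OF t] by (simp add: w_def algebra_simps)
  then have eq: "t / (t - z) = 1 / (1 - w)" using t0 by simp
  have w1: "w \<noteq> 1" using w by auto
  have "(cmod w)\<^sup>2 \<le> 1" using w by (simp add: abs_square_le_1)
  then have sq: "(Re w)\<^sup>2 + (Im w)\<^sup>2 \<le> 1" by (simp add: cmod_power2)
  have pos: "(1 - Re w)\<^sup>2 + (Im w)\<^sup>2 > 0"
  proof (rule ccontr)
    assume "\<not> ?thesis"
    then have "1 - Re w = 0 \<and> Im w = 0" by (simp add: sum_power2_gt_zero_iff)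
    then show False using w1 by (simp add: complex_eq_iff)
  qed
  have "Re (1 / (1 - w)) = (1 - Re w) / ((1 - Re w)\<^sup>2 + (Im w)\<^sup>2)"
    by (simp add: Re_divide)
  also have "\<dots> \<ge> 1 / 2"
    using pos sq by (simp add: field_simps power2_eq_square)
  finally show ?thesis by (simp add: eq)
qed

text \<open>The real part of the quadratic form is at least half of that of J g g = 1, so it cannot
  vanish on a nonzero vector.\<close>

lemma det_resolvent:
  assumes z: "cmod z < 1" and g: "cfun d d g" and one: "J d g g = 1\<^sub>m d"
  shows "Determinant.det (J d g (sk z g)) \<noteq> 0"
proof (rule det_nonzero_if_injective[of _ d])
  fix v :: "complex Matrix.vec"
  assume v: "v \<in> carrier_vec d" and zero: "J d g (sk z g) *\<^sub>v v = 0\<^sub>v d"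
  define q where "q t = (W t *\<^sub>v (g t *\<^sub>v v)) \<bullet>c (g t *\<^sub>v v)" for t
  have q: "integrable M q" using J_quadratic(2)[OF g v] by (simp add: q_def[abs_def])
  have eq: "((mat_adjoint (g t) * W t * sk z g t) *\<^sub>v v) \<bullet>c v = (t / (t - z)) * q t" if t: "t \<in> circ" for t
  proof -
    note c = mat_funD(1)[OF g t] W_carrier[OF t]
    note hv = mult_mat_vec_carrier[OF c(1) v]
    note Whv = mult_mat_vec_carrier[OF c(2) hv]
    have "mat_adjoint (g t) * W t * sk z g t = (t / (t - z)) \<cdot>\<^sub>m (mat_adjoint (g t) * W t * g t)"
      using c by (simp add: sk_def mat_smult_right)
    then have "(mat_adjoint (g t) * W t * sk z g t) *\<^sub>v v
        = (t / (t - z)) \<cdot>\<^sub>v (mat_adjoint (g t) *\<^sub>v (W t *\<^sub>v (g t *\<^sub>v v)))"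
      using c v hv by (simp add: smult_mat_mult_vec assoc_mult_mat_vec[of _ d d _ d] mult_carrier_mat[of _ d d])
    also have "\<dots> \<bullet>c v = (t / (t - z)) * ((mat_adjoint (g t) *\<^sub>v (W t *\<^sub>v (g t *\<^sub>v v))) \<bullet>c v)"
      using c v Whv by (intro smult_scalar_prod_distrib[of _ d]) (auto intro!: mult_mat_vec_carrier[of _ d d])
    also have "(mat_adjoint (g t) *\<^sub>v (W t *\<^sub>v (g t *\<^sub>v v))) \<bullet>c v = q t"
      using c Whv v by (simp add: cscalar_mult_mat_vec[of _ d d] q_def)
    finally show ?thesis .
  qed
  have qpos: "Re (q t) \<ge> 0" if t: "t \<in> circ" for t
    unfolding q_def by (rule psd_matD(3)[OF W_psd[OF t] mult_mat_vec_carrier[OF mat_funD(1)[OF g t] v]])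
  have qreal: "Im (q t) = 0" if t: "t \<in> circ" for t
  proof -
    define u where "u = g t *\<^sub>v v"
    have u: "u \<in> carrier_vec d" using mult_mat_vec_carrier[OF mat_funD(1)[OF g t] v] by (simp add: u_def)
    have Wu: "W t *\<^sub>v u \<in> carrier_vec d" by (rule mult_mat_vec_carrier[OF W_carrier[OF t] u])
    have "(W t *\<^sub>v u) \<bullet>c u = u \<bullet>c (W t *\<^sub>v u)"
      using cscalar_mult_mat_vec[OF W_carrier[OF t] u u] psd_matD(2)[OF W_psd[OF t]] by simp
    also have "u \<bullet>c y = cnj (y \<bullet>c u)" if "y \<in> carrier_vec d" for y
      using u that by (simp add: scalar_prod_def mult.commute)
    note this[OF Wu]
    finally have "Im ((W t *\<^sub>v u) \<bullet>c u) = 0" by (simp add: complex_eq_iff)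
    then show ?thesis by (simp add: q_def u_def)
  qed
  have kq: "integrable M (\<lambda>t. (t / (t - z)) * q t)"
    by (rule integrable_continuous_mult[OF continuous_kernel(2)[OF z] q])
  have "0 = Re ((J d g (sk z g) *\<^sub>v v) \<bullet>c v)" using zero v by (simp add: scalar_prod_def)
  also have "(J d g (sk z g) *\<^sub>v v) \<bullet>c v = integral\<^sup>L M (\<lambda>t. (t / (t - z)) * q t)"
    unfolding J_def mint_quadratic(1)[OF integrable_J[OF g cfun_sk[OF z g]] v]
    by (rule integral_cong_circ) (rule eq)
  also have "Re \<dots> = integral\<^sup>L M (\<lambda>t. Re ((t / (t - z)) * q t))"
    using kq by (rule integral_Re[symmetric])
  also have "\<dots> \<ge> integral\<^sup>L M (\<lambda>t. (1 / 2) * Re (q t))"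
  proof (rule integral_mono)
    fix t assume "t \<in> space M"
    then have t: "t \<in> circ" by (simp add: space_M)
    have "Re ((t / (t - z)) * q t) = Re (t / (t - z)) * Re (q t)"
      by (subst times_complex.simps(1)) (simp add: qreal[OF t])
    then show "(1 / 2) * Re (q t) \<le> Re ((t / (t - z)) * q t)"
      using mult_right_mono[OF Re_kernel_ge[OF t z] qpos[OF t]] by simp
  qed (use q kq in auto)
  also have "integral\<^sup>L M (\<lambda>t. (1 / 2) * Re (q t)) = (1 / 2) * Re (integral\<^sup>L M q)"
    using q by simp
  also have "integral\<^sup>L M q = (J d g g *\<^sub>v v) \<bullet>c v" by (simp add: J_quadratic(1)[OF g v] q_def[abs_def])
  also have "\<dots> = v \<bullet>c v" using v by (simp add: one)
  finally have "Re (v \<bullet>c v) \<le> 0" by simp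
  then show "v = 0\<^sub>v d" by (rule cscalar_self_eq_0[OF v])
qed simp

text \<open>For h = S k the pairing factors as \<open>Qk\<close> times the value of S k at z, and
  the pairing is invertible by \<open>det_resolvent\<close>.\<close>

lemma det_Qk: assumes z: "cmod z < 1" shows "Determinant.det (Qk k z) \<noteq> 0"
proof -
  note f = szego_facts[where k = k]
  have "J d (S k) (sk z (S k)) = J d (S k) (sk z (\<lambda>t. t ^ 0 \<cdot>\<^sub>m mpeval d (Slist k) t))"
    by (intro J_cong refl eq_matI) (auto simp: S_def sk_def)
  also have "\<dots> = Qk k z * (z ^ 0 \<cdot>\<^sub>m mpeval d (Slist k) z)"
    using f by (intro PQ_eval(2)[OF z]) auto
  finally have "Determinant.det (Qk k z * (z ^ 0 \<cdot>\<^sub>m mpeval d (Slist k) z)) \<noteq> 0"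
    using det_resolvent[OF z f(14,12)] by simp
  then show ?thesis using f mpeval_carrier[of "Slist k" d z] by (subst (asm) det_mult[of _ d]) (auto simp: Qk_def)
qed

lemma PQ_dims [simp]: "dim_row (Pk k z) = d" "dim_col (Pk k z) = d" "dim_row (Qk k z) = d" "dim_col (Qk k z) = d"
  "Pk k z \<in> carrier_mat d d" "Qk k z \<in> carrier_mat d d"
  by (auto simp: Pk_def Qk_def)

lemma fk_dims: assumes "cmod z < 1" shows "dim_row (fk k z) = d" "dim_col (fk k z) = d" "fk k z \<in> carrier_mat d d"
  using minv_inverse(1)[OF PQ_dims(6) det_Qk[OF assms, of k]] by (auto simp: fk_def)

lemma fk_Qk: assumes "cmod z < 1" shows "fk k z * Qk k z = Pk k z"
  using minv_inverse[OF PQ_dims(6) det_Qk[OF assms, of k]]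
  by (simp add: fk_def mat_assoc mat_one_right)

text \<open>Both pairings are the value at z multiplied on the left by \<open>Pk\<close> or
  \<open>Qk\<close>, so their quotient does not depend on the polynomial.\<close>

lemma right_relation:
  assumes z: "cmod z < 1" and cs: "set cs \<subseteq> carrier_mat d d" and len: "l + length cs \<le> Suc k"
  shows "J d (R k) (ck z (\<lambda>t. t ^ l \<cdot>\<^sub>m mpeval d cs t)) = fk k z * J d (S k) (sk z (\<lambda>t. t ^ l \<cdot>\<^sub>m mpeval d cs t))"
  unfolding PQ_eval[OF z cs len] fk_Qk[OF z, symmetric]
  using cs fk_dims[OF z] by (intro mat_assoc) auto

text \<open>S k serves as test function: at z = 0 the kernel t/(t-z) is 1 and the right side becomes
  the normalisation of S k, while 1/t turns the left side into the pairing of tR k with S k, that is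
  \<open>alpha\<close>.\<close>

lemma fk_0: "fk k 0 = alpha k"
proof -
  note f = szego_facts[where k = k]
  have Sk: "S k t = t ^ 0 \<cdot>\<^sub>m mpeval d (Slist k) t" for t
    by (intro eq_matI) (auto simp: S_def)
  have Sk': "S k = (\<lambda>t. t ^ 0 \<cdot>\<^sub>m mpeval d (Slist k) t)" by (rule ext) (rule Sk)
  have "J d (R k) (ck 0 (S k)) = fk k 0 * J d (S k) (sk 0 (S k))"
    using right_relation[of 0 "Slist k" 0 k] f by (simp only: Sk'[symmetric]) simp
  also have "J d (S k) (sk 0 (S k)) = J d (S k) (S k)"
    by (intro J_cong refl eq_matI) (auto simp: sk_def circ_cnj(3))
  also have "\<dots> = 1\<^sub>m d" by (rule f(12))
  also have "J d (R k) (ck 0 (S k)) = J d (\<lambda>t. t \<cdot>\<^sub>m R k t) (sk 0 (S k))"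
    by (rule J_shift_sk[OF f(13) _ f(14), symmetric]) simp
  also have "\<dots> = J d (\<lambda>t. t \<cdot>\<^sub>m R k t) (S k)"
    by (intro J_cong refl eq_matI) (auto simp: sk_def circ_cnj(3))
  also have "\<dots> = alpha k"
    unfolding alpha_def by (rule J_adjoint[OF f(14), symmetric]) (intro cfun_intros continuous_intros f)
  finally show ?thesis using fk_dims[of 0 k] by (simp add: mat_one_right)
qed

text \<open>Continuity at 0 is what \<open>fill0_continuous\<close> consumes; a Lipschitz bound near
  0 provides it.\<close>

lemma isCont_cauchy:
  assumes \<psi>: "integrable M (\<psi> :: complex \<Rightarrow> complex)"
  shows "isCont (\<lambda>z. integral\<^sup>L M (\<lambda>t. 1 / (t - z) * \<psi> t)) 0"
proof -
  have int: "integrable M (\<lambda>t. 1 / (t - z) * \<psi> t)" if "cmod z < 1" for z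
    by (rule integrable_continuous_mult[OF continuous_kernel(1)[OF that] \<psi>])
  define C where "C = integral\<^sup>L M (\<lambda>t. norm (\<psi> t))"
  \<comment> \<open>For |z| < 1/2 one has |t - z| at least 1/2, so 1/(t-z) - 1/t = z/(t(t-z)) is at
    most 2|z| in modulus; this is the origin of both constants.\<close>
  have bound: "norm (integral\<^sup>L M (\<lambda>t. 1 / (t - z) * \<psi> t) - integral\<^sup>L M (\<lambda>t. 1 / (t - 0) * \<psi> t)) \<le> 2 * C * norm z"
    if z: "norm z < 1 / 2" for z
  proof -
    have "norm (integral\<^sup>L M (\<lambda>t. 1 / (t - z) * \<psi> t) - integral\<^sup>L M (\<lambda>t. 1 / (t - 0) * \<psi> t))
       = norm (integral\<^sup>L M (\<lambda>t. 1 / (t - z) * \<psi> t - 1 / (t - 0) * \<psi> t))"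
      using int[of z] int[of 0] z by (subst Bochner_Integration.integral_diff) auto
    also have "\<dots> \<le> integral\<^sup>L M (\<lambda>t. norm (1 / (t - z) * \<psi> t - 1 / (t - 0) * \<psi> t))"
      by (rule integral_norm_bound)
    also have "\<dots> \<le> integral\<^sup>L M (\<lambda>t. (2 * norm z) * norm (\<psi> t))"
    proof (rule integral_mono)
      fix t assume "t \<in> space M"
      then have t: "t \<in> circ" by (simp add: space_M)
      then have n: "cmod t = 1" by (simp add: circ_def)
      have "cmod t - cmod z \<le> cmod (t - z)" by (rule norm_triangle_ineq2)
      then have tz: "cmod (t - z) \<ge> 1 / 2" using z n by simp
      have t0: "t \<noteq> 0" "t - z \<noteq> 0" using n tz by auto
      have "1 / (t - z) * \<psi> t - 1 / (t - 0) * \<psi> t = z / (t * (t - z)) * \<psi> t"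
        using t0 by (simp add: field_simps)
      then have "norm (1 / (t - z) * \<psi> t - 1 / (t - 0) * \<psi> t) = (norm z / cmod (t - z)) * norm (\<psi> t)"
        by (simp add: norm_mult norm_divide n)
      also have "\<dots> \<le> (2 * norm z) * norm (\<psi> t)"
      proof (rule mult_right_mono)
        have "norm z * 1 \<le> norm z * (2 * cmod (t - z))" using tz by (intro mult_left_mono) auto
        then show "norm z / cmod (t - z) \<le> 2 * norm z" using t0 by (simp add: divide_le_eq mult_ac)
      qed simp
      finally show "norm (1 / (t - z) * \<psi> t - 1 / (t - 0) * \<psi> t) \<le> (2 * norm z) * norm (\<psi> t)" .
    qed (use int[of z] int[of 0] z \<psi> in auto)
    also have "\<dots> = 2 * C * norm z" by (simp add: C_def)
    finally show ?thesis .
  qed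
  show ?thesis
    unfolding isCont_def
  proof (rule LIM_zero_cancel, rule Lim_null_comparison)
    have "eventually (\<lambda>z::complex. z \<in> ball 0 (1/2)) (at 0)"
      by (rule eventually_at_in_open') auto
    then show "eventually (\<lambda>z. norm (integral\<^sup>L M (\<lambda>t. 1 / (t - z) * \<psi> t) - integral\<^sup>L M (\<lambda>t. 1 / (t - 0) * \<psi> t)) \<le> 2 * C * norm z) (at 0)"
      by (rule eventually_mono) (use bound in auto)
    show "((\<lambda>z::complex. 2 * C * norm z) \<longlongrightarrow> 0) (at 0)"
      by (intro tendsto_mult_right_zero tendsto_norm_zero tendsto_ident_at)
  qed
qed

abbreviation cont0_mat :: "(complex \<Rightarrow> complex mat) \<Rightarrow> bool" where
  "cont0_mat \<equiv> mat_fun (ball 0 1) (\<lambda>f. isCont f 0) d d"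

lemma cont0_alg: "fun_algebra (ball (0::complex) 1) (\<lambda>f. isCont f 0)"
  by (rule fun_algebra_isCont) auto

lemma cont0_J:
  assumes g: "cfun d d g" and h: "cfun d d h"
  shows "cont0_mat (\<lambda>z. J d g (ck z h))"
  unfolding mat_fun_def
proof (intro conjI ballI allI impI)
  fix a b assume ab: "a < d" "b < d"
  have "integrable M (\<lambda>t. (mat_adjoint (g t) * W t * h t) $$ (a, b))"
    using integrable_J[OF g h] ab by (auto simp: integrable_mat_def)
  from isCont_cauchy[OF this]
  show "isCont (\<lambda>z. J d g (ck z h) $$ (a, b)) 0"
  proof (rule fun_algebraD(4)[OF cont0_alg, rotated])
    fix z assume "z \<in> ball (0::complex) 1"
    have "J d g (ck z h) $$ (a, b) = integral\<^sup>L M (\<lambda>t. (mat_adjoint (g t) * W t * ck z h t) $$ (a, b))"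
      using ab by (simp add: J_def mint_def)
    also have "\<dots> = integral\<^sup>L M (\<lambda>t. 1 / (t - z) * (mat_adjoint (g t) * W t * h t) $$ (a, b))"
    proof (rule integral_cong_circ)
      fix t assume t: "t \<in> circ"
      have "mat_adjoint (g t) * W t * ck z h t = (1 / (t - z)) \<cdot>\<^sub>m (mat_adjoint (g t) * W t * h t)"
        using mat_funD(1)[OF g t] mat_funD(1)[OF h t] W_carrier[OF t] by (simp add: ck_def mat_smult_right)
      then show "(mat_adjoint (g t) * W t * ck z h t) $$ (a, b) = 1 / (t - z) * (mat_adjoint (g t) * W t * h t) $$ (a, b)"
        using mat_funD(1)[OF g t] mat_funD(1)[OF h t] W_carrier[OF t] ab by (simp del: index_mult_mat(1))
    qed
    finally show "integral\<^sup>L M (\<lambda>t. 1 / (t - z) * (mat_adjoint (g t) * W t * h t) $$ (a, b)) = J d g (ck z h) $$ (a, b)" ..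
  qed
qed simp

lemma cont0_fk: "cont0_mat (fk k)"
proof -
  note f = szego_facts(13,14)[where k = k]
  have "cont0_mat (\<lambda>z. J d (S k) (ck z (mpow 1)))" by (rule cont0_J[OF f(2) cfun_mpow])
  then have Q: "cont0_mat (Qk k)"
    by (rule mat_fun_cong[OF cont0_alg]) (auto simp: Qk_def intro!: J_cong simp: ck_def sk_def mpow_def smult_smult_mat_eq)
  have P: "cont0_mat (Pk k)" unfolding Pk_def[abs_def] by (rule cont0_J[OF f(1) cfun_mpow])
  have "cont0_mat (\<lambda>z. Pk k z * minv d (Qk k z))"
    by (intro mat_fun_mult[OF cont0_alg P] mat_fun_minv[OF cont0_alg Q] det_Qk) simp
  then show ?thesis by (simp add: fk_def[abs_def])
qed

text \<open>Turns a linear relation N = F D into the value of the Schur function. The size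
  \<open>n\<close> is general, since the lemma serves the measure itself and its block measures
  alike.\<close>

lemma schur_of_value:
  fixes V :: "complex \<Rightarrow> complex mat"
  assumes V: "integrable_mat n n V" and one: "mat_int M n V = 1\<^sub>m n" and z: "cmod z < 1" "z \<noteq> 0"
    and F: "F \<in> carrier_mat n n" and rel: "mint n n (ck z V) = F * mint n n (sk z V)"
  shows "(1 / z) \<cdot>\<^sub>m ((carath M V n z - 1\<^sub>m n) * minv n (carath M V n z + 1\<^sub>m n)) = F"
proof -
  define N where "N = mint n n (ck z V)"
  define D where "D = mint n n (sk z V)"
  have [simp]: "dim_row N = n" "dim_col N = n" "dim_row D = n" "dim_col D = n" "dim_row F = n" "dim_col F = n"
    using F by (auto simp: N_def D_def)
  have Vint: "integrable M (\<lambda>t. V t $$ (a, b))" if "a < n" "b < n" for a b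
    using V that by (auto simp: integrable_mat_def)
  have Vc: "V t \<in> carrier_mat n n" if "t \<in> circ" for t using V that by (auto simp: integrable_mat_def)
  have i1: "integrable M (\<lambda>t. 1 / (t - z) * V t $$ (a, b))" and i2: "integrable M (\<lambda>t. t / (t - z) * V t $$ (a, b))"
    if "a < n" "b < n" for a b
    by (rule integrable_continuous_mult[OF continuous_kernel(1)[OF z(1)] Vint[OF that]]
        integrable_continuous_mult[OF continuous_kernel(2)[OF z(1)] Vint[OF that]])+
  have Nx: "N $$ (a, b) = integral\<^sup>L M (\<lambda>t. 1 / (t - z) * V t $$ (a, b))" if "a < n" "b < n" for a b
  proof -
    have "N $$ (a, b) = integral\<^sup>L M (\<lambda>t. ck z V t $$ (a, b))" using that by (simp add: N_def mint_def)
    also have "\<dots> = integral\<^sup>L M (\<lambda>t. 1 / (t - z) * V t $$ (a, b))"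
      using carrier_matD[OF Vc] that by (intro integral_cong_circ) (simp add: ck_def)
    finally show ?thesis .
  qed
  have Dx: "D $$ (a, b) = integral\<^sup>L M (\<lambda>t. t / (t - z) * V t $$ (a, b))" if "a < n" "b < n" for a b
  proof -
    have "D $$ (a, b) = integral\<^sup>L M (\<lambda>t. sk z V t $$ (a, b))" using that by (simp add: D_def mint_def)
    also have "\<dots> = integral\<^sup>L M (\<lambda>t. t / (t - z) * V t $$ (a, b))"
      using carrier_matD[OF Vc] that by (intro integral_cong_circ) (simp add: sk_def)
    finally show ?thesis .
  qed
  have DN: "D $$ (a, b) - z * N $$ (a, b) = (if a = b then 1 else 0)" if ab: "a < n" "b < n" for a b
  proof -
    have "D $$ (a, b) - z * N $$ (a, b) = integral\<^sup>L M (\<lambda>t. t / (t - z) * V t $$ (a, b) - z * (1 / (t - z) * V t $$ (a, b)))"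
      unfolding Nx[OF ab] Dx[OF ab] using i1[OF ab] i2[OF ab]
      by (subst Bochner_Integration.integral_diff) (auto simp del: times_divide_eq_left)
    also have "\<dots> = integral\<^sup>L M (\<lambda>t. V t $$ (a, b))"
    proof (rule integral_cong_circ)
      fix t assume "t \<in> circ"
      from circ_neq[OF this z(1)] have "t / (t - z) - z * (1 / (t - z)) = 1"
        by (simp add: diff_divide_distrib[symmetric])
      then have "(t / (t - z) - z * (1 / (t - z))) * V t $$ (a, b) = V t $$ (a, b)" by simp
      then show "t / (t - z) * V t $$ (a, b) - z * (1 / (t - z) * V t $$ (a, b)) = V t $$ (a, b)"
        by (simp add: left_diff_distrib mult.assoc)
    qed
    also have "\<dots> = mat_int M n V $$ (a, b)" using ab by (simp add: mat_int_def)
    finally show ?thesis using ab by (simp add: one)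
  qed
  have Cx: "carath M V n z $$ (a, b) = D $$ (a, b) + z * N $$ (a, b)" if ab: "a < n" "b < n" for a b
  proof -
    have "carath M V n z $$ (a, b) = integral\<^sup>L M (\<lambda>t. (((t + z) / (t - z)) \<cdot>\<^sub>m V t) $$ (a, b))"
      using ab by (simp add: carath_def mat_int_def)
    also have "\<dots> = integral\<^sup>L M (\<lambda>t. t / (t - z) * V t $$ (a, b) + z * (1 / (t - z) * V t $$ (a, b)))"
      using carrier_matD[OF Vc] ab by (intro integral_cong_circ) (simp add: add_divide_distrib distrib_right)
    also have "\<dots> = D $$ (a, b) + z * N $$ (a, b)"
      unfolding Nx[OF ab] Dx[OF ab] using i1[OF ab] i2[OF ab]
      by (subst Bochner_Integration.integral_add) (auto simp del: times_divide_eq_left)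
    finally show ?thesis .
  qed
  have cd: "dim_row (carath M V n z) = n" "dim_col (carath M V n z) = n" by (simp_all add: carath_def mat_int_def)
  have 1: "carath M V n z - 1\<^sub>m n = (2 * z) \<cdot>\<^sub>m N"
    by (rule eq_matI) (use DN in \<open>auto simp: Cx cd algebra_simps\<close>)
  have 2: "carath M V n z + 1\<^sub>m n = 2 \<cdot>\<^sub>m D"
    by (rule eq_matI) (use DN in \<open>auto simp: Cx cd algebra_simps\<close>)
  have NF: "N = F * D" using rel by (simp add: N_def D_def)
  \<comment> \<open>Substituting N = F D into D - zN = 1 exhibits 1 - zF as the inverse of
    D.\<close>
  have "(1\<^sub>m n - z \<cdot>\<^sub>m F) * D = D - z \<cdot>\<^sub>m N" by (simp add: NF mat_algebra)
  also have "\<dots> = 1\<^sub>m n" by (rule eq_matI) (use DN in auto)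
  finally have E: "(1\<^sub>m n - z \<cdot>\<^sub>m F) * D = 1\<^sub>m n" .
  have cE: "1\<^sub>m n - z \<cdot>\<^sub>m F \<in> carrier_mat n n" "D \<in> carrier_mat n n" by (auto intro: carrier_matI)
  have E': "D * (1\<^sub>m n - z \<cdot>\<^sub>m F) = 1\<^sub>m n" by (rule mat_right_inverse_imp_left[OF cE E])
  have inv: "minv n (2 \<cdot>\<^sub>m D) = (1 / 2) \<cdot>\<^sub>m (1\<^sub>m n - z \<cdot>\<^sub>m F)"
  proof (rule minv_eq)
    show "2 \<cdot>\<^sub>m D * ((1 / 2) \<cdot>\<^sub>m (1\<^sub>m n - z \<cdot>\<^sub>m F)) = 1\<^sub>m n"
      using cE by (simp add: mat_smult_left mat_smult_right smult_smult_mat_eq E') (auto intro!: eq_matI)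
  qed (use cE in auto)
  have "((2 * z) \<cdot>\<^sub>m N) * ((1 / 2) \<cdot>\<^sub>m (1\<^sub>m n - z \<cdot>\<^sub>m F)) = z \<cdot>\<^sub>m (F * (D * (1\<^sub>m n - z \<cdot>\<^sub>m F)))"
    unfolding NF using cE by (simp add: mat_smult_left mat_smult_right smult_smult_mat_eq mat_assoc)
  also have "\<dots> = z \<cdot>\<^sub>m F" by (simp add: E' mat_one_right)
  finally show ?thesis
    unfolding 1 2 inv using z(2) by (simp add: smult_smult_mat_eq) (auto intro!: eq_matI)
qed

text \<open>For k = 0 both polynomials are 1, so \<open>Pk\<close> and \<open>Qk\<close> are the
  plain Cauchy integrals of the measure.\<close>

lemma schur_of_eq_fk: assumes z: "z \<in> ball 0 1" shows "schur_of M W d z = fk 0 z"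
  unfolding schur_of_def
proof (rule fill0_continuous[of 1])
  have RS: "R 0 = (\<lambda>t. 1\<^sub>m d)" "S 0 = (\<lambda>t. 1\<^sub>m d)"
    by (auto simp: R_def S_def Rlist_def Slist_def fun_eq_iff intro!: eq_matI)
  have VW: "integrable_mat d d W" using W_carrier integrable_W by (auto simp: integrable_mat_def)
  have one: "mat_int M d W = 1\<^sub>m d" using mm by (simp add: matrix_measure_def)
  show "isCont (\<lambda>z. fk 0 z $$ (a, b)) 0" if "a < d" "b < d" for a b
    by (rule mat_funD(2)[OF cont0_fk that])
  fix w assume w: "w \<in> ball (0::complex) 1" "w \<noteq> 0"
  then have w1: "cmod w < 1" by simp
  have "Pk 0 w = mint d d (ck w W)"
    unfolding Pk_def J_def RS by (intro mint_cong) (auto simp: ck_def mpow_def W_dims mat_smult_right mat_one_left mat_one_right intro!: eq_matI)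
  moreover have "Qk 0 w = mint d d (sk w W)"
    unfolding Qk_def J_def RS by (intro mint_cong) (auto simp: sk_def mpow_def W_dims mat_smult_right mat_one_left mat_one_right intro!: eq_matI)
  ultimately show "(1 / w) \<cdot>\<^sub>m ((carath M W d w - 1\<^sub>m d) * minv d (carath M W d w + 1\<^sub>m d)) = fk 0 w"
    using fk_Qk[OF w1, of 0] by (intro schur_of_value[OF VW one w1 w(2)] fk_dims[OF w1]) simp
qed (use z fk_dims[of 0 0] in auto)

text \<open>Divide the recursion for the moments by Q: the combination P - alpha Q yields the
  numerator f - alpha of the Schur step, and Q - adj(alpha) P yields its denominator.\<close>

lemma schur_step_fk:
  assumes g: "\<And>z. z \<in> ball 0 1 \<Longrightarrow> g z = fk k z" and z: "z \<in> ball 0 1"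
  shows "schur_step d g z = fk (Suc k) z"
  unfolding schur_step_eq
proof (rule fill0_continuous[of 1])
  show "isCont (\<lambda>z. fk (Suc k) z $$ (a, b)) 0" if "a < d" "b < d" for a b
    by (rule mat_funD(2)[OF cont0_fk that])
  have g0: "g 0 = alpha k" by (simp add: g fk_0)
  note f = szego_facts(13,14)[where k = k] and str = szego_step(1)[OF szego_inv[of k]]
  note rho = rho_props[OF str]
  have [simp]: "dim_row (alpha k) = d" "dim_col (alpha k) = d" using str by (auto simp: strict_contraction_def)
  note [simp] = pd_props(1,2,4,5)[OF rho(1)] pd_props(1,2,4,5)[OF rho(2)]
  fix w assume w: "w \<in> ball (0::complex) 1" "w \<noteq> 0"
  then have w1: "cmod w < 1" by simp
  let ?P = "Pk k w" and ?Q = "Qk k w" and ?P' = "Pk (Suc k) w" and ?Q' = "Qk (Suc k) w"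
  note [simp] = fk_dims[OF w1]
  have cm: "cfun d d (sk w (mpow 0))" by (rule cfun_sk[OF w1 cfun_mpow])
  have JT: "J d (\<lambda>t. t \<cdot>\<^sub>m R k t) (sk w (mpow 0)) = ?P"
    unfolding Pk_def by (rule J_shift_sk[OF f(1) w1 cfun_mpow])
  have Q': "rhoL d (alpha k) * ?Q' = ?Q - mat_adjoint (alpha k) * ?P"
    using Szego_J(2)[OF cm, of k] by (simp add: JT Qk_def)
  \<comment> \<open>The recursion supplies the pairing of R (k+1) with t/(t-w), whereas P' uses
    1/(t-w). The former is the Cauchy moment of order one, equal to w P', and accounts for the
    division by w in the Schur step.\<close>
  have "w \<cdot>\<^sub>m ?P' = J d (R (Suc k)) (ck w (mpow 1))" using Pk_mpow[OF w1, of 1 "Suc k"] by simp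
  also have "\<dots> = J d (R (Suc k)) (sk w (mpow 0))"
    by (intro J_cong refl) (simp add: ck_def sk_def mpow_def smult_smult_mat_eq)
  finally have wP': "w \<cdot>\<^sub>m ?P' = J d (R (Suc k)) (sk w (mpow 0))" .
  have P': "rhoR d (alpha k) * (w \<cdot>\<^sub>m ?P') = ?P - alpha k * ?Q"
    unfolding wP' using Szego_J(1)[OF cm, of k] by (simp add: JT Qk_def)
  note Qi = minv_inverse[OF PQ_dims(6) det_Qk[OF w1, of k]]
  note Qi' = minv_inverse[OF PQ_dims(6) det_Qk[OF w1, of "Suc k"]]
  have [simp]: "dim_row (minv d ?Q) = d" "dim_col (minv d ?Q) = d" "dim_row (minv d ?Q') = d" "dim_col (minv d ?Q') = d"
    using Qi(1) Qi'(1) by auto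
  define N where "N = 1\<^sub>m d - mat_adjoint (alpha k) * fk k w"
  have [simp]: "dim_row N = d" "dim_col N = d" by (auto simp: N_def)
  have NQ: "N * ?Q = rhoL d (alpha k) * ?Q'" unfolding Q' by (simp add: N_def mat_algebra fk_Qk[OF w1])
  have mN: "minv d N = ?Q * (minv d ?Q' * minv d (rhoL d (alpha k)))"
  proof (rule minv_eq)
    have "N * (?Q * (minv d ?Q' * minv d (rhoL d (alpha k)))) = rhoL d (alpha k) * ((?Q' * minv d ?Q') * minv d (rhoL d (alpha k)))"
      by (simp add: mat_assoc[symmetric] NQ)
    also have "\<dots> = 1\<^sub>m d" by (simp add: Qi'(2) mat_one_left pd_props[OF rho(1)])
    finally show "N * (?Q * (minv d ?Q' * minv d (rhoL d (alpha k)))) = 1\<^sub>m d" .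
  qed (auto intro!: carrier_matI)
  have "(fk k w - alpha k) * ?Q = rhoR d (alpha k) * (w \<cdot>\<^sub>m ?P')"
    unfolding P' by (simp add: mat_algebra fk_Qk[OF w1])
  then have fQ: "minv d (rhoR d (alpha k)) * ((fk k w - alpha k) * ?Q) = w \<cdot>\<^sub>m ?P'"
    using pd_cancel(2)[OF rho(2), of "w \<cdot>\<^sub>m ?P'"] by simp
  have "minv d (rhoR d (alpha k)) * (fk k w - alpha k) * minv d N * rhoL d (alpha k)
      = (minv d (rhoR d (alpha k)) * ((fk k w - alpha k) * ?Q)) * (minv d ?Q' * (minv d (rhoL d (alpha k)) * rhoL d (alpha k)))"
    unfolding mN by (simp add: mat_assoc)
  also have "\<dots> = w \<cdot>\<^sub>m fk (Suc k) w"
    unfolding fQ by (simp add: pd_props[OF rho(1)] mat_one_right mat_smult_left fk_def[of "Suc k"])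
  finally have "(1 / w) \<cdot>\<^sub>m (minv d (rhoR d (alpha k)) * (fk k w - alpha k) * minv d N * rhoL d (alpha k)) = fk (Suc k) w"
    using w(2) by (simp add: smult_smult_mat_eq) (auto intro!: eq_matI)
  then show "(1 / w) \<cdot>\<^sub>m (minv d (rhoR d (g 0)) * (g w - g 0) *
      minv d (1\<^sub>m d - mat_adjoint (g 0) * g w) * rhoL d (g 0)) = fk (Suc k) w"
    unfolding g0 g[OF w(1)] N_def .
qed (use z fk_dims[of 0 "Suc k"] in auto)

lemma schur_iterate_eq: "z \<in> ball 0 1 \<Longrightarrow> schur_iterate d M W k z = fk k z"
proof (induction k arbitrary: z)
  case 0
  then show ?case by (simp add: schur_iterate_def schur_iter_def schur_of_eq_fk)
next
  case (Suc k)
  have "schur_iterate d M W (Suc k) z = schur_step d (schur_iterate d M W k) z"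
    by (simp add: schur_iterate_def schur_iter_def)
  then show ?case using schur_step_fk[OF Suc.IH Suc.prems] by simp
qed

lemma verblunsky_eq: "verblunsky d M W k = alpha k"
  by (simp add: verblunsky_def schur_iterate_eq fk_0)

lemma alpha_strict: "strict_contraction d (alpha k)"
  by (rule szego_step(1)[OF szego_inv])

lemma inv_iterate_eq_inv_schur: "z \<in> ball 0 1 \<Longrightarrow> inv_iterate d M W j z = inv_schur d alpha j z"
proof -
  have v: "verblunsky d M W = alpha" by (rule ext) (rule verblunsky_eq)
  show "z \<in> ball 0 1 \<Longrightarrow> inv_iterate d M W j z = inv_schur d alpha j z"
    using inv_iterate_eq[of j d M W z] by (simp add: v alpha_strict)
qed

text \<open>If h is orthogonal to all polynomials of degree at most j, then J (R j) h = 0, and by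
  t/(t-z) = 1 + z/(t-z) the pairing of R j with t/(t-z) is z times that with 1/(t-z). This factor z
  makes the Szego recursion coincide with one inverse Schur step.\<close>

lemma left_relation:
  assumes z: "cmod z < 1" "z \<noteq> 0" and h: "cfun d m h" and orth: "\<And>i. i < j \<Longrightarrow> J m (mpow i) h = 0\<^sub>m d m"
  shows "J m (S j) (sk z h) = inv_schur d alpha j z * J m (R j) (sk z h)"
  using orth
proof (induction j)
  case 0
  have "R 0 = S 0" by (simp add: R_def S_def Rlist_def Slist_def)
  then show ?case by (simp add: mat_one_left)
next
  case (Suc j)
  define b where "b = inv_schur d alpha j z"
  have cb: "contraction d b" unfolding b_def using z by (intro inv_schur_contraction alpha_strict) simp
  interpret mobius_pair d "alpha j" b z using alpha_strict cb z by unfold_locales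
  note f = szego_facts[where k = j]
  note [simp] = pd_props(1,2,4,5)[OF rho(1)] pd_props(1,2,4,5)[OF rho(2)]
  let ?P = "J m (R j) (sk z h)" and ?Q = "J m (S j) (sk z h)" and ?T = "J m (R j) (ck z h)"
  let ?P' = "J m (R (Suc j)) (sk z h)" and ?Q' = "J m (S (Suc j)) (sk z h)"
  have QP: "?Q = b * ?P" unfolding b_def using Suc by simp
  have "J m (R j) h = J m (\<lambda>t. t ^ 0 \<cdot>\<^sub>m mpeval d (Rlist j) t) h"
    by (intro J_cong refl eq_matI) (auto simp: R_def)
  \<comment> \<open>R j has degree j and the induction step assumes orthogonality up to power j; the
    exceptional index \<open>Suc j\<close> lies outside the list.\<close>
  also have "\<dots> = (if Suc j < length (Rlist j) then mat_adjoint (Rlist j ! Suc j) * J m (mpow (0 + Suc j)) h else 0\<^sub>m d m)"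
    using f(1) Suc.prems by (intro J_mpow_mpeval[OF f(3) h]) auto
  finally have "J m (R j) h = 0\<^sub>m d m" using f(1) by simp
  then have PT: "?P = z \<cdot>\<^sub>m ?T" using sk_eq[OF z(1) f(13) h] by simp
  have JT: "J m (\<lambda>t. t \<cdot>\<^sub>m R j t) (sk z h) = ?T" by (rule J_shift_sk[OF f(13) z(1) h])
  note Sz = Szego_J[OF cfun_sk[OF z(1) h], of j, unfolded JT]
  \<comment> \<open>Inserting Q = bP and P = zT into the recursion for R (j+1) produces the
    denominator N, so that X will send P' to T.\<close>
  have NT: "rhoR d (alpha j) * ?P' = N * ?T"
    unfolding Sz(1) by (simp add: QP PT N_def mat_algebra)
  have XP: "X * ?P' = ?T"
  proof -
    have "X * ?P' = minv d N * (rhoR d (alpha j) * ?P')" by (simp add: X_def mat_assoc)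
    also have "\<dots> = (minv d N * N) * ?T" unfolding NT by (simp add: mat_assoc del: N_inverse(1,2))
    finally show ?thesis by (simp add: mat_one_left)
  qed
  have YP: "Y * ?P' = b * ?P" by (simp add: Y_def mat_smult_left mat_smult_right mat_assoc XP PT)
  \<comment> \<open>The claim is checked after multiplication by rhoL, where the square of the
    defect root and the intertwining can be used.\<close>
  have "rhoL d (alpha j) * (mobius d (alpha j) z b * ?P') = - (rhoL d (alpha j) * mat_adjoint (alpha j) * ?P') + rhoL d (alpha j) * rhoL d (alpha j) * (Y * ?P')"
    by (simp add: mobius_XY mat_algebra)
  also have "rhoL d (alpha j) * mat_adjoint (alpha j) * ?P' = mat_adjoint (alpha j) * (rhoR d (alpha j) * ?P')"
    by (simp add: rho(6) mat_assoc)
  also have "\<dots> = mat_adjoint (alpha j) * (?T - alpha j * ?Q)" by (simp add: Sz(1))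
  also have "- \<dots> + rhoL d (alpha j) * rhoL d (alpha j) * (Y * ?P') = ?Q - mat_adjoint (alpha j) * ?T"
    unfolding YP QP[symmetric] rho(3) by (simp add: mat_algebra) (rule eq_matI, simp_all del: index_mult_mat(1))
  also have "\<dots> = rhoL d (alpha j) * ?Q'" by (simp add: Sz(2))
  finally have "minv d (rhoL d (alpha j)) * (rhoL d (alpha j) * (mobius d (alpha j) z b * ?P')) = minv d (rhoL d (alpha j)) * (rhoL d (alpha j) * ?Q')"
    by simp
  then have "mobius d (alpha j) z b * ?P' = ?Q'" by (simp add: pd_cancel[OF rho(1)])
  then show ?case by (simp add: b_def)
qed

end

section \<open>Block CMV matrices\<close>

text \<open>The argument \<open>m\<close> is the number of columns, which an empty list would leave
  undetermined.\<close>

primrec stack :: "nat \<Rightarrow> complex mat list \<Rightarrow> complex mat" where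
  "stack m [] = 0\<^sub>m 0 m"
| "stack m (X # Xs) = append_rows X (stack m Xs)"

lemma append_rows_dim [simp]: "dim_row (append_rows U V) = dim_row U + dim_row V" "dim_col (append_rows U V) = dim_col U"
  by (simp_all add: append_rows_def)

lemma append_rows_index:
  "i < dim_row U + dim_row V \<Longrightarrow> j < dim_col U \<Longrightarrow> dim_col V = dim_col U \<Longrightarrow>
    append_rows U V $$ (i, j) = (if i < dim_row U then U $$ (i, j) else V $$ (i - dim_row U, j))"
  by (auto simp: append_rows_def)

lemma append_rows_assoc:
  "dim_col U = m \<Longrightarrow> dim_col V = m \<Longrightarrow> dim_col X = m \<Longrightarrow>
    append_rows (append_rows U V) X = append_rows U (append_rows V X)"
  by (rule eq_matI) (auto simp: append_rows_index)

lemma append_rows_empty: "dim_col U = m \<Longrightarrow> append_rows U (0\<^sub>m 0 m) = U" "dim_col U = m \<Longrightarrow> append_rows (0\<^sub>m 0 m) U = U"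
  by (rule eq_matI, auto simp: append_rows_index)+

lemma four_block_append:
  fixes A B C D U V :: "complex mat"
  assumes "A \<in> carrier_mat r1 c1" "B \<in> carrier_mat r1 c2" "C \<in> carrier_mat r2 c1" "D \<in> carrier_mat r2 c2"
    "U \<in> carrier_mat c1 m" "V \<in> carrier_mat c2 m"
  shows "four_block_mat A B C D * append_rows U V = append_rows (A * U + B * V) (C * U + D * V)"
proof -
  have "four_block_mat A B C D * append_rows U V = four_block_mat (A * U + B * V) (A * 0\<^sub>m c1 0 + B * 0\<^sub>m c2 0)
      (C * U + D * V) (C * 0\<^sub>m c1 0 + D * 0\<^sub>m c2 0)"
    unfolding append_rows_def carrier_matD(1)[OF assms(5)] carrier_matD(1)[OF assms(6)]
    by (rule mult_four_block_mat[OF assms(1-5) zero_carrier_mat assms(6) zero_carrier_mat])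
  also have "\<dots> = append_rows (A * U + B * V) (C * U + D * V)"
    unfolding append_rows_def using assms by (intro arg_cong2[where f = "\<lambda>x y. four_block_mat (A * U + B * V) x (C * U + D * V) y"]) auto
  finally show ?thesis .
qed

lemma dsum_append:
  fixes A B U V :: "complex mat"
  assumes "A \<in> carrier_mat r1 c1" "B \<in> carrier_mat r2 c2" "U \<in> carrier_mat c1 m" "V \<in> carrier_mat c2 m"
  shows "dsum A B * append_rows U V = append_rows (A * U) (B * V)"
proof -
  have "dsum A B * append_rows U V = append_rows (A * U + 0\<^sub>m r1 c2 * V) (0\<^sub>m r2 c1 * U + B * V)"
    unfolding dsum_def using assms by (subst four_block_append[of A r1 c1 _ c2 _ r2 B U m V]) auto
  also have "A * U + 0\<^sub>m r1 c2 * V = A * U" using assms by (auto simp: zero_mat_left intro!: eq_matI)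
  also have "0\<^sub>m r2 c1 * U + B * V = B * V" using assms by (auto simp: zero_mat_left intro!: eq_matI)
  finally show ?thesis .
qed

lemma dsum_dim [simp]: "dim_row (dsum A B) = dim_row A + dim_row B" "dim_col (dsum A B) = dim_col A + dim_col B"
  by (simp_all add: dsum_def)

lemma dsum_carrier: "A \<in> carrier_mat r1 c1 \<Longrightarrow> B \<in> carrier_mat r2 c2 \<Longrightarrow> dsum A B \<in> carrier_mat (r1 + r2) (c1 + c2)"
  by (auto intro: carrier_matI)

lemma mat_adjoint_four_block:
  fixes A B C D :: "complex mat"
  assumes "A \<in> carrier_mat r1 c1" "B \<in> carrier_mat r1 c2" "C \<in> carrier_mat r2 c1" "D \<in> carrier_mat r2 c2"
  shows "mat_adjoint (four_block_mat A B C D) = four_block_mat (mat_adjoint A) (mat_adjoint C) (mat_adjoint B) (mat_adjoint D)"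
  by (rule eq_matI) (use assms in auto)

lemma mat_adjoint_dsum: "mat_adjoint (dsum A B) = dsum (mat_adjoint A) (mat_adjoint B)"
  unfolding dsum_def
  by (subst mat_adjoint_four_block[of _ "dim_row A" "dim_col A" _ "dim_col B" _ "dim_row B"]) auto

lemma stack_carrier: "(\<And>X. X \<in> set Xs \<Longrightarrow> X \<in> carrier_mat d m) \<Longrightarrow> stack m Xs \<in> carrier_mat (length Xs * d) m"
proof (induction Xs)
  case (Cons X Xs)
  then have "stack m Xs \<in> carrier_mat (length Xs * d) m" "X \<in> carrier_mat d m" by auto
  then show ?case by (auto intro!: carrier_matI)
qed simp

lemma stack_upt_carrier: "(\<And>r. X r \<in> carrier_mat d m) \<Longrightarrow> stack m (map X [i..<j]) \<in> carrier_mat ((j - i) * d) m"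
  using stack_carrier[of "map X [i..<j]" d m] by auto

lemma stack_append: "(\<And>X. X \<in> set Xs \<Longrightarrow> dim_col X = m) \<Longrightarrow> (\<And>Y. Y \<in> set Ys \<Longrightarrow> dim_col Y = m) \<Longrightarrow>
    stack m (Xs @ Ys) = append_rows (stack m Xs) (stack m Ys)"
proof (induction Xs)
  case Nil
  have "dim_col (stack m Ys) = m" using Nil by (cases Ys) auto
  then show ?case by (simp add: append_rows_empty)
next
  case (Cons X Xs)
  have "dim_col (stack m Ys) = m" "dim_col (stack m Xs) = m"
    using Cons.prems by (cases Ys, auto, cases Xs, auto)
  then show ?case using Cons by (simp add: append_rows_assoc[of _ m])
qed

lemma stack_index:
  assumes "\<And>X. X \<in> set Xs \<Longrightarrow> X \<in> carrier_mat d m" "a < length Xs * d" "b < m"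
  shows "stack m Xs $$ (a, b) = Xs ! (a div d) $$ (a mod d, b)"
  using assms
proof (induction Xs arbitrary: a)
  case (Cons X Xs)
  have d: "d > 0" using Cons.prems(2) by (cases d) auto
  have c: "X \<in> carrier_mat d m" "stack m Xs \<in> carrier_mat (length Xs * d) m"
    using Cons.prems(1) by (auto intro: stack_carrier)
  have idx: "stack m (X # Xs) $$ (a, b) = (if a < d then X $$ (a, b) else stack m Xs $$ (a - d, b))"
    using carrier_matD[OF c(1)] carrier_matD[OF c(2)] Cons.prems(2,3) by (simp add: append_rows_index)
  show ?case
  proof (cases "a < d")
    case True
    then show ?thesis using idx by simp
  next
    case False
    then have "a div d = Suc ((a - d) div d)" "a mod d = (a - d) mod d"
      using d by (simp_all add: le_div_geq le_mod_geq)
    moreover have "stack m Xs $$ (a - d, b) = Xs ! ((a - d) div d) $$ ((a - d) mod d, b)"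
      using False Cons.prems by (intro Cons.IH) auto
    ultimately show ?thesis using idx False by simp
  qed
qed simp

text \<open>The two rows of adj(Theta a) acting on the pair X r, X (r+1), stated index by index so
  that the pairs of a direct sum can be treated separately.\<close>

definition theta_rel :: "nat \<Rightarrow> complex mat \<Rightarrow> (nat \<Rightarrow> complex mat) \<Rightarrow> (nat \<Rightarrow> complex mat) \<Rightarrow> nat \<Rightarrow> bool" where
  "theta_rel d a X Y r \<longleftrightarrow> Y r = a * X r + rhoR d a * X (Suc r) \<and>
     Y (Suc r) = rhoL d a * X r - mat_adjoint a * X (Suc r)"

lemma Theta_carrier: "a \<in> carrier_mat d d \<Longrightarrow> strict_contraction d a \<Longrightarrow> Theta d a \<in> carrier_mat (d + d) (d + d)"
  unfolding Theta_def by (auto intro!: carrier_matI)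

lemma strict_carrier: "strict_contraction d a \<Longrightarrow> a \<in> carrier_mat d d"
  by (simp add: strict_contraction_def)

lemma Theta_adjoint_append:
  assumes a: "strict_contraction d a" and X: "X r \<in> carrier_mat d m" "X (Suc r) \<in> carrier_mat d m"
    and rel: "theta_rel d a X Y r"
  shows "mat_adjoint (Theta d a) * append_rows (X r) (X (Suc r)) = append_rows (Y r) (Y (Suc r))"
proof -
  have c: "a \<in> carrier_mat d d" by (rule strict_carrier[OF a])
  note rho = rho_props[OF a]
  have cr: "rhoL d a \<in> carrier_mat d d" "rhoR d a \<in> carrier_mat d d"
    using pd_matD(1)[OF rho(1)] pd_matD(1)[OF rho(2)] by auto
  have "mat_adjoint (Theta d a) = four_block_mat a (rhoR d a) (rhoL d a) (- mat_adjoint a)"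
    unfolding Theta_def rhoL_def[symmetric] rhoR_def[symmetric] using c cr
    by (subst mat_adjoint_four_block[of _ d d _ d _ d])
       (auto simp: pd_props(3)[OF rho(1)] pd_props(3)[OF rho(2)] mat_adj)
  also have "\<dots> * append_rows (X r) (X (Suc r)) =
      append_rows (a * X r + rhoR d a * X (Suc r)) (rhoL d a * X r + - mat_adjoint a * X (Suc r))"
    using c cr X by (intro four_block_append[of _ d d _ d _ d]) auto
  also have "rhoL d a * X r + - mat_adjoint a * X (Suc r) = rhoL d a * X r - mat_adjoint a * X (Suc r)"
    using c cr X by (simp add: mat_uminus_left) (rule eq_matI, simp_all del: index_mult_mat(1))
  finally show ?thesis using rel by (simp add: theta_rel_def)
qed

text \<open>The offset \<open>c\<close> covers both factors: c = 0 for pairs starting at even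
  indices, c = 1 for pairs starting at odd ones. It stays arbitrary in the induction because
  removing a block shifts it by two.\<close>

lemma dsum_list_Theta_dim:
  assumes "\<And>i. strict_contraction d (\<beta> i)"
  shows "dsum_list (map (\<lambda>i. Theta d (\<beta> (c + 2 * i))) [0..<q]) \<in> carrier_mat (2 * q * d) (2 * q * d)"
proof (induction q arbitrary: c)
  case 0
  show ?case by (simp add: dsum_list_def)
next
  case (Suc q)
  have "dsum_list (map (\<lambda>i. Theta d (\<beta> (c + 2 * i))) [0..<Suc q]) =
     dsum (Theta d (\<beta> c)) (dsum_list (map (\<lambda>i. Theta d (\<beta> (Suc (Suc c) + 2 * i))) [0..<q]))"
    by (simp add: dsum_list_def upt_conv_Cons map_Suc_upt[symmetric] o_def del: upt_Suc)
  also have "\<dots> \<in> carrier_mat ((d + d) + 2 * q * d) ((d + d) + 2 * q * d)"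
    by (intro dsum_carrier Theta_carrier assms strict_carrier Suc.IH)
  finally show ?case by (simp add: algebra_simps)
qed

lemma dsum_list_Theta_stack:
  assumes \<beta>: "\<And>i. strict_contraction d (\<beta> i)" and X: "\<And>r. X r \<in> carrier_mat d m" and Y: "\<And>r. Y r \<in> carrier_mat d m"
    and rel: "\<And>i. i < q \<Longrightarrow> theta_rel d (\<beta> (c + 2 * i)) X Y (c + 2 * i)"
  shows "mat_adjoint (dsum_list (map (\<lambda>i. Theta d (\<beta> (c + 2 * i))) [0..<q])) * stack m (map X [c..<c + 2 * q]) =
    stack m (map Y [c..<c + 2 * q])"
  using rel
proof (induction q arbitrary: c)
  case 0
  show ?case by (simp add: dsum_list_def)
next
  case (Suc q)
  let ?D = "dsum_list (map (\<lambda>i. Theta d (\<beta> (Suc (Suc c) + 2 * i))) [0..<q])"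
  have D: "?D \<in> carrier_mat (2 * q * d) (2 * q * d)" by (rule dsum_list_Theta_dim[OF \<beta>])
  have eq: "dsum_list (map (\<lambda>i. Theta d (\<beta> (c + 2 * i))) [0..<Suc q]) = dsum (Theta d (\<beta> c)) ?D"
    by (simp add: dsum_list_def upt_conv_Cons map_Suc_upt[symmetric] o_def del: upt_Suc)
  have upt: "[c..<c + 2 * Suc q] = c # Suc c # [Suc (Suc c)..<Suc (Suc c) + 2 * q]"
    by (simp add: upt_conv_Cons)
  have st: "stack m (map Z [c..<c + 2 * Suc q]) = append_rows (append_rows (Z c) (Z (Suc c))) (stack m (map Z [Suc (Suc c)..<Suc (Suc c) + 2 * q]))"
    and stc: "stack m (map Z [Suc (Suc c)..<Suc (Suc c) + 2 * q]) \<in> carrier_mat (2 * q * d) m"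
    if Z: "\<And>r. Z r \<in> carrier_mat d m" for Z
  proof -
    show 1: "stack m (map Z [Suc (Suc c)..<Suc (Suc c) + 2 * q]) \<in> carrier_mat (2 * q * d) m"
      using stack_upt_carrier[where X = Z and d = d and m = m and i = "Suc (Suc c)" and j = "Suc (Suc c) + 2 * q", OF Z]
      unfolding diff_add_inverse .
    show "stack m (map Z [c..<c + 2 * Suc q]) = append_rows (append_rows (Z c) (Z (Suc c))) (stack m (map Z [Suc (Suc c)..<Suc (Suc c) + 2 * q]))"
      unfolding upt using carrier_matD[OF Z] carrier_matD[OF 1] by (simp add: append_rows_assoc[of _ m])
  qed
  have Xc: "append_rows (X c) (X (Suc c)) \<in> carrier_mat (d + d) m"
    using carrier_matD[OF X] by (intro carrier_matI) auto
  have "mat_adjoint (dsum (Theta d (\<beta> c)) ?D) * stack m (map X [c..<c + 2 * Suc q]) =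
     append_rows (mat_adjoint (Theta d (\<beta> c)) * append_rows (X c) (X (Suc c)))
       (mat_adjoint ?D * stack m (map X [Suc (Suc c)..<Suc (Suc c) + 2 * q]))"
    unfolding mat_adjoint_dsum st[OF X]
    by (rule dsum_append[OF mat_adjoint_carrier[OF Theta_carrier[OF strict_carrier[OF \<beta>] \<beta>]] mat_adjoint_carrier[OF D] Xc stc[OF X]])
  also have "mat_adjoint (Theta d (\<beta> c)) * append_rows (X c) (X (Suc c)) = append_rows (Y c) (Y (Suc c))"
  proof (rule Theta_adjoint_append[OF \<beta> X X])
    show "theta_rel d (\<beta> c) X Y c" using Suc.prems[of 0] by simp
  qed
  also have "mat_adjoint ?D * stack m (map X [Suc (Suc c)..<Suc (Suc c) + 2 * q]) = stack m (map Y [Suc (Suc c)..<Suc (Suc c) + 2 * q])"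
  proof (rule Suc.IH)
    fix i assume "i < q"
    then show "theta_rel d (\<beta> (Suc (Suc c) + 2 * i)) X Y (Suc (Suc c) + 2 * i)" using Suc.prems[of "Suc i"] by simp
  qed
  finally show ?case unfolding eq st[OF Y] .
qed

abbreviation stk :: "nat \<Rightarrow> nat \<Rightarrow> (nat \<Rightarrow> complex mat) \<Rightarrow> complex mat" where
  "stk m n X \<equiv> stack m (map X [0..<Suc n])"

lemma stack_single: "X \<in> carrier_mat d m \<Longrightarrow> stack m [X] = X"
  by (simp add: append_rows_empty)

lemma stack_first:
  "stk m n Z = append_rows (Z 0) (stack m (map Z [1..<Suc n]))"
  by (simp add: upt_conv_Cons del: upt_Suc)

lemma stack_last:
  assumes "\<And>r. Z r \<in> carrier_mat d m" "i \<le> k"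
  shows "stack m (map Z [i..<Suc k]) = append_rows (stack m (map Z [i..<k])) (Z k)"
proof -
  have "stack m (map Z [i..<k] @ [Z k]) = append_rows (stack m (map Z [i..<k])) (stack m [Z k])"
    by (intro stack_append) (auto simp: carrier_matD(2)[OF assms(1)])
  then show ?thesis using assms(2) by (simp only: upt_Suc_append map_append list.map stack_single[OF assms(1)])
qed

lemma LN_carrier: assumes "\<And>i. strict_contraction d (\<beta> i)" shows "LN d \<beta> n \<in> carrier_mat (Suc n * d) (Suc n * d)"
proof -
  have D: "dsum_list (map (\<lambda>i. Theta d (\<beta> (2 * i))) [0..<(n + 1) div 2]) \<in> carrier_mat (2 * ((n + 1) div 2) * d) (2 * ((n + 1) div 2) * d)"
    using dsum_list_Theta_dim[where \<beta> = \<beta> and c = 0, OF assms] by simp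
  show ?thesis
  proof (cases "even n")
    case True
    then have "2 * ((n + 1) div 2) = n" by simp
    then show ?thesis using dsum_carrier[OF D one_carrier_mat[of d]] True by (simp add: LN_def add.commute)
  next
    case False
    then have "2 * ((n + 1) div 2) = Suc n" by (simp add: odd_two_times_div_two_succ)
    then show ?thesis using dsum_carrier[OF D zero_carrier_mat[of 0 0]] False by (simp add: LN_def)
  qed
qed

lemma MN_carrier: assumes "\<And>i. strict_contraction d (\<beta> i)" shows "MN d \<beta> n \<in> carrier_mat (Suc n * d) (Suc n * d)"
proof -
  have D: "dsum_list (map (\<lambda>i. Theta d (\<beta> (2 * i + 1))) [0..<n div 2]) \<in> carrier_mat (2 * (n div 2) * d) (2 * (n div 2) * d)"
    using dsum_list_Theta_dim[where \<beta> = \<beta> and c = 1, OF assms] by (simp add: add.commute)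
  show ?thesis
  proof (cases "even n")
    case True
    then have "2 * (n div 2) = n" by simp
    then show ?thesis using dsum_carrier[OF one_carrier_mat[of d] dsum_carrier[OF D zero_carrier_mat[of 0 0]]] True
      by (simp add: MN_def)
  next
    case False
    then have n: "Suc (2 * (n div 2)) = n" by (simp add: odd_two_times_div_two_succ)
    have "Suc n * d = Suc (Suc (2 * (n div 2))) * d" by (simp only: n)
    then have "d + (2 * (n div 2) * d + d) = Suc n * d" by simp
    then show ?thesis using dsum_carrier[OF one_carrier_mat[of d] dsum_carrier[OF D one_carrier_mat[of d]]] False
      by (simp add: MN_def)
  qed
qed

text \<open>The blocks pair the indices (0,1), (2,3), and so on; for even n the last index is left
  alone and meets an identity block, hence the hypothesis on it.\<close>

lemma LN_stack:
  assumes \<beta>: "\<And>i. strict_contraction d (\<beta> i)" and X: "\<And>r. X r \<in> carrier_mat d m" and Y: "\<And>r. Y r \<in> carrier_mat d m"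
    and rel: "\<And>r. r < n \<Longrightarrow> even r \<Longrightarrow> theta_rel d (\<beta> r) X Y r" and last: "even n \<Longrightarrow> Y n = X n"
  shows "mat_adjoint (LN d \<beta> n) * stk m n X = stk m n Y"
proof -
  let ?q = "(n + 1) div 2"
  let ?D = "dsum_list (map (\<lambda>i. Theta d (\<beta> (2 * i))) [0..<?q])"
  have D: "?D \<in> carrier_mat (2 * ?q * d) (2 * ?q * d)" using dsum_list_Theta_dim[where \<beta> = \<beta> and c = 0, OF \<beta>] by simp
  have DX: "mat_adjoint ?D * stack m (map X [0..<2 * ?q]) = stack m (map Y [0..<2 * ?q])"
    using dsum_list_Theta_stack[where \<beta> = \<beta> and X = X and Y = Y and q = ?q and c = 0, OF \<beta> X Y] rel by auto
  have cX: "stack m (map X [0..<2 * ?q]) \<in> carrier_mat (2 * ?q * d) m"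
    using stack_upt_carrier[where X = X and d = d and m = m, OF X, where i = 0 and j = "2 * ?q"] by simp
  show ?thesis
  proof (cases "even n")
    case True
    then have q: "2 * ?q = n" by simp
    have s: "stk m n Z = append_rows (stack m (map Z [0..<n])) (Z n)" if "\<And>r. Z r \<in> carrier_mat d m" for Z
      by (rule stack_last[where Z = Z and d = d and m = m, OF that]) simp
    have H: "mat_adjoint (LN d \<beta> n) * stk m n X = append_rows (mat_adjoint ?D * stack m (map X [0..<n])) (1\<^sub>m d * X n)"
    proof -
      have E: "mat_adjoint (LN d \<beta> n) = dsum (mat_adjoint ?D) (1\<^sub>m d)" using True by (simp add: LN_def mat_adjoint_dsum)
      show ?thesis unfolding E s[OF X] by (rule dsum_append[OF mat_adjoint_carrier[OF D[unfolded q]] one_carrier_mat cX[unfolded q] X])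
    qed
    have "1\<^sub>m d * X n = Y n" using last[OF True] X[of n] by simp
    then show ?thesis unfolding H DX[unfolded q] s[where Z = Y, OF Y] by (simp only:)
  next
    case False
    then have q: "2 * ?q = Suc n" by (simp add: odd_two_times_div_two_succ)
    have s: "stk m n Z = append_rows (stack m (map Z [0..<2 * ?q])) (0\<^sub>m 0 m)" if "\<And>r. Z r \<in> carrier_mat d m" for Z
      unfolding q using carrier_matD(2)[OF stack_upt_carrier[where X = Z and d = d and m = m, OF that]] by (simp add: append_rows_empty del: upt_Suc)
    have H: "mat_adjoint (LN d \<beta> n) * stk m n X = append_rows (mat_adjoint ?D * stack m (map X [0..<2 * ?q])) (0\<^sub>m 0 0 * 0\<^sub>m 0 m)"
    proof -
      have E: "mat_adjoint (LN d \<beta> n) = dsum (mat_adjoint ?D) (0\<^sub>m 0 0)" using False by (simp add: LN_def mat_adjoint_dsum)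
      show ?thesis unfolding E s[OF X] by (rule dsum_append[OF mat_adjoint_carrier[OF D] zero_carrier_mat cX zero_carrier_mat])
    qed
    have "0\<^sub>m 0 0 * 0\<^sub>m 0 m = (0\<^sub>m 0 m :: complex mat)" by (rule eq_matI) auto
    then show ?thesis unfolding H DX s[where Z = Y, OF Y] by (simp only:)
  qed
qed

text \<open>Here the pairs are (1,2), (3,4), and so on, so index 0 is always alone, and for odd n
  the last index is alone too.\<close>

lemma MN_stack:
  assumes \<beta>: "\<And>i. strict_contraction d (\<beta> i)" and X: "\<And>r. X r \<in> carrier_mat d m" and Y: "\<And>r. Y r \<in> carrier_mat d m"
    and rel: "\<And>r. r < n \<Longrightarrow> odd r \<Longrightarrow> theta_rel d (\<beta> r) X Y r" and first: "Y 0 = X 0" and last: "odd n \<Longrightarrow> Y n = X n"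
  shows "mat_adjoint (MN d \<beta> n) * stk m n X = stk m n Y"
proof -
  let ?q = "n div 2"
  let ?D = "dsum_list (map (\<lambda>i. Theta d (\<beta> (2 * i + 1))) [0..<?q])"
  have D: "?D \<in> carrier_mat (2 * ?q * d) (2 * ?q * d)" using dsum_list_Theta_dim[where \<beta> = \<beta> and c = 1, OF \<beta>] by (simp add: add.commute)
  have DX: "mat_adjoint ?D * stack m (map X [1..<1 + 2 * ?q]) = stack m (map Y [1..<1 + 2 * ?q])"
    using dsum_list_Theta_stack[where \<beta> = \<beta> and X = X and Y = Y and q = ?q and c = 1, OF \<beta> X Y] rel by (simp add: add.commute)
  have cX: "stack m (map X [1..<1 + 2 * ?q]) \<in> carrier_mat (2 * ?q * d) m"
    using stack_upt_carrier[where X = X and d = d and m = m, OF X, where i = 1 and j = "1 + 2 * ?q"] by simp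
  have s0: "stk m n Z = append_rows (Z 0) (stack m (map Z [1..<Suc n]))" if "\<And>r. Z r \<in> carrier_mat d m" for Z
    by (rule stack_first)
  show ?thesis
  proof (cases "even n")
    case False
    then have q: "1 + 2 * ?q = n" by (simp add: odd_two_times_div_two_succ)
    have s: "stk m n Z = append_rows (Z 0) (append_rows (stack m (map Z [1..<n])) (Z n))" if "\<And>r. Z r \<in> carrier_mat d m" for Z
      unfolding s0[OF that] using q by (subst stack_last[where Z = Z and d = d and m = m, OF that]) auto
    have c1: "append_rows (stack m (map X [1..<n])) (X n) \<in> carrier_mat (2 * ?q * d + d) m"
      using carrier_matD[OF cX[unfolded q]] carrier_matD[OF X] by (intro carrier_matI) auto
    have H: "mat_adjoint (MN d \<beta> n) * stk m n X = append_rows (1\<^sub>m d * X 0)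
        (append_rows (mat_adjoint ?D * stack m (map X [1..<n])) (1\<^sub>m d * X n))"
    proof -
      have E: "mat_adjoint (MN d \<beta> n) = dsum (1\<^sub>m d) (dsum (mat_adjoint ?D) (1\<^sub>m d))" using False by (simp add: MN_def mat_adjoint_dsum)
      show ?thesis unfolding E s[OF X] dsum_append[OF one_carrier_mat dsum_carrier[OF mat_adjoint_carrier[OF D] one_carrier_mat] X c1]
        dsum_append[OF mat_adjoint_carrier[OF D] one_carrier_mat cX[unfolded q] X] ..
    qed
    have "1\<^sub>m d * X n = Y n" "1\<^sub>m d * X 0 = Y 0" using last[OF False] first X[of n] X[of 0] by simp_all
    then show ?thesis unfolding H DX[unfolded q] s[where Z = Y, OF Y] by (simp only:)
  next
    case True
    then have q: "1 + 2 * ?q = Suc n" by simp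
    have s: "stk m n Z = append_rows (Z 0) (append_rows (stack m (map Z [1..<1 + 2 * ?q])) (0\<^sub>m 0 m))" if "\<And>r. Z r \<in> carrier_mat d m" for Z
      unfolding q s0[OF that] using carrier_matD(2)[OF stack_upt_carrier[where X = Z and d = d and m = m, OF that]] by (simp add: append_rows_empty del: upt_Suc)
    have c1: "append_rows (stack m (map X [1..<1 + 2 * ?q])) (0\<^sub>m 0 m) \<in> carrier_mat (2 * ?q * d + 0) m"
      using carrier_matD[OF cX] by (intro carrier_matI) auto
    have H: "mat_adjoint (MN d \<beta> n) * stk m n X = append_rows (1\<^sub>m d * X 0)
        (append_rows (mat_adjoint ?D * stack m (map X [1..<1 + 2 * ?q])) (0\<^sub>m 0 0 * 0\<^sub>m 0 m))"
    proof -
      have E: "mat_adjoint (MN d \<beta> n) = dsum (1\<^sub>m d) (dsum (mat_adjoint ?D) (0\<^sub>m 0 0))" using True by (simp add: MN_def mat_adjoint_dsum)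
      show ?thesis unfolding E s[OF X] dsum_append[OF one_carrier_mat dsum_carrier[OF mat_adjoint_carrier[OF D] zero_carrier_mat] X c1]
        dsum_append[OF mat_adjoint_carrier[OF D] zero_carrier_mat cX zero_carrier_mat] ..
    qed
    have "1\<^sub>m d * X 0 = Y 0" "0\<^sub>m 0 0 * 0\<^sub>m 0 m = (0\<^sub>m 0 m :: complex mat)"
      using first X[of 0] by (simp, intro eq_matI, auto)
    then show ?thesis unfolding H DX s[where Z = Y, OF Y] by (simp only:)
  qed
qed

lemma dsum_first_stack:
  assumes b: "b \<in> carrier_mat d d" and X: "\<And>r. X r \<in> carrier_mat d m"
  shows "dsum b (1\<^sub>m (n * d)) * stk m n X = stk m n (X(0 := b * X 0))"
proof -
  have X': "(X(0 := b * X 0)) r \<in> carrier_mat d m" for r using X mult_carrier_mat[OF b X[of 0]] by auto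
  have s0: "stk m n Z = append_rows (Z 0) (stack m (map Z [1..<Suc n]))" if "\<And>r. Z r \<in> carrier_mat d m" for Z
    by (rule stack_first)
  have c: "stack m (map X [1..<Suc n]) \<in> carrier_mat (n * d) m" using stack_upt_carrier[where X = X and d = d and m = m, OF X, where i = 1 and j = "Suc n"] by simp
  have "map (X(0 := b * X 0)) [1..<Suc n] = map X [1..<Suc n]" by (intro map_cong) auto
  then have "stk m n (X(0 := b * X 0)) = append_rows (b * X 0) (stack m (map X [1..<Suc n]))"
    unfolding s0[OF X'] by (simp only: fun_upd_same)
  then show ?thesis
    unfolding s0[OF X] dsum_append[OF b one_carrier_mat X c] using carrier_matD[OF c] by (simp only: mat_one_left)
qed

lemma dsum_last_stack:
  assumes f: "f \<in> carrier_mat d d" and X: "\<And>r. X r \<in> carrier_mat d m"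
  shows "dsum (1\<^sub>m (n * d)) f * stk m n X = stk m n (X(n := f * X n))"
proof -
  have X': "(X(n := f * X n)) r \<in> carrier_mat d m" for r using X mult_carrier_mat[OF f X[of n]] by auto
  have s0: "stk m n Z = append_rows (stack m (map Z [0..<n])) (Z n)" if "\<And>r. Z r \<in> carrier_mat d m" for Z
    by (rule stack_last[where Z = Z and d = d and m = m, OF that]) simp
  have c: "stack m (map X [0..<n]) \<in> carrier_mat (n * d) m" using stack_upt_carrier[where X = X and d = d and m = m, OF X, where i = 0 and j = n] by simp
  have "map (X(n := f * X n)) [0..<n] = map X [0..<n]" by (intro map_cong) auto
  then have "stk m n (X(n := f * X n)) = append_rows (stack m (map X [0..<n])) (f * X n)"
    unfolding s0[OF X'] by (simp only: fun_upd_same)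
  then show ?thesis
    unfolding s0[OF X] dsum_append[OF one_carrier_mat f c X] using carrier_matD[OF c] by (simp only: mat_one_left)
qed

lemma dsum_both_stack:
  assumes b: "b \<in> carrier_mat d d" and f: "f \<in> carrier_mat d d" and X: "\<And>r. X r \<in> carrier_mat d m" and n: "n > 0"
  shows "dsum (dsum b (1\<^sub>m ((n - 1) * d))) f * stk m n X = stk m n (X(0 := b * X 0, n := f * X n))"
proof -
  obtain n' where n': "n = Suc n'" using n by (cases n) auto
  have X': "(X(0 := b * X 0)) r \<in> carrier_mat d m" and X'': "(X(0 := b * X 0, n := f * X n)) r \<in> carrier_mat d m" for r
    using X mult_carrier_mat[OF b X[of 0]] mult_carrier_mat[OF f X[of n]] by auto
  have s0: "stk m n Z = append_rows (stk m n' Z) (Z n)" if "\<And>r. Z r \<in> carrier_mat d m" for Z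
    unfolding n' by (rule stack_last[where Z = Z and d = d and m = m, OF that]) simp
  have c: "stk m n' X \<in> carrier_mat (d + n' * d) m" using stack_upt_carrier[where X = X and d = d and m = m, OF X, where i = 0 and j = "Suc n'"] by simp
  have cb: "dsum b (1\<^sub>m (n' * d)) \<in> carrier_mat (d + n' * d) (d + n' * d)" by (rule dsum_carrier[OF b one_carrier_mat])
  have e: "map (X(0 := b * X 0, n := f * X n)) [0..<Suc n'] = map (X(0 := b * X 0)) [0..<Suc n']" by (intro map_cong) (auto simp: n')
  show ?thesis
    unfolding s0[where Z = X, OF X] s0[where Z = "X(0 := b * X 0, n := f * X n)", OF X''] e unfolding n' diff_Suc_1 dsum_append[OF cb f c X] dsum_first_stack[OF b X]
    by simp
qed

text \<open>The flag \<open>e\<close> says whether the first pair of indices belongs to the factor \<open>L\<close> (that is, \<open>j + p\<close> is even below).\<close>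

definition cmv_rhs :: "nat \<Rightarrow> (nat \<Rightarrow> complex mat) \<Rightarrow> bool \<Rightarrow> nat \<Rightarrow> complex mat \<Rightarrow> complex mat \<Rightarrow> complex mat" where
  "cmv_rhs d \<beta> e n b f =
    (if e then
       (if even n then dsum b (1\<^sub>m (n * d)) * mat_adjoint (CN d \<beta> n) * dsum (1\<^sub>m (n * d)) f
        else dsum (dsum b (1\<^sub>m ((n - 1) * d))) f * mat_adjoint (CN d \<beta> n))
     else
       (if even n then dsum (1\<^sub>m (n * d)) f * mat_adjoint (CNhat d \<beta> n) * dsum b (1\<^sub>m (n * d))
        else mat_adjoint (CNhat d \<beta> n) * dsum (dsum b (1\<^sub>m ((n - 1) * d))) f))"

lemma dsum_dims_Suc:
  assumes "b \<in> carrier_mat d d" "f \<in> carrier_mat d d"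
  shows "dsum b (1\<^sub>m (n * d)) \<in> carrier_mat (Suc n * d) (Suc n * d)" "dsum (1\<^sub>m (n * d)) f \<in> carrier_mat (Suc n * d) (Suc n * d)"
    "n > 0 \<Longrightarrow> dsum (dsum b (1\<^sub>m ((n - 1) * d))) f \<in> carrier_mat (Suc n * d) (Suc n * d)"
proof -
  show "dsum b (1\<^sub>m (n * d)) \<in> carrier_mat (Suc n * d) (Suc n * d)"
    using dsum_carrier[OF assms(1) one_carrier_mat[of "n * d"]] by simp
  show "dsum (1\<^sub>m (n * d)) f \<in> carrier_mat (Suc n * d) (Suc n * d)"
    using dsum_carrier[OF one_carrier_mat[of "n * d"] assms(2)] by (simp add: add.commute)
  show "dsum (dsum b (1\<^sub>m ((n - 1) * d))) f \<in> carrier_mat (Suc n * d) (Suc n * d)" if "n > 0"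
    using dsum_carrier[OF dsum_carrier[OF assms(1) one_carrier_mat[of "(n - 1) * d"]] assms(2)] that
    by (cases n) (simp_all add: algebra_simps)
qed

lemma CN_carrier:
  assumes "\<And>i. strict_contraction d (\<beta> i)"
  shows "mat_adjoint (CN d \<beta> n) \<in> carrier_mat (Suc n * d) (Suc n * d)"
    "mat_adjoint (CNhat d \<beta> n) \<in> carrier_mat (Suc n * d) (Suc n * d)"
    "mat_adjoint (CN d \<beta> n) = mat_adjoint (MN d \<beta> n) * mat_adjoint (LN d \<beta> n)"
    "mat_adjoint (CNhat d \<beta> n) = mat_adjoint (LN d \<beta> n) * mat_adjoint (MN d \<beta> n)"
  using LN_carrier[where \<beta> = \<beta> and n = n, OF assms] MN_carrier[where \<beta> = \<beta> and n = n, OF assms]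
  by (auto simp: CN_def CNhat_def mat_adjoint_mult intro!: mat_adjoint_carrier mult_carrier_mat[of _ "Suc n * d" "Suc n * d"] simp del: mult_Suc)

lemma cmv_rhs_carrier:
  assumes "\<And>i. strict_contraction d (\<beta> i)" "b \<in> carrier_mat d d" "f \<in> carrier_mat d d"
  shows "cmv_rhs d \<beta> e n b f \<in> carrier_mat (Suc n * d) (Suc n * d)"
  unfolding cmv_rhs_def using dsum_dims_Suc[OF assms(2,3), of n] CN_carrier(1,2)[where \<beta> = \<beta> and n = n, OF assms(1)]
  by (cases "n = 0") (auto intro!: mult_carrier_mat[of _ "Suc n * d" "Suc n * d"] simp del: mult_Suc)

text \<open>The column G is carried to A and then to B by the two factors. At each cut end a pair is
  incomplete: there the truncated factor has an identity block, while the true columns are related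
  by \<open>b\<close> or \<open>f\<close>. Replacing the end entries before or after a factor makes
  up for it, and the parities decide on which side this happens.\<close>

lemma cmv_block_relation:
  assumes \<beta>: "\<And>i. strict_contraction d (\<beta> i)" and b: "b \<in> carrier_mat d d" and f: "f \<in> carrier_mat d d"
    and G: "\<And>r. G r \<in> carrier_mat d m" and A: "\<And>r. A r \<in> carrier_mat d m" and B: "\<And>r. B r \<in> carrier_mat d m"
    and rel: "\<And>r. r < n \<Longrightarrow> even r = e \<Longrightarrow> theta_rel d (\<beta> r) G A r"
      "\<And>r. r < n \<Longrightarrow> even r \<noteq> e \<Longrightarrow> theta_rel d (\<beta> r) A B r"
    and left: "e \<Longrightarrow> B 0 = b * A 0" "\<not> e \<Longrightarrow> A 0 = b * G 0"
    and right: "even n = e \<Longrightarrow> A n = f * G n" "even n \<noteq> e \<Longrightarrow> B n = f * A n"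
  shows "cmv_rhs d \<beta> e n b f * stk m n G = stk m n B"
proof -
  note dd = dsum_dims_Suc[OF b f, of n]
  note LM = mat_adjoint_carrier[OF LN_carrier[where \<beta> = \<beta> and n = n, OF \<beta>]] mat_adjoint_carrier[OF MN_carrier[where \<beta> = \<beta> and n = n, OF \<beta>]]
  have G': "stk m n G \<in> carrier_mat (Suc n * d) m" using stack_upt_carrier[where X = G and d = d and m = m, OF G, where i = 0 and j = "Suc n"] by (simp del: upt_Suc)
  note dims = carrier_matD[OF dd(1)] carrier_matD[OF dd(2)] carrier_matD[OF LM(1)] carrier_matD[OF LM(2)] carrier_matD[OF G']
  consider "e" "even n" | "e" "odd n" | "\<not> e" "even n" | "\<not> e" "odd n" by blast
  then show ?thesis
  proof cases
    case 1
    \<comment> \<open>The last index is alone in L, so f must act before it; index 0 is alone in M,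
      so b acts afterwards.\<close>
    define G1 where "G1 = G(n := f * G n)"
    define B1 where "B1 = B(0 := A 0)"
    have G1: "G1 r \<in> carrier_mat d m" and B1: "B1 r \<in> carrier_mat d m" for r
      using G A B mult_carrier_mat[OF f G[of n]] by (auto simp: G1_def B1_def)
    have "cmv_rhs d \<beta> e n b f * stk m n G = dsum b (1\<^sub>m (n * d)) * (mat_adjoint (MN d \<beta> n) * (mat_adjoint (LN d \<beta> n) * (dsum (1\<^sub>m (n * d)) f * stk m n G)))"
      using 1 dims by (simp add: cmv_rhs_def CN_carrier(3)[where \<beta> = \<beta> and n = n, OF \<beta>] mat_assoc del: upt_Suc mult_Suc)
    also have "dsum (1\<^sub>m (n * d)) f * stk m n G = stk m n G1" unfolding G1_def by (rule dsum_last_stack[OF f G])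
    also have "mat_adjoint (LN d \<beta> n) * stk m n G1 = stk m n A"
    proof (rule LN_stack[OF \<beta> G1 A])
      fix r assume r: "r < n" "even r"
      then have "Suc r \<noteq> n" using 1 by auto
      then show "theta_rel d (\<beta> r) G1 A r" using rel(1)[of r] r 1 by (simp add: theta_rel_def G1_def)
    qed (use 1 right in \<open>simp add: G1_def\<close>)
    also have "mat_adjoint (MN d \<beta> n) * stk m n A = stk m n B1"
    proof (rule MN_stack[OF \<beta> A B1])
      fix r assume r: "r < n" "odd r"
      then have "r \<noteq> 0" by (intro notI) auto
      then show "theta_rel d (\<beta> r) A B1 r" using rel(2)[of r] r 1 by (simp add: theta_rel_def B1_def)
    qed (use 1 in \<open>auto simp: B1_def\<close>)
    also have "dsum b (1\<^sub>m (n * d)) * stk m n B1 = stk m n (B1(0 := b * B1 0))" by (rule dsum_first_stack[OF b B1])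
    also have "B1(0 := b * B1 0) = B" using left 1 by (auto simp: B1_def)
    finally show ?thesis .
  next
    case 2
    then have n: "n > 0" by (cases n) auto
    \<comment> \<open>Both unpaired indices belong to M, the factor applied last, so both
      corrections stand on the left.\<close>
    define B1 where "B1 = B(0 := A 0, n := A n)"
    have B1: "B1 r \<in> carrier_mat d m" for r using A B by (auto simp: B1_def)
    have "cmv_rhs d \<beta> e n b f * stk m n G = dsum (dsum b (1\<^sub>m ((n - 1) * d))) f * (mat_adjoint (MN d \<beta> n) * (mat_adjoint (LN d \<beta> n) * stk m n G))"
      using 2 dims carrier_matD[OF dd(3)[OF n]] by (simp add: cmv_rhs_def CN_carrier(3)[where \<beta> = \<beta> and n = n, OF \<beta>] mat_assoc del: upt_Suc mult_Suc)
    also have "mat_adjoint (LN d \<beta> n) * stk m n G = stk m n A"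
      by (rule LN_stack[OF \<beta> G A]) (use rel(1) 2 in auto)
    also have "mat_adjoint (MN d \<beta> n) * stk m n A = stk m n B1"
    proof (rule MN_stack[OF \<beta> A B1])
      fix r assume r: "r < n" "odd r"
      then have "r \<noteq> 0" "Suc r \<noteq> n" using 2 by (auto dest: odd_pos)
      then show "theta_rel d (\<beta> r) A B1 r" using rel(2)[of r] r 2 by (simp add: theta_rel_def B1_def)
    qed (use 2 n in \<open>auto simp: B1_def\<close>)
    also have "dsum (dsum b (1\<^sub>m ((n - 1) * d))) f * stk m n B1 = stk m n (B1(0 := b * B1 0, n := f * B1 n))"
      by (rule dsum_both_stack[OF b f B1 n])
    also have "B1(0 := b * B1 0, n := f * B1 n) = B" using left right 2 n by (auto simp: B1_def)
    finally show ?thesis .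
  next
    case 3
    \<comment> \<open>Now M is applied first: index 0 is corrected before it, the last index after
      L.\<close>
    define G1 where "G1 = G(0 := b * G 0)"
    define B1 where "B1 = B(n := A n)"
    have G1: "G1 r \<in> carrier_mat d m" and B1: "B1 r \<in> carrier_mat d m" for r
      using G A B mult_carrier_mat[OF b G[of 0]] by (auto simp: G1_def B1_def)
    have "cmv_rhs d \<beta> e n b f * stk m n G = dsum (1\<^sub>m (n * d)) f * (mat_adjoint (LN d \<beta> n) * (mat_adjoint (MN d \<beta> n) * (dsum b (1\<^sub>m (n * d)) * stk m n G)))"
      using 3 dims by (simp add: cmv_rhs_def CN_carrier(4)[where \<beta> = \<beta> and n = n, OF \<beta>] mat_assoc del: upt_Suc mult_Suc)
    also have "dsum b (1\<^sub>m (n * d)) * stk m n G = stk m n G1" unfolding G1_def by (rule dsum_first_stack[OF b G])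
    also have "mat_adjoint (MN d \<beta> n) * stk m n G1 = stk m n A"
    proof (rule MN_stack[OF \<beta> G1 A])
      fix r assume r: "r < n" "odd r"
      then have "r \<noteq> 0" by (intro notI) auto
      then show "theta_rel d (\<beta> r) G1 A r" using rel(1)[of r] r 3 by (simp add: theta_rel_def G1_def)
    qed (use 3 left in \<open>auto simp: G1_def\<close>)
    also have "mat_adjoint (LN d \<beta> n) * stk m n A = stk m n B1"
    proof (rule LN_stack[OF \<beta> A B1])
      fix r assume r: "r < n" "even r"
      then have "Suc r \<noteq> n" using 3 by auto
      then show "theta_rel d (\<beta> r) A B1 r" using rel(2)[of r] r 3 by (simp add: theta_rel_def B1_def)
    qed (use 3 in \<open>auto simp: B1_def\<close>)
    also have "dsum (1\<^sub>m (n * d)) f * stk m n B1 = stk m n (B1(n := f * B1 n))" by (rule dsum_last_stack[OF f B1])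
    also have "B1(n := f * B1 n) = B" using right 3 by (auto simp: B1_def)
    finally show ?thesis .
  next
    case 4
    then have n: "n > 0" by (cases n) auto
    \<comment> \<open>Both unpaired indices again belong to M, which now acts first, so both
      corrections precede it.\<close>
    define G1 where "G1 = G(0 := b * G 0, n := f * G n)"
    have G1: "G1 r \<in> carrier_mat d m" for r
      using G mult_carrier_mat[OF b G[of 0]] mult_carrier_mat[OF f G[of n]] by (auto simp: G1_def)
    have "cmv_rhs d \<beta> e n b f * stk m n G = mat_adjoint (LN d \<beta> n) * (mat_adjoint (MN d \<beta> n) * (dsum (dsum b (1\<^sub>m ((n - 1) * d))) f * stk m n G))"
      using 4 dims carrier_matD[OF dd(3)[OF n]] by (simp add: cmv_rhs_def CN_carrier(4)[where \<beta> = \<beta> and n = n, OF \<beta>] mat_assoc del: upt_Suc mult_Suc)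
    also have "dsum (dsum b (1\<^sub>m ((n - 1) * d))) f * stk m n G = stk m n G1" unfolding G1_def by (rule dsum_both_stack[OF b f G n])
    also have "mat_adjoint (MN d \<beta> n) * stk m n G1 = stk m n A"
    proof (rule MN_stack[OF \<beta> G1 A])
      fix r assume r: "r < n" "odd r"
      then have "r \<noteq> 0" "Suc r \<noteq> n" using 4 by (auto dest: odd_pos)
      then show "theta_rel d (\<beta> r) G1 A r" using rel(1)[of r] r 4 by (simp add: theta_rel_def G1_def)
    qed (use 4 left right n in \<open>auto simp: G1_def\<close>)
    also have "mat_adjoint (LN d \<beta> n) * stk m n A = stk m n B"
      by (rule LN_stack[OF \<beta> A B]) (use rel(2) 4 in auto)
    finally show ?thesis .
  qed
qed

section \<open>Schur functions of the CMV bases\<close>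

text \<open>The exponents in the CMV bases are floors of (s+p)/2. Their growth from index j on
  depends on the parity of j + p.\<close>

lemma half_shift:
  fixes j s p :: nat
  assumes "j \<le> s"
  obtains t where "s = j + t"
    "even (j + p) \<Longrightarrow> (s + p) div 2 = (j + p) div 2 + t div 2" "even (j + p) \<Longrightarrow> even (s + p) \<longleftrightarrow> even t"
    "odd (j + p) \<Longrightarrow> (s + p) div 2 = (j + p) div 2 + (t + 1) div 2" "odd (j + p) \<Longrightarrow> even (s + p) \<longleftrightarrow> odd t"
proof -
  obtain t where t: "s = j + t" using assms le_Suc_ex by blast
  have sp: "s + p = (j + p) + t" by (simp add: t)
  show ?thesis
  proof (rule that[OF t])
    assume "even (j + p)"
    then obtain m where m: "j + p = 2 * m" by (rule evenE)
    show "(s + p) div 2 = (j + p) div 2 + t div 2" "even (s + p) \<longleftrightarrow> even t" unfolding sp m by simp_all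
  next
    assume "odd (j + p)"
    then obtain m where m: "j + p = 2 * m + 1" by (rule oddE)
    have "(2 * m + 1 + t) div 2 = m + (t + 1) div 2" using div_mult_self4[of 2 m "t + 1"] by (simp add: ac_simps)
    then show "(s + p) div 2 = (j + p) div 2 + (t + 1) div 2" "even (s + p) \<longleftrightarrow> odd t" unfolding sp m by simp_all
  qed
qed

lemma mat_fun_dsum:
  assumes "fun_algebra S \<Phi>" and f: "mat_fun S \<Phi> r1 c1 f" and g: "mat_fun S \<Phi> r2 c2 g"
  shows "mat_fun S \<Phi> (r1 + r2) (c1 + c2) (\<lambda>z. dsum (f z) (g z))"
  unfolding mat_fun_def
proof (intro conjI ballI allI impI)
  fix z assume "z \<in> S"
  then show "dsum (f z) (g z) \<in> carrier_mat (r1 + r2) (c1 + c2)"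
    by (intro dsum_carrier mat_funD(1)[OF f] mat_funD(1)[OF g])
next
  fix a b assume ab: "a < r1 + r2" "b < c1 + c2"
  define h where "h z = (if a < r1 then if b < c1 then f z $$ (a, b) else 0
      else if b < c1 then 0 else g z $$ (a - r1, b - c1))" for z
  have "\<Phi> h"
  proof (cases "a < r1"; cases "b < c1")
    assume "a < r1" "b < c1"
    then show ?thesis using mat_funD(2)[OF f, of a b] by (simp add: h_def[abs_def])
  next
    assume "\<not> a < r1" "\<not> b < c1"
    then show ?thesis using ab mat_funD(2)[OF g, of "a - r1" "b - c1"] by (simp add: h_def[abs_def])
  qed (use fun_algebraD(1)[OF assms(1), of 0] in \<open>simp_all add: h_def[abs_def]\<close>)
  then show "\<Phi> (\<lambda>z. dsum (f z) (g z) $$ (a, b))"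
  proof (rule fun_algebraD(4)[OF assms(1), rotated])
    fix z assume "z \<in> S"
    from carrier_matD[OF mat_funD(1)[OF f this]] carrier_matD[OF mat_funD(1)[OF g this]]
    show "h z = dsum (f z) (g z) $$ (a, b)" using ab by (simp add: h_def dsum_def)
  qed
qed

text \<open>The row of blocks h 0, ..., h (N-1): pairing with it treats all block columns of the
  block measure at once.\<close>

definition blockrow :: "nat \<Rightarrow> nat \<Rightarrow> (nat \<Rightarrow> complex \<Rightarrow> complex mat) \<Rightarrow> complex \<Rightarrow> complex mat" where
  "blockrow d N h t = Matrix.mat d (N * d) (\<lambda>(a, b). h (b div d) t $$ (a, b mod d))"

lemma blockrow_dim [simp]: "dim_row (blockrow d N h t) = d" "dim_col (blockrow d N h t) = N * d"
  "blockrow d N h t \<in> carrier_mat d (N * d)"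
  by (simp_all add: blockrow_def)

lemma block_index: assumes "b < N * d" shows "b div d < N" "b mod d < d" "d > (0::nat)"
proof -
  show d: "d > 0" using assms by (cases d) auto
  show "b div d < N" using assms by (simp add: less_mult_imp_div_less)
  show "b mod d < d" using d by simp
qed

context matrix_meas begin

lemma cfun_blockrow: "(\<And>s. cfun d d (h s)) \<Longrightarrow> cfun d (N * d) (blockrow d N h)"
  unfolding mat_fun_def by (auto simp: blockrow_def block_index(2))

lemma mult_blockrow_index:
  assumes "A \<in> carrier_mat d d" "h (b div d) t \<in> carrier_mat d d" "a < d" "b < N * d"
  shows "(A * blockrow d N h t) $$ (a, b) = (A * h (b div d) t) $$ (a, b mod d)"
  using assms block_index[OF assms(4)] by (simp add: scalar_prod_def blockrow_def)

lemma J_blockrow: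
  assumes g: "cfun d d g" and h: "\<And>s. cfun d d (h s)" and ab: "a < d" "b < N * d"
  shows "J (N * d) g (blockrow d N h) $$ (a, b) = J d g (h (b div d)) $$ (a, b mod d)"
proof -
  have "J (N * d) g (blockrow d N h) $$ (a, b) = integral\<^sup>L M (\<lambda>t. (mat_adjoint (g t) * W t * blockrow d N h t) $$ (a, b))"
    using ab by (simp add: J_def mint_def)
  also have "\<dots> = integral\<^sup>L M (\<lambda>t. (mat_adjoint (g t) * W t * h (b div d) t) $$ (a, b mod d))"
  proof (rule integral_cong_circ)
    fix t assume t: "t \<in> circ"
    show "(mat_adjoint (g t) * W t * blockrow d N h t) $$ (a, b) = (mat_adjoint (g t) * W t * h (b div d) t) $$ (a, b mod d)"
      by (intro mult_blockrow_index mult_carrier_mat[OF mat_adjoint_carrier[OF mat_funD(1)[OF g t]] W_carrier[OF t]]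
          mat_funD(1)[OF h t] ab)
  qed
  also have "\<dots> = J d g (h (b div d)) $$ (a, b mod d)"
    using ab block_index[OF ab(2)] by (simp add: J_def mint_def)
  finally show ?thesis .
qed

lemma smult_blockrow:
  assumes h: "\<And>s. h s t \<in> carrier_mat d d"
  shows "c \<cdot>\<^sub>m blockrow d N h t = blockrow d N (\<lambda>s t. c \<cdot>\<^sub>m h s t) t"
proof (rule eq_matI)
  fix a b assume "a < dim_row (blockrow d N (\<lambda>s t. c \<cdot>\<^sub>m h s t) t)" "b < dim_col (blockrow d N (\<lambda>s t. c \<cdot>\<^sub>m h s t) t)"
  then have ab: "a < d" "b < N * d" by auto
  show "(c \<cdot>\<^sub>m blockrow d N h t) $$ (a, b) = blockrow d N (\<lambda>s t. c \<cdot>\<^sub>m h s t) t $$ (a, b)"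
    using ab block_index(2)[OF ab(2)] carrier_matD[OF h[of "b div d"]] by (simp add: blockrow_def)
qed auto

lemma ck_blockrow:
  assumes h: "\<And>s. cfun d d (h s)" and t: "t \<in> circ"
  shows "ck z (blockrow d N h) t = blockrow d N (\<lambda>s. ck z (h s)) t"
    "sk z (blockrow d N h) t = blockrow d N (\<lambda>s. sk z (h s)) t"
  unfolding ck_def sk_def smult_blockrow[where h = h and t = t, OF mat_funD(1)[OF h t]] by (simp_all add: blockrow_def)

text \<open>The factor \<open>F\<close> may not depend on the column index s; this is why the
  boundary relations are proved with factors common to all s.\<close>

lemma blockrow_rel:
  assumes F: "F \<in> carrier_mat d d" and g: "cfun d d g1" "cfun d d g2" and h: "\<And>s. cfun d d (h1 s)" "\<And>s. cfun d d (h2 s)"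
    and rel: "\<And>s. s < N \<Longrightarrow> J d g1 (h1 s) = F * J d g2 (h2 s)"
  shows "J (N * d) g1 (blockrow d N h1) = F * J (N * d) g2 (blockrow d N h2)"
proof (rule eq_matI)
  fix a b assume "a < dim_row (F * J (N * d) g2 (blockrow d N h2))" "b < dim_col (F * J (N * d) g2 (blockrow d N h2))"
  then have ab: "a < d" "b < N * d" using F by auto
  note bi = block_index[OF ab(2)]
  have "J (N * d) g1 (blockrow d N h1) $$ (a, b) = (F * J d g2 (h2 (b div d))) $$ (a, b mod d)"
    by (simp add: J_blockrow[OF g(1) h(1) ab] rel[OF bi(1)])
  also have "\<dots> = (\<Sum>k<d. F $$ (a, k) * J d g2 (h2 (b div d)) $$ (k, b mod d))"
    using F ab bi by (simp add: scalar_prod_def atLeast0LessThan)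
  also have "\<dots> = (\<Sum>k<d. F $$ (a, k) * J (N * d) g2 (blockrow d N h2) $$ (k, b))"
    using J_blockrow[OF g(2) h(2) _ ab(2)] by (intro sum.cong refl) simp
  also have "\<dots> = (F * J (N * d) g2 (blockrow d N h2)) $$ (a, b)"
    using F ab by (simp add: scalar_prod_def atLeast0LessThan)
  finally show "J (N * d) g1 (blockrow d N h1) $$ (a, b) = (F * J (N * d) g2 (blockrow d N h2)) $$ (a, b)" .
qed (use F in auto)

text \<open>Both CMV bases have the form \<open>us\<close> (with \<open>p = 0\<close> for \<open>chi\<close> and \<open>p = 1\<close> for \<open>x\<close>). The dual sequence
  \<open>ws\<close> is \<open>x\<close> for \<open>p = 0\<close> and \<open>chi\<close> divided by the variable for \<open>p = 1\<close>.\<close>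

definition T :: "nat \<Rightarrow> nat \<Rightarrow> complex \<Rightarrow> complex mat" where
  "T p s = (if even (s + p) then S s else R s)"

definition us :: "nat \<Rightarrow> nat \<Rightarrow> complex \<Rightarrow> complex mat" where
  "us p s t = cnj t ^ ((s + p) div 2) \<cdot>\<^sub>m T p s t"

definition ws :: "nat \<Rightarrow> nat \<Rightarrow> complex \<Rightarrow> complex mat" where
  "ws p s t = cnj t ^ ((s + p + 1) div 2) \<cdot>\<^sub>m T (Suc p) s t"

definition pw :: "nat \<Rightarrow> (complex \<Rightarrow> complex mat) \<Rightarrow> complex \<Rightarrow> complex mat" where
  "pw e h t = t ^ e \<cdot>\<^sub>m h t"

lemma cfun_T: "cfun d d (T p s)"
  using szego_facts(13,14) by (simp add: T_def)

lemma cfun_us: "cfun d d (us p s)" and cfun_ws: "cfun d d (ws p s)"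
  unfolding us_def[abs_def] ws_def[abs_def] by (intro cfun_intros continuous_intros cfun_T)+

lemma cfun_pw: "cfun n m h \<Longrightarrow> cfun n m (pw e h)"
  unfolding pw_def[abs_def] by (intro cfun_intros continuous_intros)

lemma J_us: "cfun d m h \<Longrightarrow> J m (us p s) h = J m (T p s) (pw ((s + p) div 2) h)"
  and J_ws: "cfun d m h \<Longrightarrow> J m (ws p s) h = J m (T (Suc p) s) (pw ((s + p + 1) div 2) h)"
  unfolding us_def[abs_def] ws_def[abs_def] pw_def[abs_def] using J_scalar[OF cfun_T] by simp_all

lemma pw_ck_Suc: "pw (Suc e) (ck z h) = pw e (sk z h)"
  by (rule ext) (simp add: pw_def ck_def sk_def smult_smult_mat_eq mult_ac)

lemma pw_ck: "pw e (ck z h) = ck z (pw e h)" and pw_sk: "pw e (sk z h) = sk z (pw e h)"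
  by (rule ext, simp add: pw_def ck_def sk_def smult_smult_mat_eq mult_ac)+

lemma J_pw_shift: "cfun d d g \<Longrightarrow> cfun d m h \<Longrightarrow> J m g (pw e h) = J m (\<lambda>t. t \<cdot>\<^sub>m g t) (pw (Suc e) h)"
  using J_shift[OF _ cfun_pw, of g m h e] by (simp add: pw_def[abs_def] smult_smult_mat_eq)

text \<open>The recursion expresses R (k+1), S (k+1) by tR k, S k. Solved instead for tR k, S (k+1)
  in terms of S k, R (k+1), its coefficient matrix becomes the unitary adj(Theta).\<close>

lemma theta_rel_Szego:
  assumes h: "cfun d m h" and X: "X r = J m (S k) h" "X (Suc r) = J m (R (Suc k)) h"
    and Y: "Y r = J m (\<lambda>t. t \<cdot>\<^sub>m R k t) h" "Y (Suc r) = J m (S (Suc k)) h"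
  shows "theta_rel d (alpha k) X Y r"
proof -
  note rho = rho_props[OF alpha_strict[of k]]
  note [simp] = pd_props(1,2,4,5)[OF rho(1)] pd_props(1,2,4,5)[OF rho(2)]
  have [simp]: "dim_row (alpha k) = d" "dim_col (alpha k) = d" using strict_carrier[OF alpha_strict[of k]] by auto
  let ?JS = "J m (S k) h" and ?JR' = "J m (R (Suc k)) h" and ?JT = "J m (\<lambda>t. t \<cdot>\<^sub>m R k t) h"
  note Sz = Szego_J[OF h, of k]
  have 1: "?JT = alpha k * ?JS + rhoR d (alpha k) * ?JR'"
    unfolding Sz(1) by (rule eq_matI, simp_all del: index_mult_mat(1))
  \<comment> \<open>The second row is verified after multiplying by the invertible rhoL, using its
    square and rhoL adj(alpha) = adj(alpha) rhoR.\<close>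
  have "rhoL d (alpha k) * (rhoL d (alpha k) * ?JS - mat_adjoint (alpha k) * ?JR')
      = (rhoL d (alpha k) * rhoL d (alpha k)) * ?JS - (rhoL d (alpha k) * mat_adjoint (alpha k)) * ?JR'"
    by (simp add: mat_diff_distrib_left mat_assoc)
  also have "\<dots> = ?JS - mat_adjoint (alpha k) * ?JT"
    unfolding rho(3) rho(6) 1 by (simp add: mat_algebra) (rule eq_matI, simp_all del: index_mult_mat(1))
  also have "\<dots> = rhoL d (alpha k) * J m (S (Suc k)) h" by (simp add: Sz(2))
  finally have "minv d (rhoL d (alpha k)) * (rhoL d (alpha k) * (rhoL d (alpha k) * ?JS - mat_adjoint (alpha k) * ?JR')) =
    minv d (rhoL d (alpha k)) * (rhoL d (alpha k) * J m (S (Suc k)) h)" by simp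
  then have 2: "rhoL d (alpha k) * ?JS - mat_adjoint (alpha k) * ?JR' = J m (S (Suc k)) h"
    by (simp add: pd_cancel[OF rho(1)])
  show ?thesis unfolding theta_rel_def X Y using 1 2 by simp
qed

text \<open>Here \<open>us\<close> has the exponent e twice and \<open>ws\<close> has e and e + 1.
  Passing from the kernel 1/(t-z) to t/(t-z) absorbs one power of t; the first entry of
  \<open>ws\<close> thereby becomes a pairing with tR k.\<close>

lemma theta_rel_G:
  assumes z: "cmod z < 1" and H: "cfun d m H" and ev: "even (k + p)"
    and X: "X r = J m (us p k) (sk z H)" "X (Suc r) = J m (us p (Suc k)) (sk z H)"
    and Y: "Y r = J m (ws p k) (ck z H)" "Y (Suc r) = J m (ws p (Suc k)) (ck z H)"
  shows "theta_rel d (alpha k) X Y r"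
proof -
  define e where "e = (k + p) div 2"
  have e: "(k + p) div 2 = e" "(Suc k + p) div 2 = e" "(k + p + 1) div 2 = e" "(Suc k + p + 1) div 2 = Suc e"
    using ev by (auto simp: e_def)
  have T: "T p k = S k" "T p (Suc k) = R (Suc k)" "T (Suc p) k = R k" "T (Suc p) (Suc k) = S (Suc k)"
    using ev by (auto simp: T_def)
  note c = cfun_ck[OF z H] cfun_sk[OF z H]
  show ?thesis
  proof (rule theta_rel_Szego[OF cfun_pw[OF c(2), of e]])
    show "X r = J m (S k) (pw e (sk z H))" "X (Suc r) = J m (R (Suc k)) (pw e (sk z H))"
      unfolding X J_us[OF c(2)] e T by (rule refl)+
    show "Y (Suc r) = J m (S (Suc k)) (pw e (sk z H))" unfolding Y J_ws[OF c(1)] e T pw_ck_Suc by (rule refl)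
    show "Y r = J m (\<lambda>t. t \<cdot>\<^sub>m R k t) (pw e (sk z H))"
      unfolding Y J_ws[OF c(1)] e T J_pw_shift[OF szego_facts(13) c(1)] pw_ck_Suc by (rule refl)
  qed
qed

text \<open>For odd k + p the exponent of \<open>us\<close> at k is one below the other three, so
  the pairing with R k becomes one with tR k and the kernel stays the same. Composed with
  \<open>theta_rel_G\<close> this leads from D to N.\<close>

lemma theta_rel_A:
  assumes z: "cmod z < 1" and H: "cfun d m H" and od: "odd (k + p)"
    and X: "X r = J m (ws p k) (ck z H)" "X (Suc r) = J m (ws p (Suc k)) (ck z H)"
    and Y: "Y r = J m (us p k) (ck z H)" "Y (Suc r) = J m (us p (Suc k)) (ck z H)"
  shows "theta_rel d (alpha k) X Y r"
proof -
  define e where "e = (k + p) div 2"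
  have e: "(k + p) div 2 = e" "(Suc k + p) div 2 = Suc e" "(k + p + 1) div 2 = Suc e" "(Suc k + p + 1) div 2 = Suc e"
    using od by (auto simp: e_def elim!: oddE)
  have T: "T p k = R k" "T p (Suc k) = S (Suc k)" "T (Suc p) k = S k" "T (Suc p) (Suc k) = R (Suc k)"
    using od by (auto simp: T_def)
  note c = cfun_ck[OF z H]
  show ?thesis
  proof (rule theta_rel_Szego[OF cfun_pw[OF c, of "Suc e"]])
    show "X r = J m (S k) (pw (Suc e) (ck z H))" "X (Suc r) = J m (R (Suc k)) (pw (Suc e) (ck z H))"
      unfolding X J_ws[OF c] e T by (rule refl)+
    show "Y (Suc r) = J m (S (Suc k)) (pw (Suc e) (ck z H))" unfolding Y J_us[OF c] e T by (rule refl)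
    show "Y r = J m (\<lambda>t. t \<cdot>\<^sub>m R k t) (pw (Suc e) (ck z H))"
      unfolding Y J_us[OF c] e T J_pw_shift[OF szego_facts(13) c] by (rule refl)
  qed
qed

lemma pw_us:
  assumes t: "t \<in> circ" and "(s + p) div 2 \<le> e"
  shows "pw e (us p s) t = t ^ (e - (s + p) div 2) \<cdot>\<^sub>m mpeval d (if even (s + p) then Slist s else Rlist s) t"
  using circ_pow(1)[OF t assms(2)] by (simp add: pw_def us_def smult_smult_mat_eq T_def S_def R_def)

text \<open>Multiplication by t^e clears the negative powers of us p s and leaves a polynomial of
  degree at most k, so \<open>right_relation\<close> applies with the same factor for every
  s.\<close>

lemma right_boundary:
  assumes z: "cmod z < 1" and s: "s \<le> k"
  shows "even (k + p) \<Longrightarrow> J d (ws p k) (ck z (us p s)) = fk k z * J d (us p k) (sk z (us p s))"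
    "odd (k + p) \<Longrightarrow> J d (us p k) (ck z (us p s)) = fk k z * J d (ws p k) (ck z (us p s))"
proof -
  define e where "e = (k + p) div 2"
  define cs where "cs = (if even (s + p) then Slist s else Rlist s)"
  define l where "l = e - (s + p) div 2"
  have se: "(s + p) div 2 \<le> e" unfolding e_def using s by (intro div_le_mono) simp
  have cs: "set cs \<subseteq> carrier_mat d d" "length cs = Suc s" using szego_facts[where k = s] by (auto simp: cs_def)
  \<comment> \<open>Degree count: raising the index from s to k leaves room for k - s more powers,
    and the exponent grows by at most that amount.\<close>
  obtain t where "k = s + t" using s le_Suc_ex by blast
  moreover have "(s + p + t) div 2 \<le> (s + p) div 2 + t" by linarith
  ultimately have "(k + p) div 2 + s \<le> k + (s + p) div 2" by (simp add: ac_simps)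
  then have len: "l + length cs \<le> Suc k" using se by (simp add: l_def cs e_def)
  note c = cfun_ck[OF z cfun_us[of p s]] cfun_sk[OF z cfun_us[of p s]]
  have P: "J d (R k) (ck z (pw e (us p s))) = J d (R k) (ck z (\<lambda>t. t ^ l \<cdot>\<^sub>m mpeval d cs t))"
    using pw_us[OF _ se] by (intro J_cong refl) (simp add: ck_def l_def cs_def)
  have Q: "J d (S k) (sk z (pw e (us p s))) = J d (S k) (sk z (\<lambda>t. t ^ l \<cdot>\<^sub>m mpeval d cs t))"
    using pw_us[OF _ se] by (intro J_cong refl) (simp add: sk_def l_def cs_def)
  have rel: "J d (R k) (ck z (pw e (us p s))) = fk k z * J d (S k) (sk z (pw e (us p s)))"
    unfolding P Q by (rule right_relation[OF z cs(1) len])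
  show "J d (ws p k) (ck z (us p s)) = fk k z * J d (us p k) (sk z (us p s))" if ev: "even (k + p)"
  proof -
    have i: "(k + p + 1) div 2 = e" and T: "T p k = S k" "T (Suc p) k = R k" using ev by (auto simp: e_def T_def)
    show ?thesis unfolding J_ws[OF c(1)] J_us[OF c(2)] i e_def[symmetric] T pw_ck pw_sk by (rule rel)
  qed
  show "J d (us p k) (ck z (us p s)) = fk k z * J d (ws p k) (ck z (us p s))" if od: "odd (k + p)"
  proof -
    have i: "(k + p + 1) div 2 = Suc e" using od by (auto simp: e_def elim!: oddE)
    have T: "T p k = R k" "T (Suc p) k = S k" using od by (auto simp: T_def)
    show ?thesis unfolding J_ws[OF c(1)] J_us[OF c(1)] i e_def[symmetric] T pw_ck_Suc pw_sk unfolding pw_ck by (rule rel)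
  qed
qed

text \<open>Moving the scalar across leaves the pairing of t^(i+b-a) with S s or R s; the hypotheses
  place that exponent in the orthogonality range, 1 to s for S and 0 to s-1 for R.\<close>

lemma J_mpow_shift_T:
  assumes "a \<le> i + b"
    and "even (s + p) \<Longrightarrow> 1 \<le> i + b - a \<and> i + b - a \<le> s" and "odd (s + p) \<Longrightarrow> i + b - a < s"
  shows "J d (mpow i) (\<lambda>t. (t ^ a * cnj t ^ b) \<cdot>\<^sub>m T p s t) = 0\<^sub>m d d"
proof -
  have "J d (mpow i) (\<lambda>t. (t ^ a * cnj t ^ b) \<cdot>\<^sub>m T p s t) = J d (mpow i) (\<lambda>t. cnj (cnj (t ^ a * cnj t ^ b)) \<cdot>\<^sub>m T p s t)"
    by simp
  also have "\<dots> = J d (\<lambda>t. cnj (t ^ a * cnj t ^ b) \<cdot>\<^sub>m mpow i t) (T p s)"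
    by (rule J_scalar[OF cfun_mpow cfun_T, symmetric])
  also have "\<dots> = J d (mpow (i + b - a)) (T p s)"
  proof (intro J_cong refl)
    fix t assume t: "t \<in> circ"
    have "cnj (t ^ a * cnj t ^ b) * t ^ i = t ^ (i + b) * cnj t ^ a" by (simp add: power_add mult_ac)
    then show "cnj (t ^ a * cnj t ^ b) \<cdot>\<^sub>m mpow i t = mpow (i + b - a) t"
      using circ_pow(1)[OF t assms(1)] unfolding mpow_def smult_smult_mat_eq by simp
  qed
  also have "\<dots> = 0\<^sub>m d d" using assms szego_facts(9,10)[where k = s] by (simp add: T_def)
  finally show ?thesis .
qed

text \<open>Dually to the right end, the shifted us p s has to be orthogonal to all powers below j.
  This rests on s being at least j, through the comparison of exponents in
  \<open>half_shift\<close>.\<close>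

lemma left_boundary:
  assumes z: "cmod z < 1" "z \<noteq> 0" and s: "j \<le> s"
  shows "even (j + p) \<Longrightarrow> J d (us p j) (ck z (us p s)) = inv_schur d alpha j z * J d (ws p j) (ck z (us p s))"
    "odd (j + p) \<Longrightarrow> J d (ws p j) (ck z (us p s)) = inv_schur d alpha j z * J d (us p j) (sk z (us p s))"
proof -
  define m where "m = (j + p) div 2"
  note c = cfun_ck[OF z(1) cfun_us[of p s]] cfun_sk[OF z(1) cfun_us[of p s]]
  show "J d (us p j) (ck z (us p s)) = inv_schur d alpha j z * J d (ws p j) (ck z (us p s))" if ev: "even (j + p)"
  proof -
    \<comment> \<open>The additional cnj t rewrites the kernel 1/(t-z) as t/(t-z), the form that
      \<open>left_relation\<close> expects.\<close>
    define h where "h t = (t ^ m * cnj t ^ Suc ((s + p) div 2)) \<cdot>\<^sub>m T p s t" for t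
    have h: "cfun d d h" unfolding h_def[abs_def] by (intro cfun_intros continuous_intros cfun_T)
    have i: "(j + p + 1) div 2 = m" and T: "T p j = S j" "T (Suc p) j = R j" using ev by (auto simp: m_def T_def)
    have eq: "pw m (ck z (us p s)) t = sk z h t" if t: "t \<in> circ" for t
    proof -
      have "t ^ m * (1 / (t - z) * cnj t ^ ((s + p) div 2)) = (t * cnj t) * (t ^ m * (1 / (t - z) * cnj t ^ ((s + p) div 2)))"
        by (simp add: circ_cnj(2)[OF t])
      also have "\<dots> = t / (t - z) * (t ^ m * cnj t ^ Suc ((s + p) div 2))" by simp
      finally show ?thesis by (simp only: pw_def ck_def sk_def us_def h_def smult_smult_mat_eq mult.assoc)
    qed
    have 1: "J d g (pw m (ck z (us p s))) = J d g (sk z h)" for g by (intro J_cong refl eq)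
    have "J d (S j) (sk z h) = inv_schur d alpha j z * J d (R j) (sk z h)"
    proof (rule left_relation[OF z h])
      fix i assume i: "i < j"
      obtain t where t: "s = j + t" "(s + p) div 2 = m + t div 2" "even (s + p) \<longleftrightarrow> even t"
        using half_shift[OF s, of p] ev unfolding m_def by metis
      have "t div 2 \<le> t" "odd t \<Longrightarrow> t div 2 < t" by (auto elim: oddE)
      then have "m \<le> i + Suc ((s + p) div 2)" "even (s + p) \<Longrightarrow> i + Suc ((s + p) div 2) - m \<le> s"
        "odd (s + p) \<Longrightarrow> i + Suc ((s + p) div 2) - m < s" "1 \<le> i + Suc ((s + p) div 2) - m"
        using i unfolding t(2,3) unfolding t(1) by auto
      then show "J d (mpow i) h = 0\<^sub>m d d" unfolding h_def[abs_def] by (intro J_mpow_shift_T) auto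
    qed
    then show ?thesis unfolding J_ws[OF c(1)] J_us[OF c(1)] i m_def[symmetric] T 1 .
  qed
  show "J d (ws p j) (ck z (us p s)) = inv_schur d alpha j z * J d (us p j) (sk z (us p s))" if od: "odd (j + p)"
  proof -
    define h where "h t = (t ^ m * cnj t ^ ((s + p) div 2)) \<cdot>\<^sub>m T p s t" for t
    have h: "cfun d d h" unfolding h_def[abs_def] by (intro cfun_intros continuous_intros cfun_T)
    have i: "(j + p + 1) div 2 = Suc m" using od by (auto simp: m_def elim!: oddE)
    have T: "T p j = R j" "T (Suc p) j = S j" using od by (auto simp: T_def)
    have eq: "pw m (us p s) = h" by (rule ext) (simp add: pw_def us_def h_def smult_smult_mat_eq)
    have "J d (S j) (sk z h) = inv_schur d alpha j z * J d (R j) (sk z h)"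
    proof (rule left_relation[OF z h])
      fix i assume i: "i < j"
      obtain t where t: "s = j + t" "(s + p) div 2 = m + (t + 1) div 2" "even (s + p) \<longleftrightarrow> odd t"
        using half_shift[OF s, of p] od unfolding m_def by metis
      have "(t + 1) div 2 \<le> t \<or> t = 0" "odd t \<Longrightarrow> 1 \<le> (t + 1) div 2" by (linarith, auto elim: oddE)
      then have "m \<le> i + (s + p) div 2" "even (s + p) \<Longrightarrow> i + (s + p) div 2 - m \<le> s"
        "odd (s + p) \<Longrightarrow> i + (s + p) div 2 - m < s" "even (s + p) \<Longrightarrow> 1 \<le> i + (s + p) div 2 - m"
        using i unfolding t(2,3) unfolding t(1) by auto
      then show "J d (mpow i) h = 0\<^sub>m d d" unfolding h_def[abs_def] by (intro J_mpow_shift_T) auto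
    qed
    then show ?thesis unfolding J_ws[OF c(1)] J_us[OF c(2)] i m_def[symmetric] T pw_ck_Suc pw_sk eq .
  qed
qed

text \<open>Clearing the power of us p r leaves a polynomial of degree at most r; comparing
  exponents shows each of its monomials to be orthogonal to the correspondingly shifted us p
  s.\<close>

lemma us_orthogonal: assumes "r < s" shows "J d (us p r) (us p s) = 0\<^sub>m d d"
proof -
  define cs where "cs = (if even (r + p) then Slist r else Rlist r)"
  define h where "h t = (t ^ ((r + p) div 2) * cnj t ^ ((s + p) div 2)) \<cdot>\<^sub>m T p s t" for t
  have h: "cfun d d h" unfolding h_def[abs_def] by (intro cfun_intros continuous_intros cfun_T)
  have cs: "set cs \<subseteq> carrier_mat d d" "length cs = Suc r" using szego_facts[where k = r] by (auto simp: cs_def)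
  have "pw ((r + p) div 2) (us p s) = h" by (rule ext) (simp add: pw_def us_def h_def smult_smult_mat_eq)
  then have "J d (us p r) (us p s) = J d (T p r) h" by (simp add: J_us[OF cfun_us])
  also have "\<dots> = J d (\<lambda>t. t ^ 0 \<cdot>\<^sub>m mpeval d cs t) h"
    by (intro J_cong refl eq_matI) (auto simp: T_def cs_def S_def R_def)
  also have "\<dots> = (if Suc r < length cs then mat_adjoint (cs ! Suc r) * J d (mpow (0 + Suc r)) h else 0\<^sub>m d d)"
  proof (rule J_mpow_mpeval[OF cs(1) h])
    fix i assume "i < length cs" "i \<noteq> Suc r"
    then have i: "i \<le> r" by (simp add: cs)
    have rs: "r \<le> s" using assms by simp
    define m where "m = (r + p) div 2"
    have "m \<le> i + (s + p) div 2 \<and> (even (s + p) \<longrightarrow> i + (s + p) div 2 - m \<le> s) \<and>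
      (odd (s + p) \<longrightarrow> i + (s + p) div 2 - m < s) \<and> (even (s + p) \<longrightarrow> 1 \<le> i + (s + p) div 2 - m)"
    proof (cases "even (r + p)")
      case True
      obtain t where t: "s = r + t" "(s + p) div 2 = m + t div 2" "even (s + p) \<longleftrightarrow> even t"
        using half_shift[OF rs, of p] True unfolding m_def by metis
      have "0 < t" using assms t(1) by simp
      then have "t div 2 < t" "even t \<Longrightarrow> 1 \<le> t div 2" by (auto elim!: evenE)
      then show ?thesis using i unfolding t(2,3) unfolding t(1) by auto
    next
      case False
      obtain t where t: "s = r + t" "(s + p) div 2 = m + (t + 1) div 2" "even (s + p) \<longleftrightarrow> odd t"
        using half_shift[OF rs, of p] False unfolding m_def by metis
      have "0 < t" using assms t(1) by simp
      then have "(t + 1) div 2 \<le> t" "even t \<Longrightarrow> (t + 1) div 2 < t" "1 \<le> (t + 1) div 2" by (auto elim!: evenE)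
      then show ?thesis using i unfolding t(2,3) unfolding t(1) by auto
    qed
    then have "(r + p) div 2 \<le> i + (s + p) div 2" "even (s + p) \<Longrightarrow> i + (s + p) div 2 - (r + p) div 2 \<le> s"
      "odd (s + p) \<Longrightarrow> i + (s + p) div 2 - (r + p) div 2 < s" "even (s + p) \<Longrightarrow> 1 \<le> i + (s + p) div 2 - (r + p) div 2"
      unfolding m_def by blast+
    then have "J d (mpow i) h = 0\<^sub>m d d" unfolding h_def[abs_def] by (intro J_mpow_shift_T) auto
    then show "cs ! i = 0\<^sub>m d d \<or> J d (mpow (0 + i)) h = 0\<^sub>m d d" by simp
  qed
  finally show ?thesis by (simp add: cs)
qed

lemma us_orthonormal: "J d (us p r) (us p s) = (if r = s then 1\<^sub>m d else 0\<^sub>m d d)"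
proof -
  consider "r < s" | "s < r" | "r = s" by linarith
  then show ?thesis
  proof cases
    case 1
    then show ?thesis by (simp add: us_orthogonal)
  next
    case 2
    have "J d (us p r) (us p s) = mat_adjoint (J d (us p s) (us p r))"
      by (rule J_adjoint[OF cfun_us cfun_us, symmetric])
    then show ?thesis using 2 by (simp add: us_orthogonal)
  next
    case 3
    have "J d (us p s) (us p s) = J d (T p s) (pw ((s + p) div 2) (us p s))" by (rule J_us[OF cfun_us])
    also have "\<dots> = J d (T p s) (T p s)"
    proof (intro J_cong refl)
      fix t assume "t \<in> circ"
      from circ_pow(1)[OF this order_refl, of "(s + p) div 2"]
      show "pw ((s + p) div 2) (us p s) t = T p s t"
        by (simp add: pw_def us_def smult_smult_mat_eq) (rule eq_matI, auto)
    qed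
    also have "\<dots> = 1\<^sub>m d" using szego_facts(11,12) by (simp add: T_def)
    finally show ?thesis using 3 by simp
  qed
qed

section \<open>The CMV bases on the circle\<close>

lemma rev_adj_orthL:
  assumes t: "t \<in> circ" shows "rev_adj d (orthL M W d i) t = cnj t ^ i \<cdot>\<^sub>m S i t"
proof -
  have "rev_adj d (orthL M W d i) t = mpeval d (rev (Slist i)) (inverse t)"
    by (simp add: rev_adj_def orthL_eq rev_map o_def)
  also have "\<dots> = inverse t ^ i \<cdot>\<^sub>m mpeval d (Slist i) t"
    by (rule mpeval_rev[OF szego_facts(4,2) circ_cnj(3)[OF t]])
  finally show ?thesis by (simp add: S_def circ_cnj(4)[OF t])
qed

lemma cmv_chi_eq: assumes t: "t \<in> circ" shows "cmv_chi d M W i t = us 0 i t"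
proof (cases "even i")
  case True
  have "t ^ (i div 2) * cnj t ^ i = cnj t ^ (i div 2)"
    using circ_pow(2)[OF t, of "i div 2" i] True by (auto elim!: evenE)
  with True show ?thesis by (simp add: cmv_chi_def us_def T_def rev_adj_orthL[OF t] smult_smult_mat_eq)
qed (simp add: cmv_chi_def us_def T_def orthR_eq R_def circ_cnj(4)[OF t])

lemma cmv_x_eq: assumes t: "t \<in> circ" shows "cmv_x d M W i t = us 1 i t"
proof (cases "even i")
  case False
  have "t ^ (i div 2) * cnj t ^ i = cnj t ^ ((i + 1) div 2)"
    using circ_pow(2)[OF t, of "i div 2" i] False by (auto elim!: oddE)
  with False show ?thesis by (simp add: cmv_x_def us_def T_def rev_adj_orthL[OF t] smult_smult_mat_eq)
qed (simp add: cmv_x_def us_def T_def orthR_eq R_def circ_cnj(4)[OF t])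

definition Hrow :: "nat \<Rightarrow> nat \<Rightarrow> nat \<Rightarrow> complex \<Rightarrow> complex mat" where
  "Hrow p j n = blockrow d (Suc n) (\<lambda>s. us p (j + s))"

lemma cfun_Hrow: "cfun d (Suc n * d) (Hrow p j n)"
  unfolding Hrow_def by (rule cfun_blockrow[OF cfun_us])

definition Fblock :: "nat \<Rightarrow> nat \<Rightarrow> nat \<Rightarrow> complex \<Rightarrow> complex mat" where
  "Fblock p j n z = cmv_rhs d (\<lambda>i. alpha (j + i)) (even (j + p)) n (inv_schur d alpha j z) (fk (j + n) z)"

lemma inv_schur_carrier: "cmod z < 1 \<Longrightarrow> inv_schur d alpha j z \<in> carrier_mat d d"
  using inv_schur_contraction[where j = j and \<alpha> = alpha and d = d and z = z, OF alpha_strict] by (simp add: contraction_def)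

lemma Fblock_carrier: "cmod z < 1 \<Longrightarrow> Fblock p j n z \<in> carrier_mat (Suc n * d) (Suc n * d)"
  unfolding Fblock_def by (intro cmv_rhs_carrier alpha_strict inv_schur_carrier fk_dims(3))

text \<open>This supplies the value at 0, which the Schur function of the block measure takes as a
  limit.\<close>

lemma cont0_Fblock: "mat_fun (ball 0 1) (\<lambda>f. isCont f 0) (Suc n * d) (Suc n * d) (Fblock p j n)"
proof -
  note alg = cont0_alg
  have b: "cont0_mat (inv_schur d alpha j)"
    using inv_schur_holo[where j = j and \<alpha> = alpha and d = d, OF alpha_strict] holo_mat_isCont[OF inv_schur_holo[where j = j and \<alpha> = alpha and d = d, OF alpha_strict]]
    unfolding mat_fun_def by auto
  have f: "cont0_mat (fk (j + n))" by (rule cont0_fk)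
  note C = CN_carrier(1,2)[where \<beta> = "\<lambda>i. alpha (j + i)" and n = n, OF alpha_strict]
  have 1: "mat_fun (ball 0 1) (\<lambda>f. isCont f 0) (Suc n * d) (Suc n * d) (\<lambda>z. dsum (inv_schur d alpha j z) (1\<^sub>m (n * d)))"
    using mat_fun_dsum[OF alg b mat_fun_const[OF alg one_carrier_mat[of "n * d"]]] by simp
  have 2: "mat_fun (ball 0 1) (\<lambda>f. isCont f 0) (Suc n * d) (Suc n * d) (\<lambda>z. dsum (1\<^sub>m (n * d)) (fk (j + n) z))"
    using mat_fun_dsum[OF alg mat_fun_const[OF alg one_carrier_mat[of "n * d"]] f] by (simp add: add.commute)
  have 3: "mat_fun (ball 0 1) (\<lambda>f. isCont f 0) (Suc n * d) (Suc n * d)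
      (\<lambda>z. dsum (dsum (inv_schur d alpha j z) (1\<^sub>m ((n - 1) * d))) (fk (j + n) z))" if "odd n"
  proof -
    have "d + (n - 1) * d + d = Suc n * d" using that by (cases n) auto
    then show ?thesis
      using mat_fun_dsum[OF alg mat_fun_dsum[OF alg b mat_fun_const[OF alg one_carrier_mat[of "(n - 1) * d"]]] f]
      by (simp only:)
  qed
  note c = mat_fun_const[OF alg C(1)] mat_fun_const[OF alg C(2)]
  note mul = mat_fun_mult[OF alg, where n = "Suc n * d" and m = "Suc n * d" and l = "Suc n * d"]
  consider "even (j + p)" "even n" | "even (j + p)" "odd n" | "odd (j + p)" "even n" | "odd (j + p)" "odd n" by blast
  then show ?thesis
  proof cases
    case 1
    then show ?thesis unfolding Fblock_def[abs_def] cmv_rhs_def using mul[OF mul[OF \<open>mat_fun _ _ _ _ (\<lambda>z. dsum (inv_schur d alpha j z) (1\<^sub>m (n * d)))\<close> c(1)] 2] by simp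
  next
    case 2
    then show ?thesis unfolding Fblock_def[abs_def] cmv_rhs_def using mul[OF 3 c(1)] by simp
  next
    case 3
    then show ?thesis unfolding Fblock_def[abs_def] cmv_rhs_def using mul[OF mul[OF \<open>mat_fun _ _ _ _ (\<lambda>z. dsum (1\<^sub>m (n * d)) (fk (j + n) z))\<close> c(2)] 1] by simp
  next
    case 4
    then show ?thesis unfolding Fblock_def[abs_def] cmv_rhs_def using mul[OF c(2) 3] by simp
  qed
qed

section \<open>The block measure of a basis that agrees with \<open>us p\<close> on the
  circle\<close>

context
  fixes p j n :: nat and B :: "nat \<Rightarrow> complex \<Rightarrow> complex mat"
  assumes B: "\<And>s t. t \<in> circ \<Longrightarrow> B s t = us p s t"
begin

lemma block_density_index:
  assumes t: "t \<in> circ" and ab: "a < Suc n * d" "b < Suc n * d"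
  shows "block_density d (Suc n) j B W t $$ (a, b) =
    (mat_adjoint (us p (j + a div d) t) * W t * us p (j + b div d) t) $$ (a mod d, b mod d)"
    "block_density d (Suc n) j B W t $$ (a, b) =
    (mat_adjoint (us p (j + a div d) t) * W t * Hrow p j n t) $$ (a mod d, b)"
proof -
  show 1: "block_density d (Suc n) j B W t $$ (a, b) =
    (mat_adjoint (us p (j + a div d) t) * W t * us p (j + b div d) t) $$ (a mod d, b mod d)"
    using ab by (simp add: block_density_def B[OF t] del: mult_Suc)
  show "block_density d (Suc n) j B W t $$ (a, b) =
    (mat_adjoint (us p (j + a div d) t) * W t * Hrow p j n t) $$ (a mod d, b)"
    unfolding 1 Hrow_def
    by (rule mult_blockrow_index[symmetric])
       (auto intro!: mult_carrier_mat[of _ d d] mat_adjoint_carrier mat_funD(1)[OF cfun_us t] W_carrier[OF t]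
         ab(2) block_index[OF ab(1)] simp del: mult_Suc)
qed

lemma integrable_block_density: "integrable_mat (Suc n * d) (Suc n * d) (block_density d (Suc n) j B W)"
  unfolding integrable_mat_def
proof (intro conjI ballI allI impI)
  fix a b assume ab: "a < Suc n * d" "b < Suc n * d"
  have "integrable M (\<lambda>t. (mat_adjoint (us p (j + a div d) t) * W t * us p (j + b div d) t) $$ (a mod d, b mod d))"
    using integrable_J[OF cfun_us cfun_us, of p "j + a div d" p "j + b div d"] block_index[OF ab(1)] block_index[OF ab(2)]
    unfolding integrable_mat_def by blast
  then show "integrable M (\<lambda>t. block_density d (Suc n) j B W t $$ (a, b))"
    by (subst integrable_cong_circ[OF block_density_index(1)[OF _ ab]])
qed (simp add: block_density_def)

text \<open>Written as a column of pairings with the common row \<open>Hrow\<close>, the block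
  integral has the shape that \<open>cmv_block_relation\<close> acts on.\<close>

lemma mint_block_density_stack:
  assumes \<kappa>: "continuous_on circ \<kappa>"
  shows "mint (Suc n * d) (Suc n * d) (\<lambda>t. \<kappa> t \<cdot>\<^sub>m block_density d (Suc n) j B W t) =
    stk (Suc n * d) n (\<lambda>r. J (Suc n * d) (us p (j + r)) (\<lambda>t. \<kappa> t \<cdot>\<^sub>m Hrow p j n t))"
proof -
  let ?N = "Suc n * d"
  let ?X = "\<lambda>r. J ?N (us p (j + r)) (\<lambda>t. \<kappa> t \<cdot>\<^sub>m Hrow p j n t)"
  have c: "stk ?N n ?X \<in> carrier_mat ?N ?N"
    using stack_upt_carrier[where X = ?X and d = d and m = ?N and i = 0 and j = "Suc n", OF J_dim(3)] by (simp only: diff_zero)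
  show ?thesis
  proof (rule eq_matI)
    fix a b assume "a < dim_row (stk ?N n ?X)" "b < dim_col (stk ?N n ?X)"
    then have ab: "a < ?N" "b < ?N" using c by (auto simp del: upt_Suc mult_Suc)
    note bi = block_index[OF ab(1)] block_index[OF ab(2)]
    have "stk ?N n ?X $$ (a, b) = map ?X [0..<Suc n] ! (a div d) $$ (a mod d, b)"
      using ab by (intro stack_index) (auto simp del: upt_Suc mult_Suc)
    also have "\<dots> = ?X (a div d) $$ (a mod d, b)" using bi by (simp del: upt_Suc mult_Suc)
    also have "\<dots> = integral\<^sup>L M (\<lambda>t. (mat_adjoint (us p (j + a div d) t) * W t * (\<kappa> t \<cdot>\<^sub>m Hrow p j n t)) $$ (a mod d, b))"
      using bi ab by (simp add: J_def mint_def del: mult_Suc)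
    also have "\<dots> = integral\<^sup>L M (\<lambda>t. (\<kappa> t \<cdot>\<^sub>m block_density d (Suc n) j B W t) $$ (a, b))"
    proof (rule integral_cong_circ)
      fix t assume t: "t \<in> circ"
      note dims = cfun_dims[OF cfun_us t] cfun_dims[OF cfun_Hrow t] W_dims[OF t]
      have "mat_adjoint (us p (j + a div d) t) * W t * (\<kappa> t \<cdot>\<^sub>m Hrow p j n t) =
          \<kappa> t \<cdot>\<^sub>m (mat_adjoint (us p (j + a div d) t) * W t * Hrow p j n t)"
        by (rule mat_smult_right) (simp add: dims del: mult_Suc)
      then have "(mat_adjoint (us p (j + a div d) t) * W t * (\<kappa> t \<cdot>\<^sub>m Hrow p j n t)) $$ (a mod d, b) =
          \<kappa> t * (mat_adjoint (us p (j + a div d) t) * W t * Hrow p j n t) $$ (a mod d, b)"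
        using bi ab by (simp add: dims del: mult_Suc index_mult_mat(1))
      also have "\<dots> = \<kappa> t * block_density d (Suc n) j B W t $$ (a, b)" by (simp only: block_density_index(2)[OF t ab])
      also have "\<dots> = (\<kappa> t \<cdot>\<^sub>m block_density d (Suc n) j B W t) $$ (a, b)"
        using ab by (simp add: block_density_def del: mult_Suc)
      finally show "(mat_adjoint (us p (j + a div d) t) * W t * (\<kappa> t \<cdot>\<^sub>m Hrow p j n t)) $$ (a mod d, b) =
        (\<kappa> t \<cdot>\<^sub>m block_density d (Suc n) j B W t) $$ (a, b)" .
    qed
    also have "\<dots> = mint ?N ?N (\<lambda>t. \<kappa> t \<cdot>\<^sub>m block_density d (Suc n) j B W t) $$ (a, b)"
      using ab by (simp add: mint_def del: mult_Suc)
    finally show "mint ?N ?N (\<lambda>t. \<kappa> t \<cdot>\<^sub>m block_density d (Suc n) j B W t) $$ (a, b) = stk ?N n ?X $$ (a, b)" ..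
  qed (use c in \<open>auto simp del: upt_Suc mult_Suc\<close>)
qed

lemma mat_int_block_density: "mat_int M (Suc n * d) (block_density d (Suc n) j B W) = 1\<^sub>m (Suc n * d)"
proof (rule eq_matI)
  fix a b assume "a < dim_row (1\<^sub>m (Suc n * d) :: complex mat)" "b < dim_col (1\<^sub>m (Suc n * d) :: complex mat)"
  then have ab: "a < Suc n * d" "b < Suc n * d" by auto
  note bi = block_index[OF ab(1)] block_index[OF ab(2)]
  have "mat_int M (Suc n * d) (block_density d (Suc n) j B W) $$ (a, b) =
      integral\<^sup>L M (\<lambda>t. block_density d (Suc n) j B W t $$ (a, b))"
    using ab by (simp add: mat_int_def del: mult_Suc)
  also have "\<dots> = integral\<^sup>L M (\<lambda>t. (mat_adjoint (us p (j + a div d) t) * W t * us p (j + b div d) t) $$ (a mod d, b mod d))"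
    by (rule integral_cong_circ) (rule block_density_index(1)[OF _ ab])
  also have "\<dots> = J d (us p (j + a div d)) (us p (j + b div d)) $$ (a mod d, b mod d)"
    using bi by (simp add: J_def mint_def)
  also have "\<dots> = (if a div d = b div d \<and> a mod d = b mod d then 1 else 0)"
    unfolding us_orthonormal using bi by auto
  also have "\<dots> = 1\<^sub>m (Suc n * d) $$ (a, b)"
    using ab by (simp del: mult_Suc) (metis div_mult_mod_eq)
  finally show "mat_int M (Suc n * d) (block_density d (Suc n) j B W) $$ (a, b) = 1\<^sub>m (Suc n * d) $$ (a, b)" .
qed (simp_all add: mat_int_def)

text \<open>G, A and Bs are the block rows of D, of the dual column in between, and of N. The even
  and odd Theta relations link them in the interior and the boundary relations at the ends, which
  are the hypotheses of \<open>cmv_block_relation\<close>.\<close>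

lemma Fblock_relation:
  assumes z: "cmod z < 1" "z \<noteq> 0"
  shows "mint (Suc n * d) (Suc n * d) (ck z (block_density d (Suc n) j B W)) =
    Fblock p j n z * mint (Suc n * d) (Suc n * d) (sk z (block_density d (Suc n) j B W))"
proof -
  let ?m = "Suc n * d" and ?H = "Hrow p j n"
  have 1: "mint ?m ?m (ck z (block_density d (Suc n) j B W)) = stk ?m n (\<lambda>r. J ?m (us p (j + r)) (ck z ?H))"
    unfolding ck_def[abs_def] by (rule mint_block_density_stack[OF continuous_kernel(1)[OF z(1)]])
  have 2: "mint ?m ?m (sk z (block_density d (Suc n) j B W)) = stk ?m n (\<lambda>r. J ?m (us p (j + r)) (sk z ?H))"
    unfolding sk_def[abs_def] by (rule mint_block_density_stack[OF continuous_kernel(2)[OF z(1)]])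
  define G where "G r = J ?m (us p (j + r)) (sk z ?H)" for r
  define A where "A r = J ?m (ws p (j + r)) (ck z ?H)" for r
  define Bs where "Bs r = J ?m (us p (j + r)) (ck z ?H)" for r
  have ckH: "J ?m g (ck z ?H) = J ?m g (blockrow d (Suc n) (\<lambda>s. ck z (us p (j + s))))" for g
    unfolding Hrow_def by (intro J_cong refl ck_blockrow(1) cfun_us)
  have skH: "J ?m g (sk z ?H) = J ?m g (blockrow d (Suc n) (\<lambda>s. sk z (us p (j + s))))" for g
    unfolding Hrow_def by (intro J_cong refl ck_blockrow(2) cfun_us)
  note cc = cfun_ck[OF z(1) cfun_us] cfun_sk[OF z(1) cfun_us]
  have "Fblock p j n z * stk ?m n G = stk ?m n Bs"
    unfolding Fblock_def
  proof (rule cmv_block_relation[OF alpha_strict inv_schur_carrier[OF z(1)] fk_dims(3)[OF z(1)]])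
    show "theta_rel d (alpha (j + r)) G A r" if "even r = even (j + p)" for r
      using that by (intro theta_rel_G[OF z(1) cfun_Hrow, of "j + r" p]) (auto simp: G_def A_def)
    show "theta_rel d (alpha (j + r)) A Bs r" if "even r \<noteq> even (j + p)" for r
      using that by (intro theta_rel_A[OF z(1) cfun_Hrow, of "j + r" p]) (auto simp: Bs_def A_def)
    show "Bs 0 = inv_schur d alpha j z * A 0" if "even (j + p)"
      unfolding Bs_def A_def ckH using that
      by (intro blockrow_rel inv_schur_carrier z(1) cfun_us cfun_ws cc) (simp add: left_boundary(1)[OF z])
    show "A 0 = inv_schur d alpha j z * G 0" if "\<not> even (j + p)"
      unfolding G_def A_def ckH skH using that
      by (intro blockrow_rel inv_schur_carrier z(1) cfun_us cfun_ws cc) (simp add: left_boundary(2)[OF z])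
    show "A n = fk (j + n) z * G n" if "even n = even (j + p)"
      unfolding G_def A_def ckH skH using that
      by (intro blockrow_rel fk_dims(3)[OF z(1)] cfun_us cfun_ws cc) (intro right_boundary(1)[OF z(1)], auto)
    show "Bs n = fk (j + n) z * A n" if "even n \<noteq> even (j + p)"
      unfolding Bs_def A_def ckH using that
      by (intro blockrow_rel fk_dims(3)[OF z(1)] cfun_us cfun_ws cc) (intro right_boundary(2)[OF z(1)], auto)
  qed (auto simp: G_def A_def Bs_def simp del: mult_Suc)
  then show ?thesis unfolding 1 2 G_def Bs_def by simp
qed

lemma schur_of_block:
  assumes z: "z \<in> ball 0 1"
  shows "schur_of M (block_density d (Suc n) j B W) (Suc n * d) z = Fblock p j n z"
  unfolding schur_of_def
proof (rule fill0_continuous[of 1])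
  show "isCont (\<lambda>z. Fblock p j n z $$ (a, b)) 0" if "a < Suc n * d" "b < Suc n * d" for a b
    by (rule mat_funD(2)[OF cont0_Fblock that])
  fix w assume w: "w \<in> ball (0::complex) 1" "w \<noteq> 0"
  then have w1: "cmod w < 1" by simp
  show "(1 / w) \<cdot>\<^sub>m ((carath M (block_density d (Suc n) j B W) (Suc n * d) w - 1\<^sub>m (Suc n * d)) *
      minv (Suc n * d) (carath M (block_density d (Suc n) j B W) (Suc n * d) w + 1\<^sub>m (Suc n * d))) = Fblock p j n w"
    by (rule schur_of_value[OF integrable_block_density mat_int_block_density w1 w(2) Fblock_carrier[OF w1]
        Fblock_relation[OF w1 w(2)]])
qed (use z Fblock_carrier[of 0] in auto)

end

end

theorem theorem4p4:
  fixes d j k :: nat and M :: "complex measure" and W :: "complex \<Rightarrow> complex mat" and z :: complex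
  assumes "d > 0" and "matrix_measure d M W" and "nontrivial_mm d M W"
    and "j \<le> k" and "z \<in> ball 0 1"
  shows "schur_of M (block_density d (Suc (k - j)) j (cmv_chi d M W) W) (Suc (k - j) * d) z =
      (let b = inv_iterate d M W j z; fk = schur_iterate d M W k z;
           C = mat_adjoint (cmv_trunc d (verblunsky d M W) j k); n = k - j in
       if even j \<and> even k then dsum b (1\<^sub>m (n * d)) * C * dsum (1\<^sub>m (n * d)) fk
       else if odd j \<and> odd k then dsum (1\<^sub>m (n * d)) fk * C * dsum b (1\<^sub>m (n * d))
       else if even j \<and> odd k then dsum (dsum b (1\<^sub>m ((n - 1) * d))) fk * C
       else C * dsum (dsum b (1\<^sub>m ((n - 1) * d))) fk)
    \<and> schur_of M (block_density d (Suc (k - j)) j (cmv_x d M W) W) (Suc (k - j) * d) z =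
      (let b = inv_iterate d M W j z; fk = schur_iterate d M W k z;
           C = mat_adjoint (cmv_trunc_hat d (verblunsky d M W) j k); n = k - j in
       if odd j \<and> odd k then dsum b (1\<^sub>m (n * d)) * C * dsum (1\<^sub>m (n * d)) fk
       else if even j \<and> even k then dsum (1\<^sub>m (n * d)) fk * C * dsum b (1\<^sub>m (n * d))
       else if odd j \<and> even k then dsum (dsum b (1\<^sub>m ((n - 1) * d))) fk * C
       else C * dsum (dsum b (1\<^sub>m ((n - 1) * d))) fk)"
  proof -
  interpret matrix_meas d M W using assms(2,3) by unfold_locales
  define n where "n = k - j"
  have k: "j + n = k" using assms(4) by (simp add: n_def)
  have z1: "cmod z < 1" using assms(5) by simp
  have v: "verblunsky d M W = alpha" by (rule ext) (rule verblunsky_eq)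
  have b: "inv_iterate d M W j z = inv_schur d alpha j z" by (rule inv_iterate_eq_inv_schur[OF assms(5)])
  have f: "schur_iterate d M W k z = fk k z" by (rule schur_iterate_eq[OF assms(5)])
  \<comment> \<open>The cases of the statement go by the parities of j and k, those of
    \<open>cmv_rhs\<close> by j + p and n = k - j.\<close>
  have par: "even k \<longleftrightarrow> (even j \<longleftrightarrow> even n)" unfolding k[symmetric] by auto
  have chi: "schur_of M (block_density d (Suc n) j (cmv_chi d M W) W) (Suc n * d) z = Fblock 0 j n z"
    by (rule schur_of_block[OF cmv_chi_eq assms(5)])
  \<comment> \<open>Passing from p = 0 to p = 1 flips the parity flag of \<open>cmv_rhs\<close>,
    which exchanges the factors L and M and with them the two tables of cases.\<close>
  have x: "schur_of M (block_density d (Suc n) j (cmv_x d M W) W) (Suc n * d) z = Fblock 1 j n z"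
    by (rule schur_of_block[OF cmv_x_eq assms(5)])
  show ?thesis
    unfolding n_def[symmetric] Let_def b f v chi x Fblock_def cmv_rhs_def k cmv_trunc_def cmv_trunc_hat_def
    using par by (cases "even j"; cases "even n") simp_all
qed

end
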